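(* Let $(G,V,E)$ be a graph. Then the space $\mathrm{Conf}_n^{\mathrm{sink}}(G,V)$ is a $K(\pi,1)$ for all $n\ge 0$.
   Context: A graph $(G,V,E)$ is a compact connected CW complex $G$ of dimension one together with its set $V$ of 0-cells (vertices) and its set $E$ of 1-cells (edges); loops and multiple edges are allowed. The $n$-th sink configuration space is $\mathrm{Conf}_n^{\mathrm{sink}}(G,V)=\{(x_1,\dots,x_n)\in G^n \mid \text{for all } i\neq j:\ x_i\neq x_j \text{ or } x_i=x_j\in V\}$, with the subspace topology from $G^n$. A $K(\pi,1)$ is a path-connected space whose homotopy groups $\pi_k$ vanish for all $k\ge 2$. *)

theory Defs
  imports "HOL-Analysis.Analysis" "HOL-Algebra.Elementary_Groups"
begin

text \<open>
  CW complexes of dimension at most one: \<open>V\<close> is the set of 0-cells, given as points, and \<open>E\<close> the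
  set of \<^emph>\<open>open\<close> 1-cells, given as subsets of the space. For an edge \<open>e\<close> with characteristic map
  \<open>\<phi>\<close>, the closed cell \<open>\<phi> ` {0..1}\<close> is the closure of \<open>e\<close>, as the space is Hausdorff. The last
  conjunct is the weak topology; the 0-cells impose no condition in it since points are closed.
  Closure-finiteness is automatic in dimension one.
\<close>

definition characteristic_map ::
    "'a topology \<Rightarrow> 'a set \<Rightarrow> 'a set \<Rightarrow> (real \<Rightarrow> 'a) \<Rightarrow> bool" where
  "characteristic_map G V e \<phi> \<longleftrightarrow>
     continuous_map (top_of_set {0..1}) G \<phi> \<and>
     \<phi> ` {0, 1} \<subseteq> V \<and>
     homeomorphic_map (top_of_set {0<..<1}) (subtopology G e) \<phi>"

definition CW_complex_1 :: "'a topology \<Rightarrow> 'a set \<Rightarrow> 'a set set \<Rightarrow> bool" where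
  "CW_complex_1 G V E \<longleftrightarrow>
     Hausdorff_space G \<and>
     V \<union> \<Union>E = topspace G \<and>
     (\<forall>e\<in>E. V \<inter> e = {}) \<and>
     pairwise disjnt E \<and>
     (\<forall>e\<in>E. \<exists>\<phi>. characteristic_map G V e \<phi>) \<and>
     (\<forall>A\<subseteq>topspace G. (\<forall>e\<in>E. closedin G (A \<inter> G closure_of e)) \<longrightarrow> closedin G A)"

text \<open>
  In the library the empty space is connected, hence the explicit nonemptiness condition here and
  in the definition of a \<open>K(\<pi>,1)\<close> below.
\<close>

definition CW_graph :: "'a topology \<Rightarrow> 'a set \<Rightarrow> 'a set set \<Rightarrow> bool" where
  "CW_graph G V E \<longleftrightarrow>
     CW_complex_1 G V E \<and> compact_space G \<and> connected_space G \<and> topspace G \<noteq> {}"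

definition sink_conf :: "nat \<Rightarrow> 'a topology \<Rightarrow> 'a set \<Rightarrow> (nat \<Rightarrow> 'a) topology" where
  "sink_conf n G V =
     subtopology (product_topology (\<lambda>_. G) {..<n})
       {x. \<forall>i<n. \<forall>j<n. i \<noteq> j \<longrightarrow> x i \<noteq> x j \<or> (x i = x j \<and> x i \<in> V)}"

text \<open>
  The homotopy group \<open>\<pi>\<^sub>k(X, x\<^sub>0)\<close>, for \<open>k \<ge> 1\<close>: homotopy classes relative to the boundary of maps
  from the \<open>k\<close>-cube to \<open>X\<close> that send the boundary to \<open>x\<^sub>0\<close>, multiplied by concatenation in the
  first coordinate. Maps are total functions, and those agreeing on the cube are homotopic, so
  their values outside the cube are immaterial.
\<close>

definition cube :: "nat \<Rightarrow> (nat \<Rightarrow> real) topology" where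
  "cube k = product_topology (\<lambda>_. top_of_set {0..1}) {..<k}"

definition cube_boundary :: "nat \<Rightarrow> (nat \<Rightarrow> real) set" where
  "cube_boundary k = {t \<in> topspace (cube k). \<exists>i<k. t i = 0 \<or> t i = 1}"

definition cube_maps :: "nat \<Rightarrow> 'a topology \<Rightarrow> 'a \<Rightarrow> ((nat \<Rightarrow> real) \<Rightarrow> 'a) set" where
  "cube_maps k X x0 =
     {f. continuous_map (cube k) X f \<and> (\<forall>t\<in>cube_boundary k. f t = x0)}"

definition cube_homotopy_rel ::
    "nat \<Rightarrow> 'a topology \<Rightarrow> 'a \<Rightarrow> (((nat \<Rightarrow> real) \<Rightarrow> 'a) \<times> ((nat \<Rightarrow> real) \<Rightarrow> 'a)) set" where
  "cube_homotopy_rel k X x0 =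
     {(f, g). f \<in> cube_maps k X x0 \<and> g \<in> cube_maps k X x0 \<and>
        homotopic_with (\<lambda>h. \<forall>t\<in>cube_boundary k. h t = x0) (cube k) X f g}"

definition cube_concat ::
    "((nat \<Rightarrow> real) \<Rightarrow> 'a) \<Rightarrow> ((nat \<Rightarrow> real) \<Rightarrow> 'a) \<Rightarrow> (nat \<Rightarrow> real) \<Rightarrow> 'a" where
  "cube_concat f g t =
     (if t 0 \<le> 1/2 then f (t(0 := 2 * t 0)) else g (t(0 := 2 * t 0 - 1)))"

definition homotopy_group ::
    "nat \<Rightarrow> 'a topology \<Rightarrow> 'a \<Rightarrow> ((nat \<Rightarrow> real) \<Rightarrow> 'a) set monoid" where
  "homotopy_group k X x0 =
     \<lparr>carrier = cube_maps k X x0 // cube_homotopy_rel k X x0,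
      monoid.mult = (\<lambda>A B. cube_homotopy_rel k X x0 `` {cube_concat f g | f g. f \<in> A \<and> g \<in> B}),
      one = cube_homotopy_rel k X x0 `` {\<lambda>_. x0}\<rparr>"

definition K_pi_1_space :: "'a topology \<Rightarrow> bool" where
  "K_pi_1_space X \<longleftrightarrow>
     topspace X \<noteq> {} \<and> path_connected_space X \<and>
     (\<forall>k\<ge>2. \<forall>x0\<in>topspace X. trivial_group (homotopy_group k X x0))"

end

theory Submission
  imports Defs
begin

text \<open>
  Why configuration spaces with sinks at the vertices are aspherical. Think of the particles of a
  configuration as sitting at vertices, except that a few of them travel along edges. Two particles
  cannot cross in the interior of an edge, so the moves that can be performed independently at a given
  moment pair distinct edges with distinct particles; up to homotopy the space is a cube complex whose
  cubes are these sets of independent moves. The moves \<open>(e, i)\<close> and \<open>(f, j)\<close> commute exactly if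
  \<open>e \<noteq> f\<close> and \<open>i \<noteq> j\<close>, hence the vertices of the universal cover are described by reduced words in
  a right-angled Artin group. Such a word is encoded as a heap: every edge and every particle carries a
  stack of signed pieces, and a move pushes a piece on the two stacks of its edge and its particle, or
  removes the piece that it cancels. The stack of a particle is the path it has travelled, which is
  why the heap alone determines the position of every particle.

  Let \<open>f\<close> map a cube of dimension \<open>k \<ge> 2\<close> to the configuration space and its boundary to one
  point. The proof stays at the level of such maps and builds no covering space.

  \<^item> Rounding every particle to an end of its edge makes \<open>f\<close> discrete, and as the cube is
  contractible, the moves between the rounded configurations can be integrated: there is a heap
  \<open>g s\<close> over every point \<open>s\<close> with \<open>g s'\<close> obtained from \<open>g s\<close> by the moves between \<open>f s\<close> and
  \<open>f s'\<close> whenever \<open>s'\<close> is close to \<open>s\<close> (\<open>exists_lift\<close>). As the boundary of the cube is connected,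
  which is where \<open>k \<ge> 2\<close> enters, \<open>g\<close> is the empty heap all along the boundary.

  \<^item> Choose a fine partition of unity. Its weights at \<open>s\<close>, put on the heaps \<open>g a\<close> of the
  centres \<open>a\<close>, sit on vertices of one cube and therefore describe a configuration, and \<open>f\<close>
  can be slid along the edges to this realization (\<open>homotopic_to_realization\<close>).

  \<^item> The realization is determined by the weights and by finitely many heaps, its labels. Every piece has
  a level, one more than the greatest level of the pieces it rests on. If \<open>m\<close> is the greatest level among
  all labels, a piece of level \<open>m\<close> has nothing on top of it in any label, so removing it from one label produces
  a heap that lies in a common cube with everything that it has to be compatible with
  (\<open>cubical_insert_pop\<close>). Moving the weight from the old label to the new one is a homotopy, and
  after finitely many such steps all labels are empty, so the map is constant
  (\<open>contract_labels\<close>).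

  All these homotopies are constant on the boundary of the cube at each time, which suffices for a
  null-homotopy relative to the boundary (\<open>null_homotopic_rel_boundary\<close>). Path connectedness is
  elementary: slide all particles to vertices, then move them one at a time.
\<close>

section \<open>Heaps of signed pieces\<close>

text \<open>
  A heap is given by its projections to edges and particles: the first component is the stack of every
  edge (whose pieces name the particle that moved), the second the stack of every particle (whose pieces
  name the edge along which it moved). The boolean is the direction of the move and the number the
  level of the piece. Commuting moves touch different stacks, so no quotient of words is needed.
\<close>

type_synonym ('e, 'i) heap = "('e \<Rightarrow> ('i \<times> bool \<times> nat) list) \<times> ('i \<Rightarrow> ('e \<times> bool \<times> nat) list)"

fun level :: "('x \<times> bool \<times> nat) list \<Rightarrow> nat" where
  "level [] = 0"
| "level ((_, _, l) # _) = l"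

definition empty_heap :: "('e, 'i) heap" where
  "empty_heap = (\<lambda>_. [], \<lambda>_. [])"

definition cancels :: "('e, 'i) heap \<Rightarrow> 'e \<Rightarrow> 'i \<Rightarrow> bool \<Rightarrow> bool" where
  "cancels p e i b \<longleftrightarrow>
     (\<exists>l m X Y. fst p e = (i, \<not> b, l) # X \<and> snd p i = (e, \<not> b, m) # Y)"

definition push :: "'e \<Rightarrow> 'i \<Rightarrow> bool \<Rightarrow> ('e, 'i) heap \<Rightarrow> ('e, 'i) heap" where
  "push e i b p =
     ((fst p)(e := (i, b, Suc (max (level (fst p e)) (level (snd p i)))) # fst p e),
      (snd p)(i := (e, b, Suc (max (level (fst p e)) (level (snd p i)))) # snd p i))"

definition pop :: "'e \<Rightarrow> 'i \<Rightarrow> ('e, 'i) heap \<Rightarrow> ('e, 'i) heap" where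
  "pop e i p = ((fst p)(e := tl (fst p e)), (snd p)(i := tl (snd p i)))"

definition move :: "'e \<Rightarrow> 'i \<Rightarrow> bool \<Rightarrow> ('e, 'i) heap \<Rightarrow> ('e, 'i) heap" where
  "move e i b p = (if cancels p e i b then pop e i p else push e i b p)"

text \<open>
  These are the heaps of reduced words: no move undoes the one just below it.
\<close>

inductive reduced_heap :: "('e, 'i) heap \<Rightarrow> bool" where
  reduced_empty: "reduced_heap empty_heap"
| reduced_push: "reduced_heap p \<Longrightarrow> \<not> cancels p e i b \<Longrightarrow> reduced_heap (push e i b p)"

lemma heap_eqI:
  assumes "\<And>e. fst p e = fst q e" "\<And>i. snd p i = snd q i"
  shows "p = q"
  using assms by (auto simp: prod_eq_iff)

lemma pop_push_commute:
  "e \<noteq> f \<Longrightarrow> i \<noteq> j \<Longrightarrow> pop e i (push f j c p) = push f j c (pop e i p)"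
  by (rule heap_eqI) (auto simp: push_def pop_def)

text \<open>
  A piece on top of both of its stacks could have been the last one pushed, because all later pieces
  commute with it. Hence removing it leaves a reduced heap, on which the piece can be pushed again.
\<close>

lemma reduced_pop:
  assumes "reduced_heap p" "fst p e = (i, b, l) # X" "snd p i = (e, c, m) # Y"
  shows "c = b \<and> m = l \<and> l = Suc (max (level X) (level Y)) \<and>
         reduced_heap (pop e i p) \<and> \<not> cancels (pop e i p) e i b"
  using assms
proof (induction arbitrary: X Y rule: reduced_heap.induct)
  case reduced_empty
  then show ?case by (simp add: empty_heap_def)
next
  case (reduced_push p f j d)
  show ?case
  proof (cases "e = f \<and> i = j")
    case True
    then have "pop e i (push f j d p) = p"
      by (auto intro!: heap_eqI simp: pop_def push_def)
    with True reduced_push show ?thesis by (auto simp: push_def)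
  next
    case False
    with reduced_push.prems have ne: "e \<noteq> f" "i \<noteq> j"
      by (auto simp: push_def split: if_splits)
    with reduced_push.prems have tops: "fst p e = (i, b, l) # X" "snd p i = (e, c, m) # Y"
      by (auto simp: push_def)
    note IH = reduced_push.IH[OF tops]
    have "\<not> cancels (pop e i p) f j d"
      using reduced_push.hyps ne by (auto simp: cancels_def pop_def)
    with IH have "reduced_heap (push f j d (pop e i p))"
      by (auto intro: reduced_heap.reduced_push)
    moreover have "\<not> cancels (push f j d (pop e i p)) e i b"
      using IH ne by (auto simp: cancels_def push_def)
    ultimately show ?thesis
      using IH ne by (simp add: pop_push_commute)
  qed
qed

text \<open>
  A piece occurs in the stack of its edge and in the stack of its particle, and levels increase
  upwards. So a top piece of an edge that is as high as the top of the stack of its particle is the top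
  piece of that stack as well; in particular a piece of maximal level is removable.
\<close>

lemma reduced_level:
  assumes "reduced_heap p"
  shows "fst p e = (i, b, l) # X \<Longrightarrow>
           level X < l \<and> l \<le> level (snd p i) \<and> (level (snd p i) = l \<longrightarrow> (\<exists>Y. snd p i = (e, b, l) # Y))"
    and "snd p i = (e, b, l) # Y \<Longrightarrow>
           level Y < l \<and> l \<le> level (fst p e) \<and> (level (fst p e) = l \<longrightarrow> (\<exists>X. fst p e = (i, b, l) # X))"
  using assms
proof (induction arbitrary: e i b l X Y rule: reduced_heap.induct)
  case reduced_empty
  {
    case 1 then show ?case by (simp add: empty_heap_def)
  next
    case 2 then show ?case by (simp add: empty_heap_def)
  }
next
  case (reduced_push p f j c)
  {
    case 1
    show ?case
    proof (cases "e = f")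
      case True
      with 1 show ?thesis by (auto simp: push_def)
    next
      case False
      with 1 have "fst p e = (i, b, l) # X" by (simp add: push_def)
      with reduced_push.IH(1)[OF this] False show ?thesis by (auto simp: push_def)
    qed
  next
    case 2
    show ?case
    proof (cases "i = j")
      case True
      with 2 show ?thesis by (auto simp: push_def)
    next
      case False
      with 2 have "snd p i = (e, b, l) # Y" by (simp add: push_def)
      with reduced_push.IH(2)[OF this] False show ?thesis by (auto simp: push_def)
    qed
  }
qed

lemma reduced_move: "reduced_heap p \<Longrightarrow> reduced_heap (move e i b p)"
  unfolding move_def using reduced_pop[of p e i] by (auto simp: cancels_def intro: reduced_push)

lemma push_pop:
  assumes "reduced_heap p" "fst p e = (i, b, l) # X" "snd p i = (e, c, m) # Y"
  shows "push e i b (pop e i p) = p"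
  using assms reduced_pop[OF assms] by (intro heap_eqI) (auto simp: push_def pop_def)

text \<open>
  Opposite moves are inverse to each other only on reduced heaps: elsewhere, undoing a cancellation could
  cancel again.
\<close>

lemma move_inverse:
  assumes "reduced_heap p"
  shows "move e i (\<not> b) (move e i b p) = p"
proof (cases "cancels p e i b")
  case True
  then obtain l m X Y where tops: "fst p e = (i, \<not> b, l) # X" "snd p i = (e, \<not> b, m) # Y"
    by (auto simp: cancels_def)
  then show ?thesis
    using True reduced_pop[OF assms tops] push_pop[OF assms tops] by (simp add: move_def)
next
  case False
  have "cancels (push e i b p) e i (\<not> b)"
    by (auto simp: cancels_def push_def)
  moreover have "pop e i (push e i b p) = p"
    by (auto intro!: heap_eqI simp: pop_def push_def)
  ultimately show ?thesis
    using False by (simp add: move_def)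
qed

lemma fst_move_other: "e \<noteq> f \<Longrightarrow> fst (move e i b p) f = fst p f"
  by (simp add: move_def push_def pop_def)

lemma snd_move_other: "i \<noteq> j \<Longrightarrow> snd (move e i b p) j = snd p j"
  by (simp add: move_def push_def pop_def)

lemma move_local:
  assumes "fst p e = fst q e" "snd p i = snd q i"
  shows "fst (move e i b p) e = fst (move e i b q) e" "snd (move e i b p) i = snd (move e i b q) i"
  using assms by (auto simp: move_def push_def pop_def cancels_def)

primrec transport :: "nat \<Rightarrow> (nat \<Rightarrow> ('e \<times> bool) option) \<Rightarrow> ('e, nat) heap \<Rightarrow> ('e, nat) heap" where
  "transport 0 \<kappa> p = p"
| "transport (Suc n) \<kappa> p =
     (case \<kappa> n of None \<Rightarrow> transport n \<kappa> p | Some (e, b) \<Rightarrow> move e n b (transport n \<kappa> p))"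

text \<open>
  In a small region of the configuration space, \<open>\<epsilon> i\<close> is the edge across whose midpoint particle
  \<open>i\<close> may move, if there is one, and \<open>\<beta>\<close>, \<open>\<gamma>\<close> record on which side the particles are before
  and after.
\<close>

definition shift :: "(nat \<Rightarrow> 'e option) \<Rightarrow> (nat \<Rightarrow> bool) \<Rightarrow> (nat \<Rightarrow> bool) \<Rightarrow> nat \<Rightarrow> ('e \<times> bool) option" where
  "shift \<epsilon> \<beta> \<gamma> i = (case \<epsilon> i of None \<Rightarrow> None | Some e \<Rightarrow> if \<beta> i = \<gamma> i then None else Some (e, \<gamma> i))"

definition matching :: "nat \<Rightarrow> (nat \<Rightarrow> 'e option) \<Rightarrow> bool" where
  "matching n \<epsilon> \<longleftrightarrow> (\<forall>i<n. \<forall>j<n. \<forall>e. \<epsilon> i = Some e \<and> \<epsilon> j = Some e \<longrightarrow> i = j)"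

lemma reduced_transport: "reduced_heap p \<Longrightarrow> reduced_heap (transport n \<kappa> p)"
  by (induction n) (auto simp: reduced_move split: option.split prod.split)

lemma transport_cong: "(\<And>i. i < n \<Longrightarrow> \<kappa> i = \<psi> i) \<Longrightarrow> transport n \<kappa> p = transport n \<psi> p"
  by (induction n) (auto split: option.split)

lemma transport_none: "(\<And>i. i < n \<Longrightarrow> \<kappa> i = None) \<Longrightarrow> transport n \<kappa> p = p"
  by (induction n) auto

lemma fst_transport_other:
  "(\<And>i b. i < n \<Longrightarrow> \<kappa> i \<noteq> Some (e, b)) \<Longrightarrow> fst (transport n \<kappa> p) e = fst p e"
proof (induction n)
  case (Suc n)
  show ?case
  proof (cases "\<kappa> n")
    case None
    with Suc show ?thesis by simp
  next
    case (Some x)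
    then obtain f b where x: "\<kappa> n = Some (f, b)" by (cases x) auto
    with Suc.prems[of n b] have "f \<noteq> e" by auto
    with Suc x show ?thesis by (simp add: fst_move_other)
  qed
qed simp

lemma snd_transport_other:
  "(i < n \<Longrightarrow> \<kappa> i = None) \<Longrightarrow> snd (transport n \<kappa> p) i = snd p i"
proof (induction n)
  case (Suc n)
  then show ?case
    by (cases "i = n") (auto simp: snd_move_other split: option.split prod.split)
qed simp

lemma transport_at:
  assumes "\<And>j b'. j < n \<Longrightarrow> \<kappa> j = Some (e, b') \<Longrightarrow> j = i" "i < n" "\<kappa> i = Some (e, b)"
  shows "fst (transport n \<kappa> p) e = fst (move e i b p) e \<and>
         snd (transport n \<kappa> p) i = snd (move e i b p) i"
  using assms
proof (induction n)
  case (Suc n)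
  show ?case
  proof (cases "i = n")
    case True
    have "fst (transport n \<kappa> p) e = fst p e"
    proof (rule fst_transport_other)
      show "\<kappa> j \<noteq> Some (e, b')" if "j < n" for j b'
        using Suc.prems(1)[of j b'] that True by auto
    qed
    moreover have "snd (transport n \<kappa> p) i = snd p i"
      by (rule snd_transport_other) (use True in simp)
    ultimately show ?thesis
      using True Suc.prems(3) move_local[of "transport n \<kappa> p" e p i b] by simp
  next
    case False
    have "fst (transport n \<kappa> p) e = fst (move e i b p) e \<and>
         snd (transport n \<kappa> p) i = snd (move e i b p) i"
    proof (rule Suc.IH)
      show "j = i" if "j < n" "\<kappa> j = Some (e, b')" for j b'
        using Suc.prems(1)[of j b'] that by simp
    qed (use Suc.prems(2,3) False in simp_all)
    then have IH: "fst (transport n \<kappa> p) e = fst (move e i b p) e"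
      "snd (transport n \<kappa> p) i = snd (move e i b p) i" by simp_all
    show ?thesis
    proof (cases "\<kappa> n")
      case None
      with IH show ?thesis by simp
    next
      case (Some x)
      then obtain f c where x: "\<kappa> n = Some (f, c)" by (cases x) auto
      with Suc.prems(1)[of n c] False have "f \<noteq> e" by auto
      with IH x False show ?thesis by (simp add: fst_move_other snd_move_other)
    qed
  qed
qed simp

text \<open>
  Since no two particles share an edge of the matching, the moves act independently.
\<close>

lemma shift_at:
  assumes "matching n \<epsilon>" "i < n" "\<epsilon> i = Some e" "reduced_heap p"
  shows "\<beta> i = \<gamma> i \<Longrightarrow> fst (transport n (shift \<epsilon> \<beta> \<gamma>) p) e = fst p e \<and>
                         snd (transport n (shift \<epsilon> \<beta> \<gamma>) p) i = snd p i"
    and "\<beta> i \<noteq> \<gamma> i \<Longrightarrow> fst (transport n (shift \<epsilon> \<beta> \<gamma>) p) e = fst (move e i (\<gamma> i) p) e \<and>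
                         snd (transport n (shift \<epsilon> \<beta> \<gamma>) p) i = snd (move e i (\<gamma> i) p) i"
proof -
  have uniq: "j = i" if "j < n" "shift \<epsilon> \<beta> \<gamma> j = Some (e, b')" for j b'
  proof -
    have "\<epsilon> j = Some e" using that(2) by (simp add: shift_def split: option.splits if_split_asm)
    then show ?thesis using assms(1-3) that(1) unfolding matching_def by blast
  qed
  show "fst (transport n (shift \<epsilon> \<beta> \<gamma>) p) e = fst p e \<and>
                         snd (transport n (shift \<epsilon> \<beta> \<gamma>) p) i = snd p i" if "\<beta> i = \<gamma> i"
  proof
    have none: "shift \<epsilon> \<beta> \<gamma> i = None" using that assms by (simp add: shift_def)
    then show "snd (transport n (shift \<epsilon> \<beta> \<gamma>) p) i = snd p i" by (rule snd_transport_other)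
    show "fst (transport n (shift \<epsilon> \<beta> \<gamma>) p) e = fst p e"
    proof (rule fst_transport_other)
      show "shift \<epsilon> \<beta> \<gamma> j \<noteq> Some (e, b)" if "j < n" for j b
        using uniq[OF that] none by fastforce
    qed
  qed
  show "fst (transport n (shift \<epsilon> \<beta> \<gamma>) p) e = fst (move e i (\<gamma> i) p) e \<and>
        snd (transport n (shift \<epsilon> \<beta> \<gamma>) p) i = snd (move e i (\<gamma> i) p) i" if "\<beta> i \<noteq> \<gamma> i"
  proof (rule transport_at)
    show "j = i" if "j < n" "shift \<epsilon> \<beta> \<gamma> j = Some (e, b')" for j b'
      using that by (rule uniq)
    show "i < n" by fact
    show "shift \<epsilon> \<beta> \<gamma> i = Some (e, \<gamma> i)" using that assms(3) by (simp add: shift_def)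
  qed
qed

lemma shift_off:
  shows "(\<And>i. i < n \<Longrightarrow> \<epsilon> i \<noteq> Some e) \<Longrightarrow> fst (transport n (shift \<epsilon> \<beta> \<gamma>) p) e = fst p e"
    and "(i < n \<Longrightarrow> \<epsilon> i = None) \<Longrightarrow> snd (transport n (shift \<epsilon> \<beta> \<gamma>) p) i = snd p i"
proof -
  assume off: "\<And>i. i < n \<Longrightarrow> \<epsilon> i \<noteq> Some e"
  have "shift \<epsilon> \<beta> \<gamma> i \<noteq> Some (e, b)" if "i < n" for i b
    using off[OF that] by (simp add: shift_def split: option.split)
  then show "fst (transport n (shift \<epsilon> \<beta> \<gamma>) p) e = fst p e" by (rule fst_transport_other)
next
  assume "i < n \<Longrightarrow> \<epsilon> i = None"
  then show "snd (transport n (shift \<epsilon> \<beta> \<gamma>) p) i = snd p i"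
    by (intro snd_transport_other) (simp add: shift_def)
qed

text \<open>
  This cocycle identity is what makes the integration of moves along paths possible.
\<close>

lemma shift_shift:
  assumes "matching n \<epsilon>" "reduced_heap p"
  shows "transport n (shift \<epsilon> \<gamma> \<delta>) (transport n (shift \<epsilon> \<beta> \<gamma>) p) = transport n (shift \<epsilon> \<beta> \<delta>) p"
proof -
  define q where "q = transport n (shift \<epsilon> \<beta> \<gamma>) p"
  define l where "l = transport n (shift \<epsilon> \<gamma> \<delta>) q"
  define r where "r = transport n (shift \<epsilon> \<beta> \<delta>) p"
  have q: "reduced_heap q" unfolding q_def by (rule reduced_transport) fact
  have on: "fst l e = fst r e \<and> snd l i = snd r i" if i: "i < n" "\<epsilon> i = Some e" for i e
  proof -
    note at1 = shift_at[OF assms(1) i assms(2), of \<beta> \<gamma>, folded q_def]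
    note at2 = shift_at[OF assms(1) i q, of \<gamma> \<delta>, folded l_def]
    note at3 = shift_at[OF assms(1) i assms(2), of \<beta> \<delta>, folded r_def]
    show ?thesis
    proof (cases "\<beta> i = \<gamma> i")
      case True
      note loc = move_local[of q e p i, OF conjunct1[OF at1(1)[OF True]] conjunct2[OF at1(1)[OF True]]]
      show ?thesis
        using True at1(1) at2 at3 loc by (cases "\<gamma> i = \<delta> i") simp_all
    next
      case False
      note loc = move_local[of q e "move e i (\<gamma> i) p" i, OF conjunct1[OF at1(2)[OF False]] conjunct2[OF at1(2)[OF False]]]
      show ?thesis
      proof (cases "\<gamma> i = \<delta> i")
        case True
        with False show ?thesis using at1(2) at2(1) at3(2) by simp
      next
        case F: False
        then have \<delta>: "\<delta> i = (\<not> \<gamma> i)" "\<beta> i = \<delta> i" using False by auto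
        show ?thesis
          using at2(2)[OF F] at3(1)[OF \<delta>(2)] loc[of "\<delta> i"] move_inverse[OF assms(2), of e i "\<gamma> i"]
          unfolding \<delta>(1) by simp
      qed
    qed
  qed
  have "l = r"
  proof (rule heap_eqI)
    fix e
    show "fst l e = fst r e"
    proof (cases "\<exists>i<n. \<epsilon> i = Some e")
      case True
      then obtain i where "i < n" "\<epsilon> i = Some e" by auto
      from on[OF this] show ?thesis ..
    next
      case False
      then have "\<And>i. i < n \<Longrightarrow> \<epsilon> i \<noteq> Some e" by auto
      note off = shift_off(1)[where \<epsilon> = \<epsilon>, OF this]
      show ?thesis
        using off[of _ \<gamma> \<delta> q] off[of _ \<beta> \<gamma> p] off[of _ \<beta> \<delta> p] unfolding l_def r_def q_def by simp
    qed
  next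
    fix i
    show "snd l i = snd r i"
    proof (cases "i < n \<and> \<epsilon> i \<noteq> None")
      case True
      then obtain e where "i < n" "\<epsilon> i = Some e" by auto
      from on[OF this] show ?thesis ..
    next
      case False
      then have "i < n \<Longrightarrow> \<epsilon> i = None" by auto
      note off = shift_off(2)[where \<epsilon> = \<epsilon>, OF this]
      show ?thesis
        using off[of _ \<gamma> \<delta> q] off[of _ \<beta> \<gamma> p] off[of _ \<beta> \<delta> p] unfolding l_def r_def q_def by simp
    qed
  qed
  then show ?thesis by (simp only: l_def r_def q_def)
qed

text \<open>
  The heaps of \<open>A\<close> are among the vertices of one cube of the universal cover. The matching \<open>N\<close> names
  the directions of the cube; along each of them every heap either has or lacks one particular top
  piece. This formulation singles out no base vertex.
\<close>

locale cubical_via =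
  fixes N :: "('e \<times> 'i) set" and A :: "('e, 'i) heap set"
  assumes one_particle: "(e, i) \<in> N \<Longrightarrow> (e, j) \<in> N \<Longrightarrow> i = j"
    and one_edge: "(e, i) \<in> N \<Longrightarrow> (f, i) \<in> N \<Longrightarrow> e = f"
    and edge_constant: "(\<And>i. (e, i) \<notin> N) \<Longrightarrow> p \<in> A \<Longrightarrow> q \<in> A \<Longrightarrow> fst p e = fst q e"
    and particle_constant: "(\<And>e. (e, i) \<notin> N) \<Longrightarrow> p \<in> A \<Longrightarrow> q \<in> A \<Longrightarrow> snd p i = snd q i"
    and direction: "(e, i) \<in> N \<Longrightarrow> \<exists>b l X Y. \<forall>p\<in>A.
      (fst p e = X \<and> snd p i = Y) \<or> (fst p e = (i, b, l) # X \<and> snd p i = (e, b, l) # Y)"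

definition cubical :: "('e, 'i) heap set \<Rightarrow> bool" where
  "cubical A \<longleftrightarrow> (\<exists>N. cubical_via N A)"

lemma cubical_subset:
  assumes "cubical A" "B \<subseteq> A"
  shows "cubical B"
proof -
  obtain N where "cubical_via N A" using assms(1) unfolding cubical_def ..
  then interpret cubical_via N A .
  have ball: "\<forall>p\<in>B. P p" if "\<forall>p\<in>A. P p" for P using that assms(2) by blast
  have "cubical_via N B"
  proof
    show "i = j" if "(e, i) \<in> N" "(e, j) \<in> N" for e i j using that by (rule one_particle)
    show "e = f" if "(e, i) \<in> N" "(f, i) \<in> N" for e f i using that by (rule one_edge)
    show "fst p e = fst q e" if "\<And>i. (e, i) \<notin> N" "p \<in> B" "q \<in> B" for e p q
      by (rule edge_constant[OF that(1) subsetD[OF assms(2) that(2)] subsetD[OF assms(2) that(3)]])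
    show "snd p i = snd q i" if "\<And>e. (e, i) \<notin> N" "p \<in> B" "q \<in> B" for i p q
      by (rule particle_constant[OF that(1) subsetD[OF assms(2) that(2)] subsetD[OF assms(2) that(3)]])
    show "\<exists>b l X Y. \<forall>p\<in>B.
        (fst p e = X \<and> snd p i = Y) \<or> (fst p e = (i, b, l) # X \<and> snd p i = (e, b, l) # Y)"
      if "(e, i) \<in> N" for e i
      using direction[OF that] by (elim ex_forward, intro ball)
  qed
  then show ?thesis unfolding cubical_def ..
qed

text \<open>
  Whether crossing the midpoint of an edge pushes a piece or cancels one, the heaps on the two sides differ
  by the presence of one top piece.
\<close>

lemma cubical_shift:
  assumes "matching n \<epsilon>" "reduced_heap p"
  shows "cubical (range (\<lambda>\<gamma>. transport n (shift \<epsilon> \<beta> \<gamma>) p))"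
proof -
  define N where "N = {(e, i). i < n \<and> \<epsilon> i = Some e}"
  let ?T = "\<lambda>\<gamma>. transport n (shift \<epsilon> \<beta> \<gamma>) p"
  have "cubical_via N (range ?T)"
  proof
    show "i = j" if "(e, i) \<in> N" "(e, j) \<in> N" for e i j
      using that assms(1) unfolding N_def matching_def by blast
    show "e = f" if "(e, i) \<in> N" "(f, i) \<in> N" for e f i
      using that by (simp add: N_def)
    show "fst q e = fst r e" if off: "\<And>i. (e, i) \<notin> N" and qr: "q \<in> range ?T" "r \<in> range ?T" for e q r
    proof -
      have "fst (?T \<gamma>) e = fst p e" for \<gamma> using off by (intro shift_off(1)) (simp add: N_def)
      then show ?thesis using qr by fastforce
    qed
    show "snd q i = snd r i" if off: "\<And>e. (e, i) \<notin> N" and qr: "q \<in> range ?T" "r \<in> range ?T" for i q r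
    proof -
      have "snd (?T \<gamma>) i = snd p i" for \<gamma>
        using off by (intro shift_off(2)) (cases "\<epsilon> i"; fastforce simp: N_def)
      then show ?thesis using qr by fastforce
    qed
    fix e i assume "(e, i) \<in> N"
    then have i: "i < n" "\<epsilon> i = Some e" by (auto simp: N_def)
    have eq: "fst (?T \<gamma>) e = (if \<beta> i = \<gamma> i then fst p e else fst (move e i (\<not> \<beta> i) p) e)"
      "snd (?T \<gamma>) i = (if \<beta> i = \<gamma> i then snd p i else snd (move e i (\<not> \<beta> i) p) i)" for \<gamma>
      using shift_at[OF assms(1) i assms(2), of \<beta> \<gamma>] by (cases "\<beta> i"; cases "\<gamma> i"; simp)+
    show "\<exists>b l X Y. \<forall>q\<in>range ?T. (fst q e = X \<and> snd q i = Y) \<or>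
        (fst q e = (i, b, l) # X \<and> snd q i = (e, b, l) # Y)"
    proof (cases "cancels p e i (\<not> \<beta> i)")
      case True
      then obtain l m X Y where tops: "fst p e = (i, \<beta> i, l) # X" "snd p i = (e, \<beta> i, m) # Y"
        by (auto simp: cancels_def)
      moreover have "m = l" using reduced_pop[OF assms(2) tops] by simp
      moreover have "fst (move e i (\<not> \<beta> i) p) e = X" "snd (move e i (\<not> \<beta> i) p) i = Y"
        using True tops by (simp_all add: move_def pop_def)
      ultimately have "(fst (?T \<gamma>) e = X \<and> snd (?T \<gamma>) i = Y) \<or>
          (fst (?T \<gamma>) e = (i, \<beta> i, l) # X \<and> snd (?T \<gamma>) i = (e, \<beta> i, l) # Y)" for \<gamma>
        unfolding eq by presburger
      then show ?thesis
        by (intro exI[of _ "\<beta> i"] exI[of _ l] exI[of _ X] exI[of _ Y]) (simp only: ball_simps, blast)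
    next
      case False
      let ?l = "Suc (max (level (fst p e)) (level (snd p i)))"
      have "fst (move e i (\<not> \<beta> i) p) e = (i, \<not> \<beta> i, ?l) # fst p e"
        "snd (move e i (\<not> \<beta> i) p) i = (e, \<not> \<beta> i, ?l) # snd p i"
        using False by (simp_all add: move_def push_def)
      then have "(fst (?T \<gamma>) e = fst p e \<and> snd (?T \<gamma>) i = snd p i) \<or>
          (fst (?T \<gamma>) e = (i, \<not> \<beta> i, ?l) # fst p e \<and> snd (?T \<gamma>) i = (e, \<not> \<beta> i, ?l) # snd p i)" for \<gamma>
        unfolding eq by presburger
      then show ?thesis
        by (intro exI[of _ "\<not> \<beta> i"] exI[of _ ?l] exI[of _ "fst p e"] exI[of _ "snd p i"])
          (simp only: ball_simps, blast)
    qed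
  qed
  then show ?thesis unfolding cubical_def ..
qed

text \<open>
  The key step of the contraction. If \<open>r\<close> carries a piece \<open>(e, i)\<close> of the greatest level occurring in
  \<open>A\<close>, no member of \<open>A\<close> has anything above that piece. Therefore the directions of the cube that
  involve \<open>e\<close> or \<open>i\<close>, but not both, are not used by \<open>A\<close> and can be traded for the direction \<open>(e, i)\<close>,
  which leads to the heap without the piece.
\<close>

lemma cubical_insert_pop:
  assumes A: "cubical A" "r \<in> A" "\<And>q. q \<in> A \<Longrightarrow> reduced_heap q"
    and top: "fst r e = (i, b, k) # X0" "snd r i = (e, b, k) # Y0"
    and max: "\<And>q f. q \<in> A \<Longrightarrow> level (fst q f) \<le> k" "\<And>q j. q \<in> A \<Longrightarrow> level (snd q j) \<le> k"
  shows "cubical (insert (pop e i r) A)"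
proof -
  obtain N where "cubical_via N A" using A(1) unfolding cubical_def ..
  then interpret cubical_via N A .
  \<comment> \<open>a piece on top of the one of \<open>r\<close> would have a level above \<open>k\<close>\<close>
  have above: "fst q f \<noteq> (j, c, l) # fst r e" "snd q j \<noteq> (f, c, l) # snd r i" if "q \<in> A" for q f j c l
  proof -
    show "fst q f \<noteq> (j, c, l) # fst r e"
      using reduced_level(1)[OF A(3)[OF that], of f j c l "fst r e"] max(1)[OF that, of f] top by force
    show "snd q j \<noteq> (f, c, l) # snd r i"
      using reduced_level(2)[OF A(3)[OF that], of j f c l "snd r i"] max(2)[OF that, of j] top by force
  qed
  \<comment> \<open>the second variant of such a direction would have a piece on top of the one of \<open>r\<close>\<close>
  have drop_i: "fst q f = fst r f \<and> snd q i = snd r i" if fi: "(f, i) \<in> N" and fe: "f \<noteq> e" and q: "q \<in> A" for f q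
  proof -
    obtain b' l X Y where v: "\<forall>p\<in>A. (fst p f = X \<and> snd p i = Y) \<or>
        (fst p f = (i, b', l) # X \<and> snd p i = (f, b', l) # Y)" using direction[OF fi] by blast
    with A(2) top(2) fe have r: "fst r f = X \<and> snd r i = Y" by force
    with v q above(2)[OF q, of i f b' l] show ?thesis by auto
  qed
  have drop_e: "fst q e = fst r e \<and> snd q j = snd r j" if ej: "(e, j) \<in> N" and ji: "j \<noteq> i" and q: "q \<in> A" for j q
  proof -
    obtain b' l X Y where v: "\<forall>p\<in>A. (fst p e = X \<and> snd p j = Y) \<or>
        (fst p e = (j, b', l) # X \<and> snd p j = (e, b', l) # Y)" using direction[OF ej] by blast
    with A(2) top(1) ji have r: "fst r e = X \<and> snd r j = Y" by force
    with v q above(1)[OF q, of e j b' l] show ?thesis by auto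
  qed
  have at: "(fst q e = X0 \<and> snd q i = Y0) \<or> (fst q e = (i, b, k) # X0 \<and> snd q i = (e, b, k) # Y0)"
    if q: "q \<in> A" for q
  proof (cases "(e, i) \<in> N")
    case True
    obtain b' l X Y where v: "\<forall>p\<in>A. (fst p e = X \<and> snd p i = Y) \<or>
        (fst p e = (i, b', l) # X \<and> snd p i = (e, b', l) # Y)" using direction[OF True] by blast
    then consider "fst r e = X \<and> snd r i = Y"
      | "fst r e = (i, b', l) # X \<and> snd r i = (e, b', l) # Y" using A(2) by blast
    then show ?thesis
    proof cases
      case 1
      with v q above(1)[OF q, of e i b' l] have "fst q e = fst r e \<and> snd q i = snd r i" by auto
      then show ?thesis using top by simp
    next
      case 2
      then show ?thesis using v q top by auto
    qed
  next
    case False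
    have "fst q e = fst r e"
    proof (cases "\<exists>j. (e, j) \<in> N")
      case True
      then obtain j where j: "(e, j) \<in> N" ..
      with False have "j \<noteq> i" by auto
      from drop_e[OF j this q] show ?thesis ..
    next
      case F: False
      then have "(e, j) \<notin> N" for j by auto
      from edge_constant[OF this q A(2)] show ?thesis .
    qed
    moreover have "snd q i = snd r i"
    proof (cases "\<exists>f. (f, i) \<in> N")
      case True
      then obtain f where j: "(f, i) \<in> N" ..
      with False have "f \<noteq> e" by auto
      from drop_i[OF j this q] show ?thesis ..
    next
      case F: False
      then have "(f, i) \<notin> N" for f by auto
      from particle_constant[OF this q A(2)] show ?thesis .
    qed
    ultimately show ?thesis using top by simp
  qed
  have off_e: "fst q f = fst r f" if f: "\<And>j. (f, j) \<in> N \<Longrightarrow> f = e \<or> j = i" "f \<noteq> e" "q \<in> A" for f q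
  proof (cases "(f, i) \<in> N")
    case True
    from drop_i[OF this f(2,3)] show ?thesis ..
  next
    case False
    then have "(f, j) \<notin> N" for j using f(1)[of j] f(2) by auto
    from edge_constant[OF this f(3) A(2)] show ?thesis .
  qed
  have off_i: "snd q j = snd r j" if f: "\<And>f. (f, j) \<in> N \<Longrightarrow> f = e \<or> j = i" "j \<noteq> i" "q \<in> A" for j q
  proof (cases "(e, j) \<in> N")
    case True
    from drop_e[OF this f(2,3)] show ?thesis ..
  next
    case False
    then have "(f', j) \<notin> N" for f' using f(1)[of f'] f(2) by auto
    from particle_constant[OF this f(3) A(2)] show ?thesis .
  qed
  have pop: "fst (pop e i r) f = (if f = e then X0 else fst r f)"
    "snd (pop e i r) j = (if j = i then Y0 else snd r j)" for f j
    using top by (simp_all add: pop_def)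
  define N' where "N' = insert (e, i) {(f, j) \<in> N. f \<noteq> e \<and> j \<noteq> i}"
  have "cubical_via N' (insert (pop e i r) A)"
  proof
    show "j = j'" if "(f, j) \<in> N'" "(f, j') \<in> N'" for f j j'
      using that one_particle[of f j j'] unfolding N'_def by blast
    show "f = f'" if "(f, j) \<in> N'" "(f', j) \<in> N'" for f f' j
      using that one_edge[of f j f'] unfolding N'_def by blast
    show "fst p f = fst q f" if off: "\<And>j. (f, j) \<notin> N'" and pq: "p \<in> insert (pop e i r) A" "q \<in> insert (pop e i r) A"
      for f p q
    proof -
      have fe: "f \<noteq> e" using off[of i] by (auto simp: N'_def)
      have fN: "f = e \<or> j = i" if "(f, j) \<in> N" for j using off[of j] that by (simp add: N'_def)
      have "fst q f = fst r f" if q: "q \<in> insert (pop e i r) A" for q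
      proof (cases "q = pop e i r")
        case True
        then show ?thesis using fe pop(1) by simp
      next
        case False
        with q have "q \<in> A" by blast
        from off_e[OF fN fe this] show ?thesis .
      qed
      from this[OF pq(1)] this[OF pq(2)] show ?thesis by simp
    qed
    show "snd p j = snd q j" if off: "\<And>f. (f, j) \<notin> N'" and pq: "p \<in> insert (pop e i r) A" "q \<in> insert (pop e i r) A"
      for j p q
    proof -
      have ji: "j \<noteq> i" using off[of e] by (auto simp: N'_def)
      have fN: "f = e \<or> j = i" if "(f, j) \<in> N" for f using off[of f] that by (simp add: N'_def)
      have "snd q j = snd r j" if q: "q \<in> insert (pop e i r) A" for q
      proof (cases "q = pop e i r")
        case True
        then show ?thesis using ji pop(2) by simp
      next
        case False
        with q have "q \<in> A" by blast
        from off_i[OF fN ji this] show ?thesis .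
      qed
      from this[OF pq(1)] this[OF pq(2)] show ?thesis by simp
    qed
    fix f j assume "(f, j) \<in> N'"
    then consider "f = e" "j = i" | "(f, j) \<in> N" "f \<noteq> e" "j \<noteq> i" by (auto simp: N'_def)
    then show "\<exists>b l X Y. \<forall>p\<in>insert (pop e i r) A. (fst p f = X \<and> snd p j = Y) \<or>
        (fst p f = (j, b, l) # X \<and> snd p j = (f, b, l) # Y)"
    proof cases
      case 1
      then show ?thesis using at pop
        by (intro exI[of _ b] exI[of _ k] exI[of _ X0] exI[of _ Y0]) simp
    next
      case 2
      obtain b' l X Y where v: "\<forall>p\<in>A. (fst p f = X \<and> snd p j = Y) \<or>
          (fst p f = (j, b', l) # X \<and> snd p j = (f, b', l) # Y)" using direction[OF 2(1)] by blast
      show ?thesis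
      proof (intro exI[of _ b'] exI[of _ l] exI[of _ X] exI[of _ Y] ballI)
        fix q assume "q \<in> insert (pop e i r) A"
        then consider "q = pop e i r" | "q \<in> A" by blast
        then show "(fst q f = X \<and> snd q j = Y) \<or> (fst q f = (j, b', l) # X \<and> snd q j = (f, b', l) # Y)"
        proof cases
          case 1
          then show ?thesis using bspec[OF v A(2)] 2 pop(1)[of f] pop(2)[of j] by simp
        next
          case 2
          then show ?thesis using v by blast
        qed
      qed
    qed
  qed
  then show ?thesis unfolding cubical_def ..
qed

section \<open>Compact graphs\<close>

text \<open>
  Fixing the characteristic maps orients the edges, so that the two ends of a loop can be told apart.
\<close>

locale cw_graph =
  fixes G :: "'a topology" and V :: "'a set" and E :: "'a set set" and \<phi> :: "'a set \<Rightarrow> real \<Rightarrow> 'a"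
  assumes graph: "CW_graph G V E"
    and char: "e \<in> E \<Longrightarrow> characteristic_map G V e (\<phi> e)"
begin

lemma hausdorff: "Hausdorff_space G" and compact: "compact_space G"
  and connected: "connected_space G" and nonempty: "topspace G \<noteq> {}"
  and space: "topspace G = V \<union> \<Union>E"
  using graph by (auto simp: CW_graph_def CW_complex_1_def)

lemma vertex_in: "v \<in> V \<Longrightarrow> v \<in> topspace G"
  by (simp add: space)

lemma edge_map_cont: "e \<in> E \<Longrightarrow> continuous_map (top_of_set {0..1}) G (\<phi> e)"
  using char by (simp add: characteristic_map_def)

lemma edge_ends: "e \<in> E \<Longrightarrow> \<phi> e 0 \<in> V" "e \<in> E \<Longrightarrow> \<phi> e 1 \<in> V"
  using char[of e] by (simp_all add: characteristic_map_def)

lemma edge_image: "e \<in> E \<Longrightarrow> \<phi> e ` {0<..<1} = e"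
proof -
  assume e: "e \<in> E"
  then have "\<phi> e ` topspace (top_of_set {0<..<1}) = topspace (subtopology G e)"
    using char[OF e] by (intro homeomorphic_imp_surjective_map) (simp add: characteristic_map_def)
  moreover have "e \<subseteq> topspace G" using e space by blast
  ultimately show ?thesis by (simp add: Int_absorb1)
qed

lemma edge_inj: "e \<in> E \<Longrightarrow> inj_on (\<phi> e) {0<..<1}"
  using homeomorphic_imp_injective_map[of "top_of_set {0<..<1}" "subtopology G e" "\<phi> e"] char[of e]
  by (simp add: characteristic_map_def)

lemma edge_vertex_disjoint: "e \<in> E \<Longrightarrow> e \<inter> V = {}"
  using graph by (auto simp: CW_graph_def CW_complex_1_def)

lemma edge_unique: "e \<in> E \<Longrightarrow> f \<in> E \<Longrightarrow> z \<in> e \<Longrightarrow> z \<in> f \<Longrightarrow> e = f"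
proof (rule ccontr)
  assume ef: "e \<in> E" "f \<in> E" "z \<in> e" "z \<in> f" "e \<noteq> f"
  have "pairwise disjnt E" using graph by (simp add: CW_graph_def CW_complex_1_def)
  from pairwiseD[OF this ef(1,2,5)] ef(3,4) show False by (auto simp: disjnt_def)
qed

lemma edge_map_in: "e \<in> E \<Longrightarrow> 0 \<le> u \<Longrightarrow> u \<le> 1 \<Longrightarrow> \<phi> e u \<in> topspace G"
  using continuous_map_image_subset_topspace[OF edge_map_cont[of e]] by auto

definition edge :: "'a \<Rightarrow> 'a set" where
  "edge z = (THE e. e \<in> E \<and> z \<in> e)"

definition coord :: "'a \<Rightarrow> real" where
  "coord z = (THE u. u \<in> {0<..<1} \<and> \<phi> (edge z) u = z)"

lemma interior_point:
  assumes "e \<in> E" "0 < u" "u < 1"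
  shows "\<phi> e u \<notin> V" "\<phi> e u \<in> e" "edge (\<phi> e u) = e" "coord (\<phi> e u) = u"
proof -
  show ine: "\<phi> e u \<in> e" using edge_image[OF assms(1)] assms by auto
  then show "\<phi> e u \<notin> V" using edge_vertex_disjoint[OF assms(1)] by blast
  show ed: "edge (\<phi> e u) = e"
    unfolding edge_def using assms ine edge_unique by (intro the_equality) blast+
  show "coord (\<phi> e u) = u"
    unfolding coord_def ed using assms edge_inj[OF assms(1)] by (intro the_equality) (auto dest: inj_onD)
qed

lemma coord_cases:
  assumes "z \<in> topspace G" "z \<notin> V"
  shows "edge z \<in> E" "0 < coord z" "coord z < 1" "\<phi> (edge z) (coord z) = z"
proof -
  obtain e where e: "e \<in> E" "z \<in> e" using assms space by auto
  then have "z \<in> \<phi> e ` {0<..<1}" using edge_image[OF e(1)] by simp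
  then obtain u where u: "0 < u" "u < 1" "z = \<phi> e u" by auto
  from interior_point[OF e(1) u(1,2)] e u
  show "edge z \<in> E" "0 < coord z" "coord z < 1" "\<phi> (edge z) (coord z) = z" by simp_all
qed

lemma edge_map_vertex_iff:
  assumes "e \<in> E" "0 \<le> u" "u \<le> 1"
  shows "\<phi> e u \<in> V \<longleftrightarrow> u = 0 \<or> u = 1"
  using interior_point(1)[OF assms(1), of u] edge_ends[OF assms(1)] assms by (cases "u = 0 \<or> u = 1") auto

lemma edge_closure: "e \<in> E \<Longrightarrow> G closure_of e = \<phi> e ` {0..1}"
proof
  assume e: "e \<in> E"
  have "compactin G (\<phi> e ` {0..1})"
    using image_compactin[OF _ edge_map_cont[OF e], of "{0..1}"] by (simp add: compactin_subtopology)
  then have "closedin G (\<phi> e ` {0..1})"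
    by (rule compactin_imp_closedin[OF hausdorff])
  moreover have "e \<subseteq> \<phi> e ` {0..1}" using edge_image[OF e] by force
  ultimately show "G closure_of e \<subseteq> \<phi> e ` {0..1}" by (rule closure_of_minimal[rotated])
  have "top_of_set {0..1} closure_of {0<..<1::real} = {0..1}"
    by (simp add: closure_of_subtopology Int_absorb1 greaterThanLessThan_subseteq_atLeastAtMost_iff)
  then show "\<phi> e ` {0..1} \<subseteq> G closure_of e"
    using continuous_map_image_closure_subset[OF edge_map_cont[OF e], of "{0<..<1}"] edge_image[OF e] by simp
qed

text \<open>
  By compactness, the weak topology can be tested on the parameter interval of each edge.
\<close>

lemma closedin_graphI:
  assumes "A \<subseteq> topspace G" "\<And>e. e \<in> E \<Longrightarrow> closedin (top_of_set {0..1}) {u \<in> {0..1}. \<phi> e u \<in> A}"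
  shows "closedin G A"
proof -
  have "closedin G (A \<inter> G closure_of e)" if e: "e \<in> E" for e
  proof -
    have "compactin (top_of_set {0..1::real}) {u \<in> {0..1}. \<phi> e u \<in> A}"
      using assms(2)[OF e] by (rule closedin_compact_space[rotated]) (simp add: compact_space_subtopology)
    then have "compactin G (\<phi> e ` {u \<in> {0..1}. \<phi> e u \<in> A})"
      by (rule image_compactin[OF _ edge_map_cont[OF e]])
    then have "closedin G (\<phi> e ` {u \<in> {0..1}. \<phi> e u \<in> A})"
      by (rule compactin_imp_closedin[OF hausdorff])
    moreover have "\<phi> e ` {u \<in> {0..1}. \<phi> e u \<in> A} = A \<inter> G closure_of e"
      unfolding edge_closure[OF e] by auto
    ultimately show ?thesis by simp
  qed
  then show ?thesis
    using graph assms(1) unfolding CW_graph_def CW_complex_1_def by blast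
qed

lemma openin_graphI:
  assumes "A \<subseteq> topspace G" "\<And>e. e \<in> E \<Longrightarrow> openin (top_of_set {0..1}) {u \<in> {0..1}. \<phi> e u \<in> A}"
  shows "openin G A"
proof -
  have "closedin G (topspace G - A)"
  proof (rule closedin_graphI)
    fix e assume e: "e \<in> E"
    have "{u \<in> {0..1}. \<phi> e u \<in> topspace G - A} = topspace (top_of_set {0..1}) - {u \<in> {0..1}. \<phi> e u \<in> A}"
      using edge_map_in[OF e] by auto
    then show "closedin (top_of_set {0..1}) {u \<in> {0..1}. \<phi> e u \<in> topspace G - A}"
      using closedin_diff[OF closedin_topspace assms(2)[OF e]] by simp
  qed auto
  then show ?thesis using assms(1) by (simp add: openin_closedin_eq)
qed

lemma closedin_finite_trace:
  assumes "A \<subseteq> topspace G" "\<And>e. e \<in> E \<Longrightarrow> finite {u \<in> {0..1}. \<phi> e u \<in> A}"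
  shows "closedin G A"
proof (rule closedin_graphI[OF assms(1)])
  fix e assume "e \<in> E"
  then show "closedin (top_of_set {0..1}) {u \<in> {0..1}. \<phi> e u \<in> A}"
    using assms(2) by (intro closed_subset finite_imp_closed) auto
qed

text \<open>
  Every subset of such a set is closed, so in a compact space the set is finite. Applied to the vertices
  and to the midpoints of the edges, this shows that the graph is finite.
\<close>

lemma finite_of_finite_trace:
  assumes "A \<subseteq> topspace G" "\<And>e. e \<in> E \<Longrightarrow> finite {u \<in> {0..1}. \<phi> e u \<in> A}"
  shows "finite A"
proof (rule ccontr)
  assume "infinite A"
  then have "G derived_set_of A \<noteq> {}"
    using compact assms(1) compact_space_imp_Bolzano_Weierstrass by blast
  then obtain x where x: "x \<in> G derived_set_of A" by blast
  have "closedin G (A - {x})"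
  proof (rule closedin_finite_trace)
    fix e assume "e \<in> E"
    from assms(2)[OF this] show "finite {u \<in> {0..1}. \<phi> e u \<in> A - {x}}"
      by (rule rev_finite_subset) auto
  qed (use assms(1) in auto)
  moreover have "x \<in> G closure_of (A - {x})"
    using x by (simp add: in_derived_set_of in_closure_of) blast
  ultimately show False by (simp add: closure_of_closedin)
qed

lemma finite_vertices: "finite V"
proof (rule finite_of_finite_trace)
  fix e assume "e \<in> E"
  then have "{u \<in> {0..1}. \<phi> e u \<in> V} \<subseteq> {0, 1}" using edge_map_vertex_iff by auto
  then show "finite {u \<in> {0..1}. \<phi> e u \<in> V}" by (rule finite_subset) simp
qed (auto simp: space)

lemma finite_edges: "finite E"
proof -
  let ?M = "(\<lambda>e. \<phi> e (1/2)) ` E"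
  have "finite ?M"
  proof (rule finite_of_finite_trace)
    fix e assume e: "e \<in> E"
    have "{u \<in> {0..1}. \<phi> e u \<in> ?M} \<subseteq> {1/2}"
    proof clarify
      fix u f assume u: "u \<in> {0..1::real}" and f: "f \<in> E" "\<phi> e u = \<phi> f (1/2)"
      note mid = interior_point[OF f(1), of "1/2"]
      from mid(1) f have "\<phi> e u \<notin> V" by simp
      then have "0 < u" "u < 1" using edge_map_vertex_iff[OF e, of u] u by auto
      from interior_point(4)[OF e this] mid(4) f show "u = 1/2" by simp
    qed
    then show "finite {u \<in> {0..1}. \<phi> e u \<in> ?M}" by (rule finite_subset) simp
  qed (auto intro: edge_map_in)
  moreover have "inj_on (\<lambda>e. \<phi> e (1/2)) E"
    by (rule inj_on_inverseI[where g = edge]) (simp add: interior_point)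
  ultimately show ?thesis by (rule finite_imageD)
qed

text \<open>
  On a whole closed edge the parameter need not be a function of the point, as the edge may be a loop.
  On arcs that miss one of the ends it is.
\<close>

lemma arc_inverse:
  assumes e: "e \<in> E" and ab: "0 \<le> a" "b \<le> 1" "0 < a \<or> b < 1"
  obtains \<theta> where "continuous_map (subtopology G (\<phi> e ` {a..b})) euclideanreal \<theta>"
    "\<And>u. a \<le> u \<Longrightarrow> u \<le> b \<Longrightarrow> \<theta> (\<phi> e u) = u"
proof -
  let ?I = "top_of_set {a..b}" and ?A = "subtopology G (\<phi> e ` {a..b})"
  have inj: "inj_on (\<phi> e) {a..b}"
  proof (rule inj_onI)
    fix u w assume uw: "u \<in> {a..b}" "w \<in> {a..b}" "\<phi> e u = \<phi> e w"
    show "u = w"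
    proof (cases "\<phi> e u \<in> V")
      case True
      then have "\<phi> e w \<in> V" using uw by simp
      with True show ?thesis using edge_map_vertex_iff[OF e, of u] edge_map_vertex_iff[OF e, of w] uw ab by auto
    next
      case False
      then have "\<phi> e w \<notin> V" using uw by simp
      then have "w \<noteq> 0" "w \<noteq> 1" using edge_ends[OF e] by auto
      moreover have "u \<noteq> 0" "u \<noteq> 1" using False edge_ends[OF e] by auto
      ultimately have "0 < u" "u < 1" "0 < w" "w < 1" using uw(1,2) ab by auto
      then have "coord (\<phi> e u) = u" "coord (\<phi> e w) = w" by (simp_all only: interior_point(4)[OF e])
      then show ?thesis using uw(3) by metis
    qed
  qed
  have sub: "{a..b} \<subseteq> {0..1}" using ab by auto
  have "continuous_map ?I G (\<phi> e)"
    by (rule continuous_map_from_subtopology_mono[OF edge_map_cont[OF e] sub])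
  then have 1: "continuous_map ?I ?A (\<phi> e)"
    by (simp add: continuous_map_in_subtopology)
  have 2: "compact_space ?I" by (simp add: compact_space_subtopology)
  have 3: "Hausdorff_space ?A" using hausdorff by (rule Hausdorff_space_subtopology)
  have "\<phi> e ` {a..b} \<subseteq> topspace G"
  proof clarify
    fix u assume "u \<in> {a..b}"
    with sub have "u \<in> {0..1}" by blast
    then show "\<phi> e u \<in> topspace G" using edge_map_in[OF e, of u] by simp
  qed
  then have 4: "\<phi> e ` topspace ?I = topspace ?A" by (simp add: Int_absorb1)
  have 5: "inj_on (\<phi> e) (topspace ?I)" using inj by simp
  have "homeomorphic_map ?I ?A (\<phi> e)"
    by (rule continuous_imp_homeomorphic_map[OF 1 2 3 4 5])
  then obtain \<theta> where \<theta>: "homeomorphic_maps ?I ?A (\<phi> e) \<theta>"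
    using homeomorphic_map_maps by blast
  show ?thesis
  proof
    show "continuous_map ?A euclideanreal \<theta>"
      using \<theta> by (simp add: homeomorphic_maps_def continuous_map_in_subtopology)
    show "\<theta> (\<phi> e u) = u" if "a \<le> u" "u \<le> b" for u
      using \<theta> that by (simp add: homeomorphic_maps_def)
  qed
qed

text \<open>
  Continuity of a map that depends on a point of the graph is checked on three arcs of each edge, where
  \<open>arc_inverse\<close> provides a coordinate, and on vertices, which accounts for isolated ones.
\<close>

lemma glue_over_graph:
  assumes F: "continuous_map Z G F"
    and vert: "\<And>v. v \<in> V \<Longrightarrow> continuous_map (subtopology Z {z \<in> topspace Z. F z = v}) Y h"
    and arcs: "\<And>e. e \<in> E \<Longrightarrow> continuous_map (subtopology Z {z \<in> topspace Z. F z \<in> \<phi> e ` {0..1/4}}) Y h"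
      "\<And>e. e \<in> E \<Longrightarrow> continuous_map (subtopology Z {z \<in> topspace Z. F z \<in> \<phi> e ` {1/4..3/4}}) Y h"
      "\<And>e. e \<in> E \<Longrightarrow> continuous_map (subtopology Z {z \<in> topspace Z. F z \<in> \<phi> e ` {3/4..1}}) Y h"
  shows "continuous_map Z Y h"
proof -
  let ?\<C> = "(\<lambda>v. {v}) ` V \<union> (\<lambda>e. \<phi> e ` {0..1/4}) ` E \<union> (\<lambda>e. \<phi> e ` {1/4..3/4}) ` E \<union> (\<lambda>e. \<phi> e ` {3/4..1}) ` E"
  have arc_closed: "closedin G (\<phi> e ` {a..b})" if "e \<in> E" "0 \<le> a" "b \<le> 1" for e a b
  proof (rule compactin_imp_closedin[OF hausdorff])
    show "compactin G (\<phi> e ` {a..b})"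
      using image_compactin[OF _ edge_map_cont[OF that(1)], of "{a..b}"] that by (simp add: compactin_subtopology)
  qed
  show ?thesis
  proof (rule pasting_lemma_closed[where I = ?\<C> and T = "\<lambda>C. {z \<in> topspace Z. F z \<in> C}" and f = "\<lambda>_. h"])
    show "finite ?\<C>" using finite_vertices finite_edges by simp
    fix C assume C: "C \<in> ?\<C>"
    have "closedin G C"
      using C arc_closed vertex_in hausdorff
      by (auto intro!: closedin_Hausdorff_singleton)
    then show "closedin Z {z \<in> topspace Z. F z \<in> C}"
      by (rule closedin_continuous_map_preimage[OF F])
    show "continuous_map (subtopology Z {z \<in> topspace Z. F z \<in> C}) Y h"
      using C vert arcs by auto
  next
    fix z assume z: "z \<in> topspace Z"
    then have Fz: "F z \<in> topspace G" using continuous_map_image_subset_topspace[OF F] by blast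
    have "\<exists>C\<in>?\<C>. F z \<in> C"
    proof (cases "F z \<in> V")
      case True
      then show ?thesis by auto
    next
      case False
      note c = coord_cases[OF Fz False]
      consider "coord (F z) \<in> {0..1/4}" | "coord (F z) \<in> {1/4..3/4}" | "coord (F z) \<in> {3/4..1}"
        using c by force
      then show ?thesis
      proof cases
        case 1
        then have "F z \<in> \<phi> (edge (F z)) ` {0..1/4}" by (rule image_eqI[where f = "\<phi> (edge (F z))", OF c(4)[symmetric]])
        then show ?thesis by (rule bexI[OF _ UnI1[OF UnI1[OF UnI2[OF imageI[OF c(1)]]]]])
      next
        case 2
        then have "F z \<in> \<phi> (edge (F z)) ` {1/4..3/4}" by (rule image_eqI[where f = "\<phi> (edge (F z))", OF c(4)[symmetric]])
        then show ?thesis by (rule bexI[OF _ UnI1[OF UnI2[OF imageI[OF c(1)]]]])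
      next
        case 3
        then have "F z \<in> \<phi> (edge (F z)) ` {3/4..1}" by (rule image_eqI[where f = "\<phi> (edge (F z))", OF c(4)[symmetric]])
        then show ?thesis by (rule bexI[OF _ UnI2[OF imageI[OF c(1)]]])
      qed
    qed
    then obtain C where "C \<in> ?\<C>" "F z \<in> C" by (rule bexE)
    then show "\<exists>C. C \<in> ?\<C> \<and> z \<in> {z \<in> topspace Z. F z \<in> C} \<and> h z = h z"
      using z by (intro exI[of _ C] conjI CollectI refl)
  qed simp
qed

definition arc :: "'a set \<Rightarrow> real set \<Rightarrow> 'a set" where
  "arc e J = {z \<in> topspace G. z \<notin> V \<and> edge z = e \<and> coord z \<in> J}"

text \<open>
  The arms have length \<open>1/4\<close>, so that a star contains no points of the middle halves of edges, where
  the crossing of midpoints is registered. This matters for the two arms of a loop.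
\<close>

definition star :: "'a \<Rightarrow> 'a set" where
  "star v = {z \<in> topspace G. z = v \<or> z \<notin> V \<and>
     (coord z < 1/4 \<and> \<phi> (edge z) 0 = v \<or> 3/4 < coord z \<and> \<phi> (edge z) 1 = v)}"

lemma openin_arc:
  assumes "open J" shows "openin G (arc e J)"
proof (rule openin_graphI)
  fix f assume f: "f \<in> E"
  have "{u \<in> {0..1}. \<phi> f u \<in> arc e J} = {0..1} \<inter> (if f = e then J \<inter> {0<..<1} else {})"
    using interior_point[OF f] edge_map_vertex_iff[OF f] edge_map_in[OF f]
    unfolding arc_def by (fastforce split: if_splits)
  also have "openin (top_of_set {0..1}) \<dots>"
    using assms by (intro openin_open_Int) auto
  finally show "openin (top_of_set {0..1}) {u \<in> {0..1}. \<phi> f u \<in> arc e J}" .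
qed (auto simp: arc_def)

lemma openin_star:
  assumes "v \<in> V" shows "openin G (star v)"
proof (rule openin_graphI)
  fix e assume e: "e \<in> E"
  have "{u \<in> {0..1}. \<phi> e u \<in> star v} =
      {0..1} \<inter> ((if \<phi> e 0 = v then {..<1/4} else {}) \<union> (if \<phi> e 1 = v then {3/4<..} else {}))" (is "_ = ?R")
  proof (rule Set.set_eqI)
    fix u :: real
    consider "u \<notin> {0..1}" | "u = 0" | "u = 1" | "0 < u" "u < 1" by force
    then show "u \<in> {u \<in> {0..1}. \<phi> e u \<in> star v} \<longleftrightarrow> u \<in> ?R"
    proof cases
      case 2
      then show ?thesis using edge_ends[OF e] edge_map_in[OF e, of 0] by (simp add: star_def)
    next
      case 3
      then show ?thesis using edge_ends[OF e] edge_map_in[OF e, of 1] by (simp add: star_def)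
    next
      case 4
      then have "\<phi> e u \<noteq> v" using interior_point(1)[OF e] assms by auto
      with 4 show ?thesis using interior_point[OF e 4] edge_map_in[OF e, of u] by (simp add: star_def)
    qed auto
  qed
  also have "openin (top_of_set {0..1}) \<dots>" by (intro openin_open_Int) auto
  finally show "openin (top_of_set {0..1}) {u \<in> {0..1}. \<phi> e u \<in> star v}" .
qed (auto simp: star_def)

lemma edge_path:
  assumes "e \<in> E" "0 \<le> u" "u \<le> 1"
  shows "path_component_of G (\<phi> e 0) (\<phi> e u)"
  unfolding path_component_of_def pathin_def
proof (intro exI[of _ "\<lambda>s. \<phi> e (s * u)"] conjI)
  have "continuous_map (top_of_set {0..1}) (top_of_set {0..1}) (\<lambda>s. s * u)"
    using assms by (auto intro!: continuous_intros mult_le_one)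
  from continuous_map_compose[OF this edge_map_cont[OF assms(1)]]
  show "continuous_map (top_of_set {0..1}) G (\<lambda>s. \<phi> e (s * u))" by (simp add: o_def)
qed auto

text \<open>
  A path component contains each closed edge that it meets, so path components are open and closed.
\<close>

lemma path_connected_graph: "path_connected_space G"
proof -
  obtain v where v: "v \<in> topspace G" using nonempty by blast
  define P where "P = Collect (path_component_of G v)"
  have sub: "P \<subseteq> topspace G" unfolding P_def by (auto dest: path_component_in_topspace)
  have edge_iff: "\<phi> e u \<in> P \<longleftrightarrow> \<phi> e 0 \<in> P" if "e \<in> E" "u \<in> {0..1}" for e u
  proof -
    have p: "path_component_of G (\<phi> e 0) (\<phi> e u)" using edge_path[OF that(1), of u] that(2) by simp
    note q = p[THEN path_component_of_sym]
    show ?thesis unfolding P_def mem_Collect_eq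
      using path_component_of_trans[OF _ p] path_component_of_trans[OF _ q] by blast
  qed
  have cl: "closedin G A" if A: "A \<subseteq> topspace G" and trace: "\<And>e u. e \<in> E \<Longrightarrow> u \<in> {0..1} \<Longrightarrow> \<phi> e u \<in> A \<longleftrightarrow> \<phi> e 0 \<in> A" for A
  proof (rule closedin_graphI[OF A])
    fix e assume e: "e \<in> E"
    have "u \<in> {0..1} \<and> \<phi> e u \<in> A \<longleftrightarrow> u \<in> {0..1} \<and> \<phi> e 0 \<in> A" for u
      using trace[OF e, of u] by blast
    then have eq: "{u \<in> {0..1}. \<phi> e u \<in> A} = {u \<in> {0..1}. \<phi> e 0 \<in> A}" by (simp only:)
    show "closedin (top_of_set {0..1}) {u \<in> {0..1}. \<phi> e u \<in> A}"
    proof (cases "\<phi> e 0 \<in> A")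
      case True
      then have "{u \<in> {0..1::real}. \<phi> e 0 \<in> A} = {0..1}" by blast
      then show ?thesis unfolding eq by (simp only:) (simp add: closed_subset)
    next
      case False
      then show ?thesis unfolding eq by simp
    qed
  qed
  have 1: "closedin G P" by (rule cl[OF sub edge_iff])
  have "closedin G (topspace G - P)"
  proof (rule cl)
    fix e u assume eu: "e \<in> E" "u \<in> {0..1::real}"
    then have "\<phi> e u \<in> topspace G" "\<phi> e 0 \<in> topspace G" using edge_map_in[OF eu(1)] by auto
    then show "\<phi> e u \<in> topspace G - P \<longleftrightarrow> \<phi> e 0 \<in> topspace G - P" using edge_iff[OF eu] by blast
  qed auto
  then have "openin G P" using sub by (simp add: openin_closedin_eq)
  with 1 have "P = {} \<or> P = topspace G" using connected by (simp add: connected_space_clopen_in)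
  moreover have "v \<in> P" using v by (simp add: P_def path_component_of_refl)
  ultimately have "P = topspace G" by blast
  then have pv: "path_component_of G v x" if "x \<in> topspace G" for x using that unfolding P_def by blast
  show ?thesis
    unfolding path_connected_space_iff_path_component
    by (intro ballI path_component_of_trans[OF path_component_of_sym[OF pv] pv])
qed

end

section \<open>Configurations read off from weighted heaps\<close>

text \<open>
  Along one particle a cube shows at most two stacks, and they differ by one top piece. This is where
  the heaps of a cube become a point of an edge.
\<close>

lemma cubical_particle:
  assumes N: "cubical_via N A" and ne: "A \<noteq> {}"
  obtains p where "p \<in> A"
    "\<And>q. q \<in> A \<Longrightarrow> snd q i = snd p i \<or> (\<exists>e b l. snd p i = (e, b, l) # snd q i \<and> (e, i) \<in> N)"
proof -
  obtain p0 where p0: "p0 \<in> A" using ne by blast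
  show ?thesis
  proof (cases "\<exists>e. (e, i) \<in> N")
    case True
    then obtain e where e: "(e, i) \<in> N" ..
    obtain b l X Y where v: "\<forall>p\<in>A. (fst p e = X \<and> snd p i = Y) \<or>
        (fst p e = (i, b, l) # X \<and> snd p i = (e, b, l) # Y)" using cubical_via.direction[OF N e] by blast
    show ?thesis
    proof (cases "\<exists>p\<in>A. snd p i = (e, b, l) # Y")
      case True
      then obtain p where p: "p \<in> A" "snd p i = (e, b, l) # Y" by blast
      show ?thesis
      proof (rule that[OF p(1)])
        fix q assume "q \<in> A"
        with v consider "snd q i = (e, b, l) # Y" | "snd q i = Y" by blast
        then show "snd q i = snd p i \<or> (\<exists>e b l. snd p i = (e, b, l) # snd q i \<and> (e, i) \<in> N)"
        proof cases
          case 1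
          then show ?thesis using p(2) by simp
        next
          case 2
          then have "snd p i = (e, b, l) # snd q i \<and> (e, i) \<in> N" using p(2) e by simp
          then show ?thesis by blast
        qed
      qed
    next
      case False
      have "snd q i = Y" if "q \<in> A" for q using v False that by blast
      then show ?thesis using that[OF p0] p0 by simp
    qed
  next
    case False
    then have "(e, i) \<notin> N" for e by blast
    from cubical_via.particle_constant[OF N this _ p0] show ?thesis using that[OF p0] by blast
  qed
qed

lemma sum_fibres:
  fixes W :: "'j \<Rightarrow> real"
  assumes "finite J" "finite B"
  shows "(\<Sum>Y\<in>B. \<Sum>j\<in>{j \<in> J. S j = Y}. W j) = (\<Sum>j\<in>{j \<in> J. S j \<in> B}. W j)"
proof -
  have "(\<Sum>Y\<in>B. \<Sum>j\<in>{j \<in> {j \<in> J. S j \<in> B}. S j = Y}. W j) = (\<Sum>j\<in>{j \<in> J. S j \<in> B}. W j)"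
    using assms by (intro sum.group) auto
  moreover have "{j \<in> {j \<in> J. S j \<in> B}. S j = Y} = {j \<in> J. S j = Y}" if "Y \<in> B" for Y
    using that by blast
  ultimately show ?thesis by simp
qed

definition mass :: "'j set \<Rightarrow> ('j \<Rightarrow> 'y) \<Rightarrow> ('j \<Rightarrow> real) \<Rightarrow> 'y \<Rightarrow> real" where
  "mass J S W Y = (\<Sum>j\<in>{j \<in> J. S j = Y}. W j)"

definition weights :: "'j set \<Rightarrow> ('j \<Rightarrow> real) \<Rightarrow> bool" where
  "weights J W \<longleftrightarrow> finite J \<and> (\<forall>j\<in>J. 0 \<le> W j) \<and> sum W J = 1"

lemma mass_nonneg: "weights J W \<Longrightarrow> 0 \<le> mass J S W Y"
  unfolding mass_def weights_def by (intro sum_nonneg) simp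

lemma mass_pos:
  assumes "weights J W" "0 < mass J S W Y"
  obtains j where "j \<in> J" "0 < W j" "S j = Y"
proof -
  have "\<exists>j\<in>{j \<in> J. S j = Y}. 0 < W j"
  proof (rule ccontr)
    assume "\<not> ?thesis"
    then have "mass J S W Y \<le> 0" unfolding mass_def by (intro sum_nonpos) force
    with assms(2) show False by simp
  qed
  then show ?thesis using that by blast
qed

lemma mass_concentrated:
  assumes "weights J W" "finite B" "\<And>j. j \<in> J \<Longrightarrow> 0 < W j \<Longrightarrow> S j \<in> B"
  shows "sum (mass J S W) B = 1"
proof -
  have "sum (mass J S W) B = sum W {j \<in> J. S j \<in> B}"
    unfolding mass_def using assms by (intro sum_fibres) (simp add: weights_def)
  also have "\<dots> = sum W J"
  proof (rule sum.mono_neutral_left)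
    show "\<forall>j\<in>J - {j \<in> J. S j \<in> B}. W j = 0"
    proof
      fix j assume "j \<in> J - {j \<in> J. S j \<in> B}"
      then have "j \<in> J" "\<not> 0 < W j" using assms(3)[of j] by auto
      then show "W j = 0" using assms(1) by (simp add: weights_def order_antisym)
    qed
  qed (use assms(1) in \<open>auto simp: weights_def\<close>)
  finally show ?thesis using assms(1) by (simp add: weights_def)
qed

lemma mass_zero:
  assumes "weights J W" "finite B" "sum (mass J S W) B = 1" "Y \<notin> B"
  shows "mass J S W Y = 0"
proof -
  have "mass J S W Y + 1 = sum (mass J S W) (insert Y B)"
    using assms by simp
  also have "\<dots> = sum W {j \<in> J. S j \<in> insert Y B}"
    unfolding mass_def using assms by (intro sum_fibres) (simp_all add: weights_def)
  also have "\<dots> \<le> sum W J"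
    using assms(1) unfolding weights_def by (intro sum_mono2) auto
  finally show ?thesis
    using assms(1) mass_nonneg[OF assms(1), of S Y] by (simp add: weights_def)
qed

text \<open>
  The weights are supported on \<open>Y\<close> and \<open>tl Y\<close> for a single stack \<open>Y\<close>. For \<open>Y = []\<close> the convention
  \<open>tl [] = []\<close> leaves just \<open>Y\<close>.
\<close>

definition top_stack :: "('y list \<Rightarrow> real) \<Rightarrow> 'y list" where
  "top_stack \<mu> = (THE Y. 0 < \<mu> Y \<and> (\<forall>Y'. 0 < \<mu> Y' \<longrightarrow> Y' = Y \<or> Y' = tl Y))"

lemma top_stack_eq:
  assumes "0 < \<mu> Y" "\<And>Y'. 0 < \<mu> Y' \<Longrightarrow> Y' = Y \<or> Y' = tl Y"
  shows "top_stack \<mu> = Y"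
  unfolding top_stack_def
proof (rule the_equality)
  show "0 < \<mu> Y \<and> (\<forall>Y'. 0 < \<mu> Y' \<longrightarrow> Y' = Y \<or> Y' = tl Y)" using assms by blast
  fix Z assume Z: "0 < \<mu> Z \<and> (\<forall>Y'. 0 < \<mu> Y' \<longrightarrow> Y' = Z \<or> Y' = tl Z)"
  then have 1: "Z = Y \<or> Z = tl Y" using assms(2) by blast
  have 2: "Y = Z \<or> Y = tl Z" using Z assms(1) by blast
  show "Z = Y"
  proof (rule ccontr)
    assume ne: "Z \<noteq> Y"
    then have "length Z = length Y - 1" "length Y = length Z - 1" using 1 2 by (metis length_tl)+
    then have "length Z = 0" "length Y = 0" by linarith+
    then show False using ne by simp
  qed
qed

context cw_graph
begin

text \<open>
  The stack of a particle is a walk in the graph from \<open>v\<close>, with the most recent step first; a step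
  along \<open>e\<close> with direction \<open>b\<close> runs to the end of \<open>e\<close> with parameter \<open>of_bool b\<close>.
\<close>

primrec tip :: "'a \<Rightarrow> ('a set \<times> bool \<times> nat) list \<Rightarrow> 'a" where
  "tip v [] = v"
| "tip v (x # Y) = \<phi> (fst x) (of_bool (fst (snd x)))"

primrec walk :: "'a \<Rightarrow> ('a set \<times> bool \<times> nat) list \<Rightarrow> bool" where
  "walk v [] \<longleftrightarrow> v \<in> V"
| "walk v (x # Y) \<longleftrightarrow> fst x \<in> E \<and> tip v Y = \<phi> (fst x) (of_bool (\<not> fst (snd x))) \<and> walk v Y"

lemma tip_in: "walk v Y \<Longrightarrow> tip v Y \<in> V"
  by (cases Y) (auto simp: edge_ends)

text \<open>
  With weight \<open>\<mu> Y\<close> on a walk \<open>Y\<close> and the rest on the walk without its last step, the particle is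
  somewhere on the edge of this step.
\<close>

definition place :: "'a \<Rightarrow> (('a set \<times> bool \<times> nat) list \<Rightarrow> real) \<Rightarrow> 'a" where
  "place v \<mu> = (case top_stack \<mu> of [] \<Rightarrow> v
     | x # _ \<Rightarrow> \<phi> (fst x) (if fst (snd x) then \<mu> (top_stack \<mu>) else 1 - \<mu> (top_stack \<mu>)))"

lemma place_tip:
  assumes "\<mu> Y = 1" "\<And>Y'. 0 < \<mu> Y' \<Longrightarrow> Y' = Y"
  shows "place v \<mu> = tip v Y"
proof -
  have "top_stack \<mu> = Y" using assms by (intro top_stack_eq) auto
  then show ?thesis using assms(1) by (auto simp: place_def split: list.split)
qed

text \<open>
  If all weight is on the shorter walk, the point is the tip of that walk, which is the other end of the
  edge. So the description of the position does not jump when the longer walk loses its weight.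
\<close>

lemma place_between:
  assumes "walk v ((e, b, l) # Y)" "0 \<le> \<mu> ((e, b, l) # Y)" "\<mu> ((e, b, l) # Y) + \<mu> Y = 1"
    "\<And>Y'. 0 < \<mu> Y' \<Longrightarrow> Y' = (e, b, l) # Y \<or> Y' = Y"
  shows "place v \<mu> = \<phi> e (if b then \<mu> ((e, b, l) # Y) else 1 - \<mu> ((e, b, l) # Y))"
proof (cases "\<mu> ((e, b, l) # Y) = 0")
  case True
  have "place v \<mu> = tip v Y"
  proof (rule place_tip)
    show "\<mu> Y = 1" using assms(3) True by simp
    fix Y' assume "0 < \<mu> Y'"
    with assms(4)[of Y'] True show "Y' = Y" by auto
  qed
  then show ?thesis using assms(1) True by (cases b) simp_all
next
  case False
  then have "0 < \<mu> ((e, b, l) # Y)" using assms(2) by simp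
  then have "top_stack \<mu> = (e, b, l) # Y" using assms(4) by (intro top_stack_eq) auto
  then show ?thesis by (simp add: place_def)
qed

text \<open>
  Particles in the interior of an edge belong to a direction \<open>(e, i)\<close> of the cube. The directions form a
  matching, hence no two particles are realized inside the same edge.
\<close>

lemma place_cubical:
  assumes W: "weights J W"
    and N: "cubical_via N {p j | j. j \<in> J \<and> 0 < W j}"
    and walk: "\<And>j. j \<in> J \<Longrightarrow> walk v (snd (p j) i)"
  defines "\<mu> \<equiv> mass J (\<lambda>j. snd (p j) i) W"
  obtains (stack) j where "j \<in> J" "0 < W j" "sum \<mu> {snd (p j) i, tl (snd (p j) i)} = 1"
    "place v \<mu> \<in> V \<or> (\<exists>e. e \<in> E \<and> (e, i) \<in> N \<and> place v \<mu> \<in> e)"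
proof -
  let ?A = "{p j | j. j \<in> J \<and> 0 < W j}"
  have "?A \<noteq> {}"
  proof
    assume A: "?A = {}"
    have "W k \<le> 0" if "k \<in> J" for k
    proof (rule ccontr)
      assume "\<not> W k \<le> 0"
      with that have "p k \<in> ?A" by force
      with A show False by blast
    qed
    then have "sum W J \<le> 0" by (rule sum_nonpos)
    then show False using W by (simp add: weights_def)
  qed
  then obtain q where q: "q \<in> ?A" "\<And>r. r \<in> ?A \<Longrightarrow> snd r i = snd q i \<or> (\<exists>e b l. snd q i = (e, b, l) # snd r i \<and> (e, i) \<in> N)"
    using cubical_particle[OF N, where i = i] by blast
  then obtain j where j: "j \<in> J" "0 < W j" "q = p j" by blast
  have near: "snd (p k) i = snd q i \<or> (\<exists>e b l. snd q i = (e, b, l) # snd (p k) i \<and> (e, i) \<in> N)"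
    if "k \<in> J" "0 < W k" for k
    using q(2)[of "p k"] that by blast
  let ?Y = "snd q i"
  have sum1: "sum \<mu> {?Y, tl ?Y} = 1"
    unfolding \<mu>_def
  proof (rule mass_concentrated[OF W])
    fix k assume "k \<in> J" "0 < W k"
    from near[OF this] show "snd (p k) i \<in> {?Y, tl ?Y}" by (metis insert_iff list.sel(3))
  qed simp
  have supp: "Y' = ?Y \<or> Y' = tl ?Y" if "0 < \<mu> Y'" for Y'
    using mass_zero[OF W _ sum1[unfolded \<mu>_def], of Y'] that unfolding \<mu>_def by auto
  have "place v \<mu> \<in> V \<or> (\<exists>e. e \<in> E \<and> (e, i) \<in> N \<and> place v \<mu> \<in> e)"
  proof (cases "\<mu> (tl ?Y) > 0 \<and> tl ?Y \<noteq> ?Y")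
    case True
    then have "0 < mass J (\<lambda>j. snd (p j) i) W (tl ?Y)" by (simp add: \<mu>_def)
    then obtain k where k: "k \<in> J" "0 < W k" "snd (p k) i = tl ?Y"
      by (rule mass_pos[OF W])
    have "snd (p k) i \<noteq> ?Y" using True k(3) by simp
    with near[OF k(1,2)] obtain e b l where "?Y = (e, b, l) # snd (p k) i" and eN: "(e, i) \<in> N" by blast
    then have e: "?Y = (e, b, l) # tl ?Y" "(e, i) \<in> N" using k(3) by simp_all
    define Y where "Y = tl ?Y"
    have Y: "?Y = (e, b, l) # Y" using e(1) by (simp add: Y_def)
    have w: "walk v ((e, b, l) # Y)" using walk[OF j(1)] j(3) Y by simp
    have m: "0 \<le> \<mu> ((e, b, l) # Y)" unfolding \<mu>_def by (rule mass_nonneg[OF W])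
    have s: "\<mu> ((e, b, l) # Y) + \<mu> Y = 1" using sum1 Y by simp
    have p: "place v \<mu> = \<phi> e (if b then \<mu> ((e, b, l) # Y) else 1 - \<mu> ((e, b, l) # Y))"
      by (rule place_between[OF w m s]) (use supp Y in auto)
    have m': "0 \<le> \<mu> Y" unfolding \<mu>_def by (rule mass_nonneg[OF W])
    define u where "u = (if b then \<mu> ((e, b, l) # Y) else 1 - \<mu> ((e, b, l) # Y))"
    have u: "0 \<le> u" "u \<le> 1" using m m' s by (auto simp: u_def)
    have eE: "e \<in> E" using w by simp
    show ?thesis
    proof (cases "u = 0 \<or> u = 1")
      case True
      then show ?thesis using p edge_ends[OF eE] unfolding u_def[symmetric] by auto
    next
      case False
      then have "\<phi> e u \<in> e" using u interior_point(2)[OF eE, of u] by simp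
      then show ?thesis using p e(2) eE unfolding u_def[symmetric] by auto
    qed
  next
    case False
    have "place v \<mu> = tip v ?Y"
    proof (rule place_tip)
      show eq: "Y' = ?Y" if "0 < \<mu> Y'" for Y' using supp[OF that] False that by auto
      have "\<mu> (tl ?Y) = 0" if "tl ?Y \<noteq> ?Y"
        using False that mass_nonneg[OF W, of "\<lambda>j. snd (p j) i" "tl ?Y"] unfolding \<mu>_def by simp
      then show "\<mu> ?Y = 1" using sum1 by (cases "tl ?Y = ?Y") simp_all
    qed
    then show ?thesis using tip_in[OF walk[OF j(1)]] j(3) by simp
  qed
  with sum1 j show ?thesis using stack by blast
qed

lemma sink_conf_iff:
  "x \<in> topspace (sink_conf n G V) \<longleftrightarrow> x \<in> (\<Pi>\<^sub>E i\<in>{..<n}. topspace G) \<and>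
     (\<forall>i<n. \<forall>j<n. i \<noteq> j \<longrightarrow> x i = x j \<longrightarrow> x i \<in> V)"
  unfolding sink_conf_def by auto

lemma sink_conf_in: "x \<in> topspace (sink_conf n G V) \<Longrightarrow> i < n \<Longrightarrow> x i \<in> topspace G"
  by (auto simp: sink_conf_iff)

lemma continuous_component: "i < n \<Longrightarrow> continuous_map (sink_conf n G V) G (\<lambda>x. x i)"
  unfolding sink_conf_def
  by (intro continuous_map_from_subtopology continuous_map_product_projection) simp

lemma continuous_into_sink_conf:
  assumes "\<And>i. i < n \<Longrightarrow> continuous_map Z G (F i)"
    and "\<And>z i j. z \<in> topspace Z \<Longrightarrow> i < n \<Longrightarrow> j < n \<Longrightarrow> i \<noteq> j \<Longrightarrow> F i z = F j z \<Longrightarrow> F i z \<in> V"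
  shows "continuous_map Z (sink_conf n G V) (\<lambda>z. \<lambda>i\<in>{..<n}. F i z)"
proof -
  have "continuous_map Z (product_topology (\<lambda>_. G) {..<n}) (\<lambda>z. \<lambda>i\<in>{..<n}. F i z)"
    using assms(1) by (subst continuous_map_componentwise) auto
  moreover have "(\<lambda>i\<in>{..<n}. F i z) \<in> {x. \<forall>i<n. \<forall>j<n. i \<noteq> j \<longrightarrow> x i \<noteq> x j \<or> (x i = x j \<and> x i \<in> V)}"
    if "z \<in> topspace Z" for z
  proof (intro CollectI allI impI)
    fix i j assume "i < n" "j < n" "i \<noteq> j"
    then show "(\<lambda>i\<in>{..<n}. F i z) i \<noteq> (\<lambda>i\<in>{..<n}. F i z) j \<or>
        ((\<lambda>i\<in>{..<n}. F i z) i = (\<lambda>i\<in>{..<n}. F i z) j \<and> (\<lambda>i\<in>{..<n}. F i z) i \<in> V)"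
      using assms(2)[OF that, of i j] by simp
  qed
  ultimately show ?thesis
    unfolding sink_conf_def by (auto simp: continuous_map_in_subtopology)
qed

definition realize :: "nat \<Rightarrow> (nat \<Rightarrow> 'a) \<Rightarrow> 'j set \<Rightarrow> ('j \<Rightarrow> ('a set, nat) heap) \<Rightarrow> ('j \<Rightarrow> real) \<Rightarrow> nat \<Rightarrow> 'a" where
  "realize n v J p W = (\<lambda>i\<in>{..<n}. place (v i) (mass J (\<lambda>j. snd (p j) i) W))"

text \<open>
  The parameter space is covered by the closed sets on which the weight is concentrated on a fixed walk
  and the walk without its last step; on each of them the position is a continuous point of one edge.
\<close>

lemma continuous_place:
  assumes W: "\<And>z. z \<in> topspace Z \<Longrightarrow> weights J (\<lambda>j. w j z)"
    and cont: "\<And>j. j \<in> J \<Longrightarrow> continuous_map Z euclideanreal (w j)"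
    and cub: "\<And>z. z \<in> topspace Z \<Longrightarrow> cubical {p j | j. j \<in> J \<and> 0 < w j z}"
    and walk: "\<And>j. j \<in> J \<Longrightarrow> walk v (snd (p j) i)"
  shows "continuous_map Z G (\<lambda>z. place v (mass J (\<lambda>j. snd (p j) i) (\<lambda>j. w j z)))"
proof (cases "topspace Z = {}")
  case True
  then show ?thesis by (simp add: continuous_map_on_empty)
next
  case False
  then obtain z where "z \<in> topspace Z" by blast
  from W[OF this] have fin: "finite J" by (simp add: weights_def)
  define \<mu> where "\<mu> z = mass J (\<lambda>j. snd (p j) i) (\<lambda>j. w j z)" for z
  define T where "T Y = {z \<in> topspace Z. sum (\<mu> z) {Y, tl Y} \<in> {1}}" for Y
  have mcont: "continuous_map Z euclideanreal (\<lambda>z. \<mu> z Y)" for Y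
    unfolding \<mu>_def mass_def using fin cont by (intro continuous_map_sum) auto
  show ?thesis
    unfolding \<mu>_def[symmetric]
  proof (rule pasting_lemma_closed[where I = "(\<lambda>j. snd (p j) i) ` J" and T = T and f = "\<lambda>_ z. place v (\<mu> z)"])
    show "finite ((\<lambda>j. snd (p j) i) ` J)" using fin by simp
  next
    fix Y
    show "closedin Z (T Y)"
      unfolding T_def
      by (rule closedin_continuous_map_preimage[where Y = euclideanreal])
         (auto intro!: continuous_map_sum mcont)
  next
    fix Y assume "Y \<in> (\<lambda>j. snd (p j) i) ` J"
    then have wY: "walk v Y" using walk by blast
    have TY: "topspace (subtopology Z (T Y)) = T Y" unfolding T_def by auto
    have supp: "Y' \<in> {Y, tl Y}" if "z \<in> T Y" "0 < \<mu> z Y'" for z Y'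
      using mass_zero[OF W, of z "{Y, tl Y}" "\<lambda>j. snd (p j) i" Y'] that unfolding T_def \<mu>_def by fastforce
    show "continuous_map (subtopology Z (T Y)) G (\<lambda>z. place v (\<mu> z))"
    proof (cases Y)
      case Nil
      have eq: "v = place v (\<mu> z)" if z: "z \<in> T Y" for z
      proof -
        have "place v (\<mu> z) = tip v []"
          using supp[OF z] z Nil by (intro place_tip) (auto simp: T_def)
        then show ?thesis by simp
      qed
      have "v \<in> topspace G" using wY Nil vertex_in by simp
      then have "continuous_map (subtopology Z (T Y)) G (\<lambda>_. v)" by simp
      then show ?thesis by (rule continuous_map_eq) (simp only: TY eq[symmetric])
    next
      case (Cons x Y')
      then obtain e b l where Y: "Y = (e, b, l) # Y'" by (cases x) auto
      have eE: "e \<in> E" using wY Y by simp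
      define u where "u z = (if b then \<mu> z Y else 1 - \<mu> z Y)" for z
      have bounds: "0 \<le> \<mu> z Y" "\<mu> z Y + \<mu> z Y' = 1" "\<mu> z Y \<le> 1" if "z \<in> T Y" for z
      proof -
        have z: "z \<in> topspace Z" using that by (simp add: T_def)
        show "0 \<le> \<mu> z Y" unfolding \<mu>_def by (rule mass_nonneg[OF W[OF z]])
        have "0 \<le> \<mu> z Y'" unfolding \<mu>_def by (rule mass_nonneg[OF W[OF z]])
        moreover show "\<mu> z Y + \<mu> z Y' = 1" using that Y by (simp add: T_def)
        ultimately show "\<mu> z Y \<le> 1" by simp
      qed
      have eq: "place v (\<mu> z) = \<phi> e (u z)" if z: "z \<in> T Y" for z
        unfolding u_def Y
      proof (rule place_between)
        show "walk v ((e, b, l) # Y')" using wY Y by simp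
        show "0 \<le> \<mu> z ((e, b, l) # Y')" "\<mu> z ((e, b, l) # Y') + \<mu> z Y' = 1" using bounds[OF z] Y by simp_all
        show "Y'' = (e, b, l) # Y' \<or> Y'' = Y'" if "0 < \<mu> z Y''" for Y'' using supp[OF z that] Y by simp
      qed
      have "continuous_map (subtopology Z (T Y)) euclideanreal u"
        unfolding u_def
        by (cases b) (auto intro!: continuous_intros continuous_map_from_subtopology mcont)
      then have "continuous_map (subtopology Z (T Y)) (top_of_set {0..1}) u"
        using bounds TY by (auto simp: continuous_map_in_subtopology u_def)
      from continuous_map_compose[OF this edge_map_cont[OF eE]]
      have "continuous_map (subtopology Z (T Y)) G (\<lambda>z. \<phi> e (u z))" by (simp add: o_def)
      then show ?thesis by (rule continuous_map_eq) (simp only: TY eq)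
    qed
  next
    fix z assume z: "z \<in> topspace Z"
    obtain N where N: "cubical_via N {p j | j. j \<in> J \<and> 0 < w j z}" using cub[OF z] unfolding cubical_def ..
    show "\<exists>Y. Y \<in> (\<lambda>j. snd (p j) i) ` J \<and> z \<in> T Y \<and> place v (\<mu> z) = place v (\<mu> z)"
    proof (rule place_cubical[OF W[OF z] N walk])
      fix j assume "j \<in> J" "sum (mass J (\<lambda>j. snd (p j) i) (\<lambda>j. w j z)) {snd (p j) i, tl (snd (p j) i)} = 1"
      then show ?thesis using z by (intro exI[of _ "snd (p j) i"]) (simp add: T_def \<mu>_def)
    qed
  qed simp
qed

lemma continuous_realize:
  assumes W: "\<And>z. z \<in> topspace Z \<Longrightarrow> weights J (\<lambda>j. w j z)"
    and cont: "\<And>j. j \<in> J \<Longrightarrow> continuous_map Z euclideanreal (w j)"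
    and cub: "\<And>z. z \<in> topspace Z \<Longrightarrow> cubical {p j | j. j \<in> J \<and> 0 < w j z}"
    and walk: "\<And>j i. j \<in> J \<Longrightarrow> i < n \<Longrightarrow> walk (v i) (snd (p j) i)"
  shows "continuous_map Z (sink_conf n G V) (\<lambda>z. realize n v J p (\<lambda>j. w j z))"
  unfolding realize_def
proof (rule continuous_into_sink_conf)
  fix i assume "i < n"
  then show "continuous_map Z G (\<lambda>z. place (v i) (mass J (\<lambda>j. snd (p j) i) (\<lambda>j. w j z)))"
    by (intro continuous_place W cont cub walk)
next
  fix z i j
  assume z: "z \<in> topspace Z" and ij: "i < n" "j < n" "i \<noteq> j"
  let ?x = "\<lambda>i. place (v i) (mass J (\<lambda>j. snd (p j) i) (\<lambda>j. w j z))"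
  assume eq: "?x i = ?x j"
  obtain N where N: "cubical_via N {p j | j. j \<in> J \<and> 0 < w j z}" using cub[OF z] unfolding cubical_def ..
  have at: "?x k \<in> V \<or> (\<exists>e. e \<in> E \<and> (e, k) \<in> N \<and> ?x k \<in> e)" if "k < n" for k
    by (rule place_cubical[OF W[OF z] N walk[OF _ that]])
  show "?x i \<in> V"
  proof (rule ccontr)
    assume nV: "?x i \<notin> V"
    then obtain e where e: "e \<in> E" "(e, i) \<in> N" "?x i \<in> e" using at[OF ij(1)] by blast
    have "?x j \<notin> V" using nV eq by simp
    then obtain f where f: "f \<in> E" "(f, j) \<in> N" "?x j \<in> f" using at[OF ij(2)] by blast
    have "e = f" using edge_unique[OF e(1) f(1) e(3)] f(3) eq by simp
    then show False using cubical_via.one_particle[OF N e(2)] f(2) ij(3) by blast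
  qed
qed

end

section \<open>Contracting labellings by removing pieces\<close>

lemma mass_insert_Inr:
  assumes "finite J"
  shows "mass (insert (Inr ()) (Inl ` J)) S W Y =
    (\<Sum>j\<in>J. if S (Inl j) = Y then W (Inl j) else 0) + (if S (Inr ()) = Y then W (Inr ()) else 0)"
proof -
  have "mass (insert (Inr ()) (Inl ` J)) S W Y =
      (\<Sum>j\<in>insert (Inr ()) (Inl ` J). if S j = Y then W j else 0)"
    unfolding mass_def using assms by (intro sum.inter_filter) simp
  also have "\<dots> = (if S (Inr ()) = Y then W (Inr ()) else 0) + (\<Sum>j\<in>Inl ` J. if S j = Y then W j else 0)"
    using assms by (subst sum.insert) auto
  also have "(\<Sum>j\<in>Inl ` J. if S j = Y then W j else 0) = (\<Sum>j\<in>J. if S (Inl j) = Y then W (Inl j) else 0)"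
    by (subst sum.reindex) (auto simp: inj_on_def)
  finally show ?thesis by simp
qed

lemma mass_filter: "finite J \<Longrightarrow> mass J S W Y = (\<Sum>j\<in>J. if S j = Y then W j else 0)"
  unfolding mass_def by (intro sum.inter_filter)

context cw_graph
begin

lemma realize_const:
  assumes W: "weights J W" and empty: "\<And>j i. j \<in> J \<Longrightarrow> 0 < W j \<Longrightarrow> i < n \<Longrightarrow> snd (p j) i = []"
  shows "realize n v J p W = (\<lambda>i\<in>{..<n}. v i)"
proof -
  have "place (v i) (mass J (\<lambda>j. snd (p j) i) W) = v i" if i: "i < n" for i
  proof -
    have "place (v i) (mass J (\<lambda>j. snd (p j) i) W) = tip (v i) []"
    proof (rule place_tip)
      have "sum (mass J (\<lambda>j. snd (p j) i) W) {[]} = 1"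
        by (rule mass_concentrated[OF W]) (simp_all add: empty i)
      then show "mass J (\<lambda>j. snd (p j) i) W [] = 1" by simp
      fix Y assume "0 < mass J (\<lambda>j. snd (p j) i) W Y"
      then obtain j where "j \<in> J" "0 < W j" "snd (p j) i = Y" by (rule mass_pos[OF W])
      with empty[OF this(1,2) i] show "Y = []" by simp
    qed
    then show ?thesis by simp
  qed
  then show ?thesis unfolding realize_def by (intro restrict_ext) simp
qed

lemma realize_cong:
  "(\<And>i. i < n \<Longrightarrow> mass J (\<lambda>j. snd (p j) i) W = mass J' (\<lambda>j. snd (p' j) i) W') \<Longrightarrow>
     realize n v J p W = realize n v J' p' W'"
  unfolding realize_def by (intro restrict_ext) simp

text \<open>
  The weight of the index \<open>j0\<close> is transferred linearly from its old label to the new label \<open>q\<close>. During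
  the transfer both labels occur, so the index set gets one extra element \<open>Inr ()\<close> for the new one.
\<close>

lemma relabel_homotopy:
  assumes W: "\<And>z. z \<in> topspace Z \<Longrightarrow> weights J (\<lambda>j. w j z)" and fin: "finite J"
    and cont: "\<And>j. j \<in> J \<Longrightarrow> continuous_map Z euclideanreal (w j)"
    and j0: "j0 \<in> J"
    and cub: "\<And>z. z \<in> topspace Z \<Longrightarrow>
        cubical ({p j | j. j \<in> J \<and> 0 < w j z} \<union> (if 0 < w j0 z then {q} else {}))"
    and walk: "\<And>j i. j \<in> J \<Longrightarrow> i < n \<Longrightarrow> walk (v i) (snd (p j) i)"
      "\<And>i. i < n \<Longrightarrow> walk (v i) (snd q i)"
    and B: "B \<subseteq> topspace Z" "\<And>z j i. z \<in> B \<Longrightarrow> j \<in> J \<Longrightarrow> 0 < w j z \<Longrightarrow> i < n \<Longrightarrow> snd (p j) i = []"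
      "\<And>z. z \<in> B \<Longrightarrow> w j0 z = 0"
  shows "homotopic_with (\<lambda>h. \<forall>z\<in>B. h z = (\<lambda>i\<in>{..<n}. v i)) Z (sink_conf n G V)
     (\<lambda>z. realize n v J p (\<lambda>j. w j z)) (\<lambda>z. realize n v J (p(j0 := q)) (\<lambda>j. w j z))"
proof -
  let ?J = "insert (Inr ()) (Inl ` J)"
  define p' where "p' = case_sum p (\<lambda>_::unit. q)"
  define w' where "w' j = (\<lambda>(t, z). case j of
      Inl j \<Rightarrow> if j = j0 then (1 - t) * w j z else w j z | Inr (_::unit) \<Rightarrow> t * w j0 z)" for j
  define h where "h y = realize n v ?J p' (\<lambda>j. w' j y)" for y
  let ?X = "prod_topology (top_of_set {0..1::real}) Z"
  have W': "weights ?J (\<lambda>j. w' j (t, z))" if "t \<in> {0..1}" "z \<in> topspace Z" for t z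
  proof -
    have pos: "\<forall>j\<in>J. 0 \<le> w j z" and one: "(\<Sum>j\<in>J. w j z) = 1"
      using W[OF that(2)] by (simp_all add: weights_def)
    have "(\<Sum>j\<in>?J. w' j (t, z)) = t * w j0 z + (\<Sum>j\<in>J. w' (Inl j) (t, z))"
      using fin by (subst sum.insert) (auto simp: sum.reindex inj_on_def w'_def)
    also have "(\<Sum>j\<in>J. w' (Inl j) (t, z)) = (1 - t) * w j0 z + (\<Sum>j\<in>J - {j0}. w j z)"
      using fin j0 by (subst sum.remove[of _ j0]) (auto simp: w'_def intro!: sum.cong)
    also have "t * w j0 z + \<dots> = w j0 z + (\<Sum>j\<in>J - {j0}. w j z)" by (simp add: algebra_simps)
    also have "\<dots> = 1" using one fin j0 by (subst (asm) sum.remove[of _ j0]) auto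
    finally show ?thesis
      using pos fin j0 that by (auto simp: weights_def w'_def)
  qed
  have "continuous_map ?X (sink_conf n G V) (\<lambda>y. realize n v ?J p' (\<lambda>j. w' j y))"
  proof (rule continuous_realize)
    fix y assume "y \<in> topspace ?X"
    then obtain t z where y: "y = (t, z)" "t \<in> {0..1}" "z \<in> topspace Z" by (cases y) auto
    show "weights ?J (\<lambda>j. w' j y)" unfolding y(1) by (rule W'[OF y(2,3)])
    have "p' j \<in> {p j | j. j \<in> J \<and> 0 < w j z} \<union> (if 0 < w j0 z then {q} else {})"
      if j: "j \<in> ?J" "0 < w' j y" for j
    proof (cases j)
      case (Inl k)
      have k: "k \<in> J" using j Inl by auto
      have "0 < w k z"
      proof (cases "k = j0")
        case True
        then have "0 < (1 - t) * w k z" using j Inl y by (simp add: w'_def)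
        moreover have "0 \<le> 1 - t" using y by simp
        ultimately show ?thesis by (simp add: zero_less_mult_iff)
      next
        case False
        then show ?thesis using j Inl y by (simp add: w'_def)
      qed
      then show ?thesis using Inl k by (auto simp: p'_def)
    next
      case (Inr u)
      then have "0 < t * w j0 z" using j y by (simp add: w'_def)
      then have "0 < w j0 z" using y by (simp add: zero_less_mult_iff)
      then show ?thesis using Inr by (simp add: p'_def)
    qed
    then show "cubical {p' j | j. j \<in> ?J \<and> 0 < w' j y}"
      by (intro cubical_subset[OF cub[OF y(3)]]) blast
  next
    fix j assume "j \<in> ?J"
    show "continuous_map ?X euclideanreal (w' j)"
    proof (cases j)
      case (Inl k)
      then have k: "continuous_map ?X euclideanreal (\<lambda>y. w k (snd y))"
        using \<open>j \<in> ?J\<close> continuous_map_compose[OF continuous_map_snd cont[of k]] by (auto simp: o_def)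
      have f: "continuous_map ?X euclideanreal fst"
        using continuous_map_fst[of "top_of_set {0..1::real}" Z] by (simp add: continuous_map_in_subtopology)
      have "continuous_map ?X euclideanreal (\<lambda>y. (1 - fst y) * w k (snd y))"
        by (intro continuous_intros f k) simp
      then show ?thesis using k Inl by (cases "k = j0") (simp_all add: w'_def split_beta')
    next
      case (Inr u)
      have k: "continuous_map ?X euclideanreal (\<lambda>y. w j0 (snd y))"
        using continuous_map_compose[OF continuous_map_snd cont[OF j0]] by (auto simp: o_def)
      have f: "continuous_map ?X euclideanreal fst"
        using continuous_map_fst[of "top_of_set {0..1::real}" Z] by (simp add: continuous_map_in_subtopology)
      have "continuous_map ?X euclideanreal (\<lambda>y. fst y * w j0 (snd y))"
        by (intro continuous_intros f k)
      then show ?thesis using Inr by (simp add: w'_def split_beta')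
    qed
  next
    fix j i assume "j \<in> ?J" "i < n"
    then show "walk (v i) (snd (p' j) i)" using walk by (auto simp: p'_def)
  qed
  then have contw: "continuous_map ?X (sink_conf n G V) h" by (simp add: h_def[abs_def])
  have h0: "h (0, z) = realize n v J p (\<lambda>j. w j z)" for z
    unfolding h_def
  proof (rule realize_cong, rule ext)
    fix i Y
    have "w' (Inl j) (0, z) = w j z" for j by (simp add: w'_def)
    moreover have "w' (Inr ()) (0, z) = 0" by (simp add: w'_def)
    ultimately show "mass ?J (\<lambda>j. snd (p' j) i) (\<lambda>j. w' j (0, z)) Y = mass J (\<lambda>j. snd (p j) i) (\<lambda>j. w j z) Y"
      unfolding mass_insert_Inr[OF fin] mass_filter[OF fin] by (simp add: p'_def cong: if_cong)
  qed
  have h1: "h (1, z) = realize n v J (p(j0 := q)) (\<lambda>j. w j z)" for z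
    unfolding h_def
  proof (rule realize_cong, rule ext)
    fix i Y
    have "(\<Sum>j\<in>J. if snd (p' (Inl j)) i = Y then w' (Inl j) (1, z) else 0) =
        (\<Sum>j\<in>J - {j0}. if snd (p j) i = Y then w j z else 0)"
    proof -
      have "(\<Sum>j\<in>J - {j0}. if snd (p' (Inl j)) i = Y then w' (Inl j) (1, z) else 0) =
          (\<Sum>j\<in>J - {j0}. if snd (p j) i = Y then w j z else 0)"
        by (rule sum.cong) (simp_all add: w'_def p'_def)
      moreover have "w' (Inl j0) (1, z) = 0" by (simp add: w'_def)
      ultimately show ?thesis by (simp add: sum.remove[OF fin j0])
    qed
    moreover have "(\<Sum>j\<in>J. if snd ((p(j0 := q)) j) i = Y then w j z else 0) =
        (if snd q i = Y then w j0 z else 0) + (\<Sum>j\<in>J - {j0}. if snd (p j) i = Y then w j z else 0)"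
    proof -
      have "(\<Sum>j\<in>J - {j0}. if snd ((p(j0 := q)) j) i = Y then w j z else 0) =
          (\<Sum>j\<in>J - {j0}. if snd (p j) i = Y then w j z else 0)"
        by (rule sum.cong) simp_all
      then show ?thesis by (simp add: sum.remove[OF fin j0])
    qed
    ultimately show "mass ?J (\<lambda>j. snd (p' j) i) (\<lambda>j. w' j (1, z)) Y =
        mass J (\<lambda>j. snd ((p(j0 := q)) j) i) (\<lambda>j. w j z) Y"
      unfolding mass_insert_Inr[OF fin] mass_filter[OF fin] by (simp add: p'_def w'_def)
  qed
  have hB: "h (t, z) = (\<lambda>i\<in>{..<n}. v i)" if "t \<in> {0..1}" "z \<in> B" for t z
    unfolding h_def
  proof (rule realize_const)
    show "weights ?J (\<lambda>j. w' j (t, z))" using W' that B by blast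
    fix j i assume j: "j \<in> ?J" "0 < w' j (t, z)" and i: "i < n"
    show "snd (p' j) i = []"
    proof (cases j)
      case (Inl k)
      have k: "k \<in> J" using j Inl by auto
      have "k \<noteq> j0" using j Inl B(3)[OF that(2)] by (auto simp: w'_def)
      then have "0 < w k z" using j Inl by (simp add: w'_def)
      then show ?thesis using B(2)[OF that(2) k _ i] Inl by (simp add: p'_def)
    next
      case (Inr u)
      then show ?thesis using j B(3)[OF that(2)] by (simp add: w'_def)
    qed
  qed
  show ?thesis
    unfolding homotopic_with_def
    using contw h0 h1 hB by (intro exI[of _ h] conjI allI ballI) auto
qed

lemma pop_stack: "snd (pop e i p) = (snd p)(i := tl (snd p i))"
  by (simp add: pop_def)

text \<open>
  Among all labels, a piece of the greatest level is removed from one of them. The total number of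
  pieces drops, and when none is left the realization is constant.
\<close>

lemma contract_labels:
  assumes W: "\<And>z. z \<in> topspace Z \<Longrightarrow> weights J (\<lambda>j. w j z)" and fin: "finite J"
    and cont: "\<And>j. j \<in> J \<Longrightarrow> continuous_map Z euclideanreal (w j)"
    and B: "B \<subseteq> topspace Z"
    and cub: "\<And>z. z \<in> topspace Z \<Longrightarrow> cubical {p j | j. j \<in> J \<and> 0 < w j z}"
    and red: "\<And>j. j \<in> J \<Longrightarrow> reduced_heap (p j)"
    and walk: "\<And>j i. j \<in> J \<Longrightarrow> i < n \<Longrightarrow> walk (v i) (snd (p j) i)"
    and out: "\<And>j i. j \<in> J \<Longrightarrow> n \<le> i \<Longrightarrow> snd (p j) i = []"
    and emp: "\<And>z j i. z \<in> B \<Longrightarrow> j \<in> J \<Longrightarrow> 0 < w j z \<Longrightarrow> snd (p j) i = []"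
  shows "homotopic_with (\<lambda>h. \<forall>z\<in>B. h z = (\<lambda>i\<in>{..<n}. v i)) Z (sink_conf n G V)
     (\<lambda>z. realize n v J p (\<lambda>j. w j z)) (\<lambda>_. \<lambda>i\<in>{..<n}. v i)"
  using cub red walk out emp
proof (induction "\<Sum>j\<in>J. \<Sum>i<n. length (snd (p j) i)" arbitrary: p rule: less_induct)
  case (less p)
  note cub = less.prems(1) and red = less.prems(2) and walk = less.prems(3) and out = less.prems(4)
    and emp = less.prems(5)
  let ?P = "\<lambda>h. \<forall>z\<in>B. h z = (\<lambda>i\<in>{..<n}. v i)"
  show ?case
  proof (cases "\<forall>j\<in>J. \<forall>i<n. snd (p j) i = []")
    case True
    have eq: "realize n v J p (\<lambda>j. w j z) = (\<lambda>i\<in>{..<n}. v i)" if "z \<in> topspace Z" for z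
      by (rule realize_const[OF W[OF that]]) (use True in blast)
    show ?thesis
      by (rule homotopic_with_equal) (use eq B continuous_realize[OF W cont cub walk] in auto)
  next
    case False
    \<comment> \<open>the greatest level is found on a particle stack, as these bound the levels on edge stacks\<close>
    define L where "L = (\<lambda>(j, i). level (snd (p j) i)) ` (J \<times> {..<n})"
    have finL: "finite L" using fin by (simp add: L_def)
    obtain j1 i1 where "j1 \<in> J" "i1 < n" using False by blast
    then have "L \<noteq> {}" by (auto simp: L_def)
    define k where "k = Max L"
    have "k \<in> L" unfolding k_def by (rule Max_in) fact+
    then obtain j0 i0 where j0: "j0 \<in> J" "i0 < n" "level (snd (p j0) i0) = k"
      by (auto simp: L_def)
    have le: "level (snd (p j) i) \<le> k" if "j \<in> J" for j i
    proof (cases "i < n")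
      case True
      then have "level (snd (p j) i) \<in> L" using that by (force simp: L_def)
      then show ?thesis unfolding k_def by (rule Max_ge[OF finL])
    qed (use out that in simp)
    have "0 < k"
    proof -
      obtain j i where ji: "j \<in> J" "i < n" "snd (p j) i \<noteq> []" using False by blast
      then obtain e b l Y where Y: "snd (p j) i = (e, b, l) # Y" by (cases "snd (p j) i") auto
      have "0 < l" using reduced_level(2)[OF red[OF ji(1)] Y] by simp
      moreover have "l \<le> k" using le[OF ji(1), of i] Y by simp
      ultimately show ?thesis by simp
    qed
    have lef: "level (fst (p j) e) \<le> k" if "j \<in> J" for j e
    proof (cases "fst (p j) e")
      case (Cons x X)
      then obtain i b l where X: "fst (p j) e = (i, b, l) # X" by (cases x) auto
      from reduced_level(1)[OF red[OF that] X] le[OF that, of i] show ?thesis using X by simp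
    qed simp
    obtain e b Y0 where Y0: "snd (p j0) i0 = (e, b, k) # Y0"
    proof (cases "snd (p j0) i0")
      case Nil
      then show ?thesis using j0(3) \<open>0 < k\<close> by simp
    next
      case (Cons x Y0)
      then have "snd (p j0) i0 = (fst x, fst (snd x), k) # Y0" using j0(3) by (cases x) simp
      then show ?thesis by (rule that)
    qed
    note lev = reduced_level(2)[OF red[OF j0(1)] Y0]
    then have "level (fst (p j0) e) = k" using lef[OF j0(1), of e] by linarith
    with lev obtain X0 where X0: "fst (p j0) e = (i0, b, k) # X0" by blast
    define q where "q = pop e i0 (p j0)"
    have q: "reduced_heap q" unfolding q_def using reduced_pop[OF red[OF j0(1)] X0 Y0] by simp
    have sq: "snd q i = (if i = i0 then Y0 else snd (p j0) i)" for i
      using Y0 by (simp add: q_def pop_stack)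
    have wq: "walk (v i) (snd q i)" if "i < n" for i
      using walk[OF j0(1) that] Y0 by (cases "i = i0") (simp_all add: sq)
    \<comment> \<open>over \<open>B\<close> only empty labels have weight, and the label of \<open>j0\<close> is not empty\<close>
    have wB: "w j0 z = 0" if "z \<in> B" for z
    proof (rule ccontr)
      assume "w j0 z \<noteq> 0"
      moreover have "0 \<le> w j0 z" using W[of z] B that j0 by (auto simp: weights_def)
      ultimately have "0 < w j0 z" by simp
      from emp[OF that j0(1) this, of i0] Y0 show False by simp
    qed
    have cub2: "cubical ({p j | j. j \<in> J \<and> 0 < w j z} \<union> (if 0 < w j0 z then {q} else {}))"
      if z: "z \<in> topspace Z" for z
    proof (cases "0 < w j0 z")
      case True
      have "cubical (insert (pop e i0 (p j0)) {p j | j. j \<in> J \<and> 0 < w j z})"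
      proof (rule cubical_insert_pop[OF cub[OF z] _ _ X0 Y0])
        show "p j0 \<in> {p j | j. j \<in> J \<and> 0 < w j z}" using True j0 by blast
      qed (use red le lef in blast)+
      then show ?thesis using True by (simp add: q_def)
    next
      case False
      then show ?thesis using cub[OF z] by simp
    qed
    have step: "homotopic_with ?P Z (sink_conf n G V)
       (\<lambda>z. realize n v J p (\<lambda>j. w j z)) (\<lambda>z. realize n v J (p(j0 := q)) (\<lambda>j. w j z))"
      by (rule relabel_homotopy[OF W fin cont j0(1) cub2 walk wq B emp wB])
    have "homotopic_with ?P Z (sink_conf n G V)
       (\<lambda>z. realize n v J (p(j0 := q)) (\<lambda>j. w j z)) (\<lambda>_. \<lambda>i\<in>{..<n}. v i)"
    proof (rule less.hyps)
      have lt: "(\<Sum>i<n. length (snd q i)) < (\<Sum>i<n. length (snd (p j0) i))"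
      proof (rule sum_strict_mono_ex1)
        show "\<forall>i\<in>{..<n}. length (snd q i) \<le> length (snd (p j0) i)" using Y0 by (simp add: sq)
        show "\<exists>i\<in>{..<n}. length (snd q i) < length (snd (p j0) i)"
          using Y0 j0(2) by (intro bexI[of _ i0]) (simp_all add: sq)
      qed simp
      show "(\<Sum>j\<in>J. \<Sum>i<n. length (snd ((p(j0 := q)) j) i)) < (\<Sum>j\<in>J. \<Sum>i<n. length (snd (p j) i))"
      proof (rule sum_strict_mono_ex1[OF fin])
        show "\<forall>j\<in>J. (\<Sum>i<n. length (snd ((p(j0 := q)) j) i)) \<le> (\<Sum>i<n. length (snd (p j) i))"
          using lt by auto
        show "\<exists>j\<in>J. (\<Sum>i<n. length (snd ((p(j0 := q)) j) i)) < (\<Sum>i<n. length (snd (p j) i))"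
          using lt j0(1) by (intro bexI[of _ j0]) auto
      qed
    next
      fix z assume z: "z \<in> topspace Z"
      have "{(p(j0 := q)) j | j. j \<in> J \<and> 0 < w j z} \<subseteq>
          {p j | j. j \<in> J \<and> 0 < w j z} \<union> (if 0 < w j0 z then {q} else {})"
        by auto
      then show "cubical {(p(j0 := q)) j | j. j \<in> J \<and> 0 < w j z}"
        by (rule cubical_subset[OF cub2[OF z]])
    next
      fix j assume "j \<in> J" then show "reduced_heap ((p(j0 := q)) j)" using red q by simp
    next
      fix j i assume "j \<in> J" "i < n" then show "walk (v i) (snd ((p(j0 := q)) j) i)" using walk wq by simp
    next
      fix j i assume "j \<in> J" "n \<le> i"
      then show "snd ((p(j0 := q)) j) i = []" using out[of j i] out[OF j0(1), of i] j0(2) by (simp add: sq)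
    next
      fix z j i assume "z \<in> B" "j \<in> J" "0 < w j z"
      then show "snd ((p(j0 := q)) j) i = []" using emp[of z j i] wB[of z] by (cases "j = j0") auto
    qed
    with step show ?thesis by (rule homotopic_with_trans)
  qed
qed

end

section \<open>Charts and the lift to heaps\<close>

lemma cube_mem: "s \<in> topspace (cube k) \<longleftrightarrow> s \<in> extensional {..<k} \<and> (\<forall>i<k. 0 \<le> s i \<and> s i \<le> 1)"
  by (auto simp: cube_def PiE_iff)

definition near :: "nat \<Rightarrow> real \<Rightarrow> (nat \<Rightarrow> real) \<Rightarrow> (nat \<Rightarrow> real) \<Rightarrow> bool" where
  "near k d s s' \<longleftrightarrow> (\<forall>i<k. \<bar>s i - s' i\<bar> < d)"

lemma near_refl: "0 < d \<Longrightarrow> near k d s s"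
  by (simp add: near_def)

lemma near_sym: "near k d s s' \<Longrightarrow> near k d s' s"
  by (simp add: near_def abs_minus_commute)

lemma near_mono: "near k d s s' \<Longrightarrow> d \<le> d' \<Longrightarrow> near k d' s s'"
  by (force simp: near_def)

lemma near_trans: "near k d s s' \<Longrightarrow> near k d' s' s'' \<Longrightarrow> near k (d + d') s s''"
  unfolding near_def by (smt (verit))

definition shrink :: "nat \<Rightarrow> real \<Rightarrow> (nat \<Rightarrow> real) \<Rightarrow> nat \<Rightarrow> real" where
  "shrink k r s = (\<lambda>i\<in>{..<k}. r * s i)"

lemma shrink_in: "s \<in> topspace (cube k) \<Longrightarrow> 0 \<le> r \<Longrightarrow> r \<le> 1 \<Longrightarrow> shrink k r s \<in> topspace (cube k)"
  by (auto simp: cube_mem shrink_def mult_le_one)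

lemma shrink_one: "s \<in> topspace (cube k) \<Longrightarrow> shrink k 1 s = s"
  by (auto simp: cube_mem shrink_def intro!: extensionalityI[of _ "{..<k}"])

lemma shrink_zero: "shrink k 0 s = shrink k 0 s'"
  by (simp add: shrink_def)

context cw_graph
begin

definition side :: "'a \<Rightarrow> bool" where
  "side z \<longleftrightarrow> 1/2 \<le> coord z"

text \<open>
  Midpoints are rounded to the end with parameter 1, in agreement with \<open>side\<close>.
\<close>

definition rounding :: "'a \<Rightarrow> 'a" where
  "rounding z = (if z \<in> V then z else \<phi> (edge z) (of_bool (side z)))"

text \<open>
  The move that takes the rounding of \<open>z\<close> to the rounding of \<open>z'\<close>. Only the middle half of an edge
  counts: near the vertex of a loop two close points can have opposite sides although no particle
  crosses a midpoint between them.
\<close>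

definition cross :: "'a \<Rightarrow> 'a \<Rightarrow> ('a set \<times> bool) option" where
  "cross z z' = (if z \<notin> V \<and> z' \<notin> V \<and> edge z = edge z' \<and> coord z \<in> {1/4<..<3/4} \<and> coord z' \<in> {1/4<..<3/4} \<and>
      side z \<noteq> side z' then Some (edge z, side z') else None)"

text \<open>
  Only particles at the midpoint of an edge may cross it within a chart. The margin \<open>\<eta>\<close> keeps the
  others farther from the midpoint than the one at the midpoint can get, so that the order of the particles on
  an edge does not change between a crossing particle and the rest.
\<close>

definition nbhd :: "real \<Rightarrow> 'a \<Rightarrow> 'a set" where
  "nbhd \<eta> c = (if c \<in> V then star c
     else if coord c = 1/2 then arc (edge c) {1/2 - \<eta><..<1/2 + \<eta>}
     else if coord c < 1/2 then arc (edge c) {..<1/2 - \<eta>}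
     else arc (edge c) {1/2 + \<eta><..})"

definition chart_edge :: "(nat \<Rightarrow> 'a) \<Rightarrow> nat \<Rightarrow> 'a set option" where
  "chart_edge c i = (if c i \<notin> V \<and> coord (c i) = 1/2 then Some (edge (c i)) else None)"

definition chart :: "nat \<Rightarrow> real \<Rightarrow> (nat \<Rightarrow> 'a) \<Rightarrow> (nat \<Rightarrow> 'a) set" where
  "chart n \<eta> c = {x \<in> topspace (sink_conf n G V). \<forall>i<n. x i \<in> nbhd \<eta> (c i)}"

definition good_chart :: "nat \<Rightarrow> (nat \<Rightarrow> 'a) set \<Rightarrow> bool" where
  "good_chart n W \<longleftrightarrow> (\<exists>c \<eta>. c \<in> topspace (sink_conf n G V) \<and> 0 < \<eta> \<and> \<eta> \<le> 1/4 \<and> W = chart n \<eta> c)"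

lemma rounding_in: "z \<in> topspace G \<Longrightarrow> rounding z \<in> V"
  using edge_ends coord_cases(1) by (auto simp: rounding_def of_bool_def)

lemma cross_refl: "cross z z = None"
  by (simp add: cross_def)

lemma openin_nbhd: "openin G (nbhd \<eta> c)"
  unfolding nbhd_def by (simp add: openin_star openin_arc)

lemma exists_chart:
  assumes "c \<in> topspace (sink_conf n G V)"
  obtains W where "good_chart n W" "openin (sink_conf n G V) W" "c \<in> W"
proof -
  define S where "S = insert (1/4) ((\<lambda>i. \<bar>1/2 - coord (c i)\<bar> / 2) ` {i. i < n \<and> c i \<notin> V \<and> coord (c i) \<noteq> 1/2})"
  \<comment> \<open>half the distances to the midpoints, so that the particles stay outside the margin\<close>
  define \<eta> where "\<eta> = Min S"
  have fin: "finite S" by (simp add: S_def)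
  have "0 < a" if "a \<in> S" for a using that by (auto simp: S_def)
  moreover have "Min S \<in> S" by (rule Min_in[OF fin]) (simp add: S_def)
  moreover have "Min S \<le> 1/4" by (rule Min_le[OF fin]) (simp add: S_def)
  ultimately have \<eta>: "0 < \<eta>" "\<eta> \<le> 1/4" by (simp_all add: \<eta>_def)
  have small: "\<eta> < \<bar>1/2 - coord (c i)\<bar>" if "i < n" "c i \<notin> V" "coord (c i) \<noteq> 1/2" for i
  proof -
    have "\<bar>1/2 - coord (c i)\<bar> / 2 \<in> S" using that by (simp add: S_def)
    then have "\<eta> \<le> \<bar>1/2 - coord (c i)\<bar> / 2" unfolding \<eta>_def by (rule Min_le[OF fin])
    moreover have "0 < \<bar>1/2 - coord (c i)\<bar>" using that by simp
    moreover have "y \<le> a / 2 \<Longrightarrow> 0 < a \<Longrightarrow> y < a" for y a :: real by linarith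
    ultimately show ?thesis by blast
  qed
  have "c i \<in> nbhd \<eta> (c i)" if i: "i < n" for i
  proof -
    have "c i \<in> topspace G" using sink_conf_in[OF assms i] .
    then show ?thesis using small[OF i] \<eta> by (auto simp: nbhd_def star_def arc_def)
  qed
  then have "c \<in> chart n \<eta> c" using assms by (simp add: chart_def)
  moreover have "good_chart n (chart n \<eta> c)" unfolding good_chart_def using assms \<eta> by blast
  moreover have "openin (sink_conf n G V) (chart n \<eta> c)"
  proof -
    have "chart n \<eta> c = topspace (sink_conf n G V) \<inter>
        (\<Inter>i\<in>{..<n}. {x \<in> topspace (sink_conf n G V). x i \<in> nbhd \<eta> (c i)})"
      by (auto simp: chart_def)
    also have "openin (sink_conf n G V) \<dots>"
      by (cases "n = 0")
         (auto intro!: openin_Int_Inter openin_continuous_map_preimage[OF continuous_component openin_nbhd])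
    finally show ?thesis .
  qed
  ultimately show ?thesis using that by blast
qed

text \<open>
  Stars round to their centre and contain no points of middle halves of edges; the other neighbourhoods
  lie on one side of a midpoint.
\<close>

lemma nbhd_rigid:
  assumes c: "c \<in> topspace G" and \<eta>: "0 < \<eta>" "\<eta> \<le> 1/4" and none: "c \<in> V \<or> coord c \<noteq> 1/2"
    and z: "z \<in> nbhd \<eta> c" "z' \<in> nbhd \<eta> c"
  shows "rounding z = rounding z'" "cross z z' = None"
proof -
  consider "c \<in> V" | "c \<notin> V" "coord c < 1/2" | "c \<notin> V" "coord c > 1/2" using none by force
  then have "rounding z = rounding z' \<and> cross z z' = None"
  proof cases
    case 1
    have star: "rounding y = c \<and> (y \<in> V \<or> coord y \<notin> {1/4<..<3/4})" if "y \<in> star c" for y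
    proof (cases "y = c")
      case True
      then show ?thesis using 1 by (simp add: rounding_def)
    next
      case False
      then show ?thesis using that by (auto simp: star_def rounding_def side_def)
    qed
    show ?thesis using star[of z] star[of z'] z 1 by (auto simp: nbhd_def cross_def)
  next
    case 2
    have "\<not> side y \<and> y \<notin> V \<and> edge y = edge c" if "y \<in> nbhd \<eta> c" for y
      using that 2 \<eta> by (auto simp: nbhd_def arc_def side_def)
    from this[OF z(1)] this[OF z(2)] show ?thesis by (simp add: rounding_def cross_def)
  next
    case 3
    have "side y \<and> y \<notin> V \<and> edge y = edge c" if "y \<in> nbhd \<eta> c" for y
      using that 3 \<eta> by (auto simp: nbhd_def arc_def side_def)
    from this[OF z(1)] this[OF z(2)] show ?thesis by (simp add: rounding_def cross_def)
  qed
  then show "rounding z = rounding z'" "cross z z' = None" by auto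
qed

lemma nbhd_mid:
  assumes "0 < \<eta>" "\<eta> \<le> 1/4" "c \<notin> V" "coord c = 1/2" "z \<in> nbhd \<eta> c"
  shows "z \<notin> V" "edge z = edge c" "1/2 - \<eta> < coord z" "coord z < 1/2 + \<eta>" "z \<in> topspace G"
  using assms by (auto simp: nbhd_def arc_def)

text \<open>
  Two particles cannot both be at the midpoint of an edge, as it is not a vertex.
\<close>

lemma matching_chart_edge:
  assumes c: "c \<in> topspace (sink_conf n G V)"
  shows "matching n (chart_edge c)"
  unfolding matching_def
proof (intro allI impI)
  fix i j e assume ij: "i < n" "j < n" and e: "chart_edge c i = Some e \<and> chart_edge c j = Some e"
  then have "c i \<notin> V" "coord (c i) = 1/2" "edge (c i) = e" "c j \<notin> V" "coord (c j) = 1/2" "edge (c j) = e"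
    by (auto simp: chart_edge_def split: if_split_asm)
  then have "c i = \<phi> e (1/2)" "c j = \<phi> e (1/2)"
    using coord_cases(4)[of "c i"] coord_cases(4)[of "c j"] sink_conf_in[OF c ij(1)] sink_conf_in[OF c ij(2)]
    by metis+
  then have "c i = c j" by simp
  with c ij \<open>c i \<notin> V\<close> show "i = j" unfolding sink_conf_iff by blast
qed

lemma chart_cross:
  assumes c: "c \<in> topspace (sink_conf n G V)" and \<eta>: "0 < \<eta>" "\<eta> \<le> 1/4"
    and x: "x \<in> chart n \<eta> c" "x' \<in> chart n \<eta> c" and i: "i < n"
  shows "cross (x i) (x' i) = shift (chart_edge c) (\<lambda>i. side (x i)) (\<lambda>i. side (x' i)) i"
proof -
  have nb: "x i \<in> nbhd \<eta> (c i)" "x' i \<in> nbhd \<eta> (c i)" using x i by (auto simp: chart_def)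
  show ?thesis
  proof (cases "c i \<in> V \<or> coord (c i) \<noteq> 1/2")
    case True
    then have "chart_edge c i = None" by (auto simp: chart_edge_def)
    then show ?thesis
      using nbhd_rigid(2)[OF sink_conf_in[OF c i] \<eta> True nb] by (simp add: shift_def)
  next
    case False
    then have ce: "c i \<notin> V" "coord (c i) = 1/2" by auto
    then have "chart_edge c i = Some (edge (c i))" by (simp add: chart_edge_def)
    then show ?thesis
      using nbhd_mid[OF \<eta> ce nb(1)] nbhd_mid[OF \<eta> ce nb(2)] \<eta> by (simp add: shift_def cross_def)
  qed
qed

definition carry :: "nat \<Rightarrow> (nat \<Rightarrow> 'a) \<Rightarrow> (nat \<Rightarrow> 'a) \<Rightarrow> ('a set, nat) heap \<Rightarrow> ('a set, nat) heap" where
  "carry n x x' p = transport n (\<lambda>i. cross (x i) (x' i)) p"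

lemma carry_refl: "carry n x x p = p"
  unfolding carry_def by (rule transport_none) (rule cross_refl)

lemma carry_chart:
  assumes "c \<in> topspace (sink_conf n G V)" "0 < \<eta>" "\<eta> \<le> 1/4" "x \<in> chart n \<eta> c" "x' \<in> chart n \<eta> c"
  shows "carry n x x' p = transport n (shift (chart_edge c) (\<lambda>i. side (x i)) (\<lambda>i. side (x' i))) p"
  unfolding carry_def by (rule transport_cong) (rule chart_cross[OF assms])

lemma carry_carry:
  assumes W: "good_chart n W" "x \<in> W" "x' \<in> W" "x'' \<in> W" and p: "reduced_heap p"
  shows "carry n x' x'' (carry n x x' p) = carry n x x'' p"
proof -
  obtain c \<eta> where c: "c \<in> topspace (sink_conf n G V)" "0 < \<eta>" "\<eta> \<le> 1/4" and W': "W = chart n \<eta> c"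
    using W(1) unfolding good_chart_def by blast
  note x = W(2-4)[unfolded W']
  show ?thesis
    unfolding carry_chart[OF c x(2,3)] carry_chart[OF c x(1,2)] carry_chart[OF c x(1,3)]
    by (rule shift_shift[OF matching_chart_edge[OF c(1)] p])
qed

text \<open>
  The heap \<open>p\<close> lies over the configuration \<open>x\<close>: walking along the stacks leads from the rounded initial
  configuration \<open>v\<close> to the rounding of \<open>x\<close>.
\<close>

definition tracks :: "nat \<Rightarrow> (nat \<Rightarrow> 'a) \<Rightarrow> (nat \<Rightarrow> 'a) \<Rightarrow> ('a set, nat) heap \<Rightarrow> bool" where
  "tracks n v x p \<longleftrightarrow> reduced_heap p \<and>
     (\<forall>i<n. walk (v i) (snd p i) \<and> tip (v i) (snd p i) = rounding (x i)) \<and> (\<forall>i\<ge>n. snd p i = [])"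

lemma walk_move:
  assumes "walk v (snd p i)" "e \<in> E" "tip v (snd p i) = \<phi> e (of_bool (\<not> b))"
  shows "walk v (snd (move e i b p) i) \<and> tip v (snd (move e i b p) i) = \<phi> e (of_bool b)"
proof (cases "cancels p e i b")
  case True
  then obtain m Y where "snd p i = (e, \<not> b, m) # Y" by (auto simp: cancels_def)
  then show ?thesis using assms True by (simp add: move_def pop_def)
next
  case False
  then show ?thesis using assms by (simp add: move_def push_def)
qed

lemma tracks_carry:
  assumes W: "good_chart n W" "x \<in> W" "x' \<in> W" and p: "tracks n v x p"
  shows "tracks n v x' (carry n x x' p)"
proof -
  obtain c \<eta> where c: "c \<in> topspace (sink_conf n G V)" "0 < \<eta>" "\<eta> \<le> 1/4" and W': "W = chart n \<eta> c"
    using W(1) unfolding good_chart_def by blast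
  note x = W(2-3)[unfolded W']
  have red: "reduced_heap p" using p by (simp add: tracks_def)
  let ?q = "transport n (shift (chart_edge c) (\<lambda>i. side (x i)) (\<lambda>i. side (x' i))) p"
  have "walk (v i) (snd ?q i) \<and> tip (v i) (snd ?q i) = rounding (x' i)" if i: "i < n" for i
  proof -
    have pi: "walk (v i) (snd p i)" "tip (v i) (snd p i) = rounding (x i)" using p i by (auto simp: tracks_def)
    have nb: "x i \<in> nbhd \<eta> (c i)" "x' i \<in> nbhd \<eta> (c i)" using x i by (auto simp: chart_def)
    show ?thesis
    proof (cases "c i \<in> V \<or> coord (c i) \<noteq> 1/2")
      case True
      then have "chart_edge c i = None" by (auto simp: chart_edge_def)
      then have "snd ?q i = snd p i" by (intro shift_off(2)) simp
      then show ?thesis using pi nbhd_rigid(1)[OF sink_conf_in[OF c(1) i] c(2,3) True nb] by simp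
    next
      case False
      then have ce: "c i \<notin> V" "coord (c i) = 1/2" by auto
      then have ed: "chart_edge c i = Some (edge (c i))" by (simp add: chart_edge_def)
      note z = nbhd_mid[OF c(2,3) ce nb(1)] and z' = nbhd_mid[OF c(2,3) ce nb(2)]
      have eE: "edge (c i) \<in> E" using coord_cases(1)[OF sink_conf_in[OF c(1) i] ce(1)] .
      have r: "rounding (x i) = \<phi> (edge (c i)) (of_bool (side (x i)))"
        "rounding (x' i) = \<phi> (edge (c i)) (of_bool (side (x' i)))"
        using z z' by (simp_all add: rounding_def)
      note at = shift_at[OF matching_chart_edge[OF c(1)] i ed red, of "\<lambda>i. side (x i)" "\<lambda>i. side (x' i)"]
      show ?thesis
      proof (cases "side (x i) = side (x' i)")
        case True
        with at(1) show ?thesis using pi r by simp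
      next
        case F: False
        then have "tip (v i) (snd p i) = \<phi> (edge (c i)) (of_bool (\<not> side (x' i)))" using pi(2) r(1) by simp
        from walk_move[OF pi(1) eE this] at(2)[OF F] r(2) show ?thesis by simp
      qed
    qed
  qed
  moreover have "snd ?q i = []" if "n \<le> i" for i
  proof -
    have "snd ?q i = snd p i" using that by (intro shift_off(2)) simp
    then show ?thesis using p that by (simp add: tracks_def)
  qed
  moreover have "reduced_heap ?q" by (rule reduced_transport[OF red])
  ultimately show ?thesis unfolding carry_chart[OF c x] tracks_def by (intro conjI allI impI) simp_all
qed

lemma cubical_carry:
  assumes W: "good_chart n W" "x \<in> W" and p: "reduced_heap p"
  shows "cubical ((\<lambda>x'. carry n x x' p) ` W)"
proof -
  obtain c \<eta> where c: "c \<in> topspace (sink_conf n G V)" "0 < \<eta>" "\<eta> \<le> 1/4" and W': "W = chart n \<eta> c"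
    using W(1) unfolding good_chart_def by blast
  have "(\<lambda>x'. carry n x x' p) ` W \<subseteq> range (\<lambda>\<gamma>. transport n (shift (chart_edge c) (\<lambda>i. side (x i)) \<gamma>) p)"
  proof (rule image_subsetI)
    fix x' assume "x' \<in> W"
    then show "carry n x x' p \<in> range (\<lambda>\<gamma>. transport n (shift (chart_edge c) (\<lambda>i. side (x i)) \<gamma>) p)"
      using carry_chart[OF c W(2)[unfolded W'], of x' p] W' by auto
  qed
  then show ?thesis
    by (rule cubical_subset[OF cubical_shift[OF matching_chart_edge[OF c(1)] p]])
qed

text \<open>
  The cube is star-shaped about the origin, so the lift over \<open>s\<close> is obtained by composing the moves along
  the segment from the origin to \<open>s\<close>, cut into \<open>N\<close> short steps. For nearby \<open>s\<close> and \<open>s'\<close> the two segments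
  are joined by a ladder of short rungs; each square of the ladder lies in one chart, where
  \<open>carry_carry\<close> says that the moves around it agree.
\<close>

lemma exists_lift:
  assumes d: "0 < d"
    and chart: "\<And>s. s \<in> topspace (cube k) \<Longrightarrow>
      \<exists>W. good_chart n W \<and> (\<forall>s'\<in>topspace (cube k). near k d s s' \<longrightarrow> f s' \<in> W)"
  defines "v \<equiv> \<lambda>i. rounding (f (shrink k 0 (\<lambda>_. 0)) i)"
  obtains g where "\<And>s. s \<in> topspace (cube k) \<Longrightarrow> tracks n v (f s) (g s)"
    "\<And>s s'. s \<in> topspace (cube k) \<Longrightarrow> s' \<in> topspace (cube k) \<Longrightarrow> near k (d/2) s s' \<Longrightarrow>
       g s' = carry n (f s) (f s') (g s)"
    "g (shrink k 0 (\<lambda>_. 0)) = empty_heap"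
proof -
  let ?K = "topspace (cube k)" and ?o = "shrink k 0 (\<lambda>_. 0)"
  obtain N0 :: nat where "2 / d < real N0" using reals_Archimedean2 by blast
  define N where "N = Suc N0"
  have N: "0 < N" "1 / real N < d/2"
  proof -
    have "2 / d < real N" using \<open>2 / d < real N0\<close> by (simp add: N_def)
    then show "1 / real N < d/2" using d by (simp add: field_simps N_def)
  qed (simp add: N_def)
  define pt where "pt j s = shrink k (real j / real N) s" for j s
  have pt_in: "pt j s \<in> ?K" if "j \<le> N" "s \<in> ?K" for j s
    unfolding pt_def using that N by (intro shrink_in) auto
  have pt_step: "near k (d/2) (pt j s) (pt (Suc j) s)" if "s \<in> ?K" for j s
    unfolding near_def
  proof (intro allI impI)
    fix i assume "i < k"
    then have s: "0 \<le> s i" "s i \<le> 1" using that by (auto simp: cube_mem)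
    have "pt j s i - pt (Suc j) s i = - (s i / real N)"
      using \<open>i < k\<close> N(1) by (simp add: pt_def shrink_def field_simps)
    then have "\<bar>pt j s i - pt (Suc j) s i\<bar> = s i / real N" using s by simp
    also have "\<dots> \<le> 1 / real N" using s N(1) by (intro divide_right_mono) auto
    finally show "\<bar>pt j s i - pt (Suc j) s i\<bar> < d/2" using N(2) by simp
  qed
  have pt_near: "near k (d/2) (pt j s) (pt j s')" if "near k (d/2) s s'" "j \<le> N" for j s s'
    unfolding near_def
  proof (intro allI impI)
    fix i assume "i < k"
    let ?r = "real j / real N"
    have r: "0 \<le> ?r" "?r \<le> 1" using that(2) N(1) by auto
    have "pt j s i - pt j s' i = ?r * (s i - s' i)"
      using \<open>i < k\<close> by (simp add: pt_def shrink_def right_diff_distrib)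
    then have "\<bar>pt j s i - pt j s' i\<bar> = ?r * \<bar>s i - s' i\<bar>"
      by (simp only: abs_mult abs_of_nonneg[OF r(1)])
    also have "\<dots> \<le> 1 * \<bar>s i - s' i\<bar>" using r by (intro mult_right_mono) auto
    also have "\<dots> < d/2" using that(1) \<open>i < k\<close> by (simp add: near_def)
    finally show "\<bar>pt j s i - pt j s' i\<bar> < d/2" .
  qed
  define h where "h s = rec_nat empty_heap (\<lambda>j p. carry n (f (pt j s)) (f (pt (Suc j) s)) p)" for s
  have h0: "h s 0 = empty_heap" and hSuc: "h s (Suc j) = carry n (f (pt j s)) (f (pt (Suc j) s)) (h s j)" for s j
    by (simp_all add: h_def)
  have pt0: "pt 0 s = ?o" for s by (simp add: pt_def shrink_zero[of k s "\<lambda>_. 0"])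
  have K0: "?o \<in> ?K" by (auto simp: cube_mem shrink_def)
  have vin: "v i \<in> V" if "i < n" for i
  proof -
    obtain W where W: "good_chart n W" "f ?o \<in> W" using chart[OF K0] K0 near_refl[OF d] by blast
    then have "f ?o \<in> topspace (sink_conf n G V)" unfolding good_chart_def chart_def by auto
    then show ?thesis unfolding v_def by (intro rounding_in sink_conf_in[OF _ that])
  qed
  have track: "tracks n v (f (pt j s)) (h s j)" if sK: "s \<in> ?K" and jN: "j \<le> N" for s j
    using jN
  proof (induction j)
    case 0
    show ?case using vin unfolding tracks_def h0 pt0 v_def
      by (auto simp: empty_heap_def reduced_empty[unfolded empty_heap_def])
  next
    case (Suc j)
    obtain W where W: "good_chart n W" "\<forall>s'\<in>?K. near k d (pt j s) s' \<longrightarrow> f s' \<in> W"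
      using chart[OF pt_in[of j s]] Suc.prems sK by auto
    have "f (pt j s) \<in> W" using W(2) pt_in[of j s] Suc.prems sK near_refl[OF d] by auto
    moreover have "f (pt (Suc j) s) \<in> W"
      using W(2) pt_in[OF Suc.prems sK] near_mono[OF pt_step[OF sK], of d] d by auto
    ultimately show ?case unfolding hSuc using tracks_carry[OF W(1)] Suc by simp
  qed
  have red: "reduced_heap (h s j)" if "s \<in> ?K" "j \<le> N" for s j
    using track[OF that] by (simp add: tracks_def)
  have comp: "h s' j = carry n (f (pt j s)) (f (pt j s')) (h s j)"
    if s: "s \<in> ?K" "s' \<in> ?K" and ns: "near k (d/2) s s'" and j: "j \<le> N" for s s' j
    using j
  proof (induction j)
    case 0
    then show ?case by (simp add: h0 pt0 carry_refl)
  next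
    case (Suc j)
    let ?a = "pt j s" and ?a' = "pt j s'" and ?b = "pt (Suc j) s" and ?b' = "pt (Suc j) s'"
    have j: "j \<le> N" using Suc.prems by simp
    obtain W where W: "good_chart n W" "\<forall>s'\<in>?K. near k d ?b s' \<longrightarrow> f s' \<in> W"
      using chart[OF pt_in[OF Suc.prems s(1)]] by blast
    have ba: "near k (d/2) ?b ?a" by (rule near_sym[OF pt_step[OF s(1)]])
    have "near k (d/2 + d/2) ?b ?a'" by (rule near_trans[OF ba pt_near[OF ns j]])
    then have a': "f ?a' \<in> W" using W(2) pt_in[OF j s(2)] by simp
    have a: "f ?a \<in> W" using W(2) pt_in[OF j s(1)] near_mono[OF ba, of d] d by simp
    have b: "f ?b \<in> W" using W(2) pt_in[OF Suc.prems s(1)] near_refl[OF d] by simp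
    have b': "f ?b' \<in> W"
      using W(2) pt_in[OF Suc.prems s(2)] near_mono[OF pt_near[OF ns Suc.prems], of d] d by simp
    have "h s' (Suc j) = carry n (f ?a') (f ?b') (carry n (f ?a) (f ?a') (h s j))"
      using Suc.IH[OF j] by (simp add: hSuc)
    also have "\<dots> = carry n (f ?a) (f ?b') (h s j)" by (rule carry_carry[OF W(1) a a' b' red[OF s(1) j]])
    also have "\<dots> = carry n (f ?b) (f ?b') (carry n (f ?a) (f ?b) (h s j))"
      by (rule carry_carry[OF W(1) a b b' red[OF s(1) j], symmetric])
    finally show ?case by (simp add: hSuc)
  qed
  have ptN: "pt N s = s" if "s \<in> ?K" for s
    using N(1) shrink_one[OF that] by (simp add: pt_def)
  have "h ?o j = empty_heap" for j
  proof (induction j)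
    case (Suc j)
    have "pt j ?o = ?o" for j by (simp add: pt_def shrink_def fun_eq_iff)
    then show ?case using Suc by (simp add: hSuc carry_refl)
  qed (simp add: h0)
  then show ?thesis
    using that[of "\<lambda>s. h s N"] track[of _ N] comp[of _ _ N] ptN by simp
qed

lemma lift_constant_along:
  assumes d: "0 < d"
    and g: "\<And>s s'. s \<in> topspace (cube k) \<Longrightarrow> s' \<in> topspace (cube k) \<Longrightarrow> near k d s s' \<Longrightarrow>
       g s' = carry n (f s) (f s') (g s)"
    and \<sigma>: "\<And>r. r \<in> {0..1} \<Longrightarrow> \<sigma> r \<in> topspace (cube k)" "\<And>r. r \<in> {0..1} \<Longrightarrow> f (\<sigma> r) = x0"
      "\<And>r r' i. i < k \<Longrightarrow> r \<in> {0..1} \<Longrightarrow> r' \<in> {0..1} \<Longrightarrow> \<bar>\<sigma> r i - \<sigma> r' i\<bar> \<le> \<bar>r - r'\<bar>"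
  shows "g (\<sigma> 1) = g (\<sigma> 0)"
proof -
  obtain N0 :: nat where "1 / d < real N0" using reals_Archimedean2 by blast
  define N where "N = Suc N0"
  have "1 / d < real N" using \<open>1 / d < real N0\<close> by (simp add: N_def)
  then have N: "1 / real N < d" using d by (simp add: field_simps N_def)
  have "g (\<sigma> (real j / real N)) = g (\<sigma> 0)" if "j \<le> N" for j
    using that
  proof (induction j)
    case (Suc j)
    let ?r = "real j / real N" and ?r' = "real (Suc j) / real N"
    have r: "?r \<in> {0..1}" "?r' \<in> {0..1}" using Suc.prems by (auto simp: N_def field_simps)
    have "near k d (\<sigma> ?r) (\<sigma> ?r')"
      unfolding near_def
    proof (intro allI impI)
      fix i assume "i < k"
      have "?r' = ?r + 1 / real N" by (simp add: add_divide_distrib)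
      then have "\<bar>?r - ?r'\<bar> = 1 / real N" by simp
      with \<sigma>(3)[OF \<open>i < k\<close> r] N show "\<bar>\<sigma> ?r i - \<sigma> ?r' i\<bar> < d" by simp
    qed
    from g[OF \<sigma>(1)[OF r(1)] \<sigma>(1)[OF r(2)] this] have "g (\<sigma> ?r') = g (\<sigma> ?r)"
      unfolding \<sigma>(2)[OF r(1)] \<sigma>(2)[OF r(2)] carry_refl .
    then show ?case using Suc by simp
  qed simp
  from this[of N] show ?thesis by (simp add: N_def)
qed

text \<open>
  For \<open>k \<ge> 2\<close> each boundary point is joined to the origin inside the boundary: first move a coordinate
  \<open>l\<close> other than the one that is 0 or 1 to zero, then shrink everything.
\<close>

lemma lift_on_boundary:
  assumes k: "2 \<le> k" and d: "0 < d"
    and g: "\<And>s s'. s \<in> topspace (cube k) \<Longrightarrow> s' \<in> topspace (cube k) \<Longrightarrow> near k d s s' \<Longrightarrow>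
       g s' = carry n (f s) (f s') (g s)"
    and f: "\<And>s. s \<in> cube_boundary k \<Longrightarrow> f s = x0"
    and s: "s \<in> cube_boundary k"
  shows "g s = g (shrink k 0 (\<lambda>_. 0))"
proof -
  have sK: "s \<in> topspace (cube k)" using s by (simp add: cube_boundary_def)
  obtain j where j: "j < k" "s j = 0 \<or> s j = 1" using s by (auto simp: cube_boundary_def)
  define l where "l = (if j = 0 then 1 else 0 :: nat)"
  have l: "l < k" "l \<noteq> j" using k by (auto simp: l_def)
  define \<sigma> where "\<sigma> r = s(l := r * s l)" for r
  define \<tau> where "\<tau> r = shrink k r (\<sigma> 0)" for r
  have sl: "0 \<le> s l" "s l \<le> 1" using sK l by (auto simp: cube_mem)
  have \<sigma>K: "\<sigma> r \<in> topspace (cube k)" if "r \<in> {0..1}" for r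
    using sK l sl that by (auto simp: cube_mem \<sigma>_def extensional_def mult_le_one)
  have \<sigma>: "\<sigma> r \<in> cube_boundary k" if "r \<in> {0..1}" for r
    unfolding cube_boundary_def using \<sigma>K[OF that] j l by (auto simp: \<sigma>_def intro!: exI[of _ j])
  have \<tau>: "\<tau> r \<in> cube_boundary k" if "r \<in> {0..1}" for r
    unfolding cube_boundary_def \<tau>_def using shrink_in[OF \<sigma>K[of 0], of r] that l
    by (auto simp: shrink_def \<sigma>_def intro!: exI[of _ l])
  have "g (\<sigma> 1) = g (\<sigma> 0)"
  proof (rule lift_constant_along[OF d g])
    show "f (\<sigma> r) = x0" if "r \<in> {0..1}" for r using f \<sigma>[OF that] by blast
    show "\<bar>\<sigma> r i - \<sigma> r' i\<bar> \<le> \<bar>r - r'\<bar>" for r r' i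
    proof (cases "i = l")
      case True
      then have "\<bar>\<sigma> r i - \<sigma> r' i\<bar> = \<bar>r - r'\<bar> * s l"
        using sl by (simp add: \<sigma>_def left_diff_distrib[symmetric] abs_mult)
      also have "\<dots> \<le> \<bar>r - r'\<bar> * 1" using sl by (intro mult_left_mono) auto
      finally show ?thesis by simp
    qed (simp add: \<sigma>_def)
  qed (use \<sigma>K in auto)
  moreover have "g (\<tau> 1) = g (\<tau> 0)"
  proof (rule lift_constant_along[OF d g])
    show "f (\<tau> r) = x0" if "r \<in> {0..1}" for r using f \<tau>[OF that] by blast
    show "\<tau> r \<in> topspace (cube k)" if "r \<in> {0..1}" for r using \<tau>[OF that] by (simp add: cube_boundary_def)
    show "\<bar>\<tau> r i - \<tau> r' i\<bar> \<le> \<bar>r - r'\<bar>" if "i < k" for r r' i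
    proof -
      have b: "0 \<le> \<sigma> 0 i" "\<sigma> 0 i \<le> 1" using \<sigma>K[of 0] that by (auto simp: cube_mem)
      have "\<bar>\<tau> r i - \<tau> r' i\<bar> = \<bar>r - r'\<bar> * \<sigma> 0 i"
        using b that by (simp add: \<tau>_def shrink_def left_diff_distrib[symmetric] abs_mult)
      also have "\<dots> \<le> \<bar>r - r'\<bar> * 1" using b by (intro mult_left_mono) auto
      finally show ?thesis by simp
    qed
  qed
  moreover have "\<sigma> 1 = s" by (simp add: \<sigma>_def)
  moreover have "\<tau> 1 = \<sigma> 0" unfolding \<tau>_def by (rule shrink_one[OF \<sigma>K]) simp
  moreover have "\<tau> 0 = shrink k 0 (\<lambda>_. 0)" unfolding \<tau>_def by (rule shrink_zero)
  ultimately show ?thesis by simp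
qed

end

section \<open>Sliding particles along their edges\<close>

context cw_graph
begin

definition slide :: "real \<Rightarrow> 'a \<Rightarrow> real \<Rightarrow> 'a" where
  "slide t z \<kappa> = (if z \<in> V then z else \<phi> (edge z) ((1 - t) * coord z + t * \<kappa>))"

lemma slide_zero: "z \<in> topspace G \<Longrightarrow> slide 0 z \<kappa> = z"
  using coord_cases(4) by (simp add: slide_def)

lemma convex_01:
  fixes t a b :: real
  assumes "0 \<le> t" "t \<le> 1" "0 \<le> a" "a \<le> 1" "0 \<le> b" "b \<le> 1"
  shows "0 \<le> (1 - t) * a + t * b" "(1 - t) * a + t * b \<le> 1"
  using assms convex_bound_le[of a 1 b "1 - t" t] by simp_all

text \<open>
  If the targets are ordered like the particles, particles of one edge keep their strict order before
  time 1. At time 1 they can meet only if their targets agree, and common targets are ends of the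
  edge, where collisions are permitted.
\<close>

lemma slide_conf:
  assumes x: "x \<in> topspace (sink_conf n G V)" and t: "0 \<le> t" "t \<le> 1"
    and \<kappa>: "\<And>i. i < n \<Longrightarrow> 0 \<le> \<kappa> i \<and> \<kappa> i \<le> 1"
    and mono: "\<And>i j. i < n \<Longrightarrow> j < n \<Longrightarrow> i \<noteq> j \<Longrightarrow> x i \<notin> V \<Longrightarrow> x j \<notin> V \<Longrightarrow> edge (x i) = edge (x j) \<Longrightarrow>
      coord (x i) < coord (x j) \<Longrightarrow> \<kappa> i \<le> \<kappa> j"
    and strict: "\<And>i j. i < n \<Longrightarrow> j < n \<Longrightarrow> i \<noteq> j \<Longrightarrow> x i \<notin> V \<Longrightarrow> x j \<notin> V \<Longrightarrow> edge (x i) = edge (x j) \<Longrightarrow>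
      \<kappa> i = \<kappa> j \<Longrightarrow> \<kappa> i = 0 \<or> \<kappa> i = 1"
    and ij: "i < n" "j < n" "i \<noteq> j" and eq: "slide t (x i) (\<kappa> i) = slide t (x j) (\<kappa> j)"
  shows "slide t (x i) (\<kappa> i) \<in> V"
proof (rule ccontr)
  assume nV: "slide t (x i) (\<kappa> i) \<notin> V"
  define w where "w l = (1 - t) * coord (x l) + t * \<kappa> l" for l
  have interior: "x l \<notin> V \<and> x l \<in> topspace G \<and> 0 < w l \<and> w l < 1 \<and> edge (x l) = edge (slide t (x i) (\<kappa> i)) \<and>
      w l = coord (slide t (x i) (\<kappa> i))" if l: "l < n" "slide t (x l) (\<kappa> l) = slide t (x i) (\<kappa> i)" for l
  proof -
    have G: "x l \<in> topspace G" by (rule sink_conf_in[OF x l(1)])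
    have xl: "x l \<notin> V"
    proof
      assume "x l \<in> V"
      then have "slide t (x l) (\<kappa> l) \<in> V" by (simp add: slide_def)
      then show False using nV l(2) by simp
    qed
    note c = coord_cases[OF G xl]
    have s: "slide t (x l) (\<kappa> l) = \<phi> (edge (x l)) (w l)" using xl by (simp add: slide_def w_def)
    have w: "0 \<le> w l" "w l \<le> 1"
      unfolding w_def using convex_01[OF t] c \<kappa>[OF l(1)] by simp_all
    have "\<phi> (edge (x l)) (w l) \<notin> V" using s l(2) nV by simp
    then have w': "0 < w l" "w l < 1" using edge_map_vertex_iff[OF c(1) w] w by auto
    note p = interior_point[OF c(1) w']
    have "edge (slide t (x i) (\<kappa> i)) = edge (x l)" "coord (slide t (x i) (\<kappa> i)) = w l"
      using p(3,4) s l(2) by simp_all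
    then show ?thesis using xl G w' by simp
  qed
  note I = interior[OF ij(1) refl] and J = interior[OF ij(2) eq[symmetric]]
  have no: False if lm: "l < n" "m < n" "l \<noteq> m" "x l \<notin> V" "x m \<notin> V" "edge (x l) = edge (x m)" "w l = w m" "0 < w l" "w l < 1"
    and lt: "coord (x l) < coord (x m)" for l m
  proof -
    have k: "\<kappa> l \<le> \<kappa> m" by (rule mono[OF lm(1-6) lt])
    have "(1 - t) * (coord (x m) - coord (x l)) + t * (\<kappa> m - \<kappa> l) = 0"
      using lm(7) by (simp add: w_def algebra_simps)
    moreover have "0 \<le> (1 - t) * (coord (x m) - coord (x l))" "0 \<le> t * (\<kappa> m - \<kappa> l)" using t lt k by simp_all
    ultimately have "(1 - t) * (coord (x m) - coord (x l)) = 0" "t * (\<kappa> m - \<kappa> l) = 0" by linarith+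
    then have "t = 1" "\<kappa> l = \<kappa> m" using lt by auto
    with strict[OF lm(1-6)] have "\<kappa> l = 0 \<or> \<kappa> l = 1" by simp
    with lm(8,9) \<open>t = 1\<close> show False by (auto simp: w_def)
  qed
  consider "coord (x i) < coord (x j)" | "coord (x j) < coord (x i)" | "coord (x i) = coord (x j)" by linarith
  then show False
  proof cases
    case 1
    with no[of i j] I J ij show False by simp
  next
    case 2
    with no[of j i] I J ij show False by simp
  next
    case 3
    then have "x i = x j" using coord_cases(4)[of "x i"] coord_cases(4)[of "x j"] I J by metis
    then show False using x ij I unfolding sink_conf_iff by blast
  qed
qed

text \<open>
  Near the ends the weight \<open>\<beta>\<close> is replaced by the end itself: nearby points may lie on the other arm of a
  loop there, or at its vertex, where their side carries no information.
\<close>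

definition target :: "'a \<Rightarrow> real \<Rightarrow> real" where
  "target z \<beta> = (if coord z \<le> 1/4 then 0 else if 3/4 \<le> coord z then 1 else \<beta>)"

definition upper :: "'j set \<Rightarrow> ('j \<Rightarrow> nat \<Rightarrow> 'a) \<Rightarrow> ('j \<Rightarrow> real) \<Rightarrow> nat \<Rightarrow> real" where
  "upper J y W i = (\<Sum>j\<in>J. if side (y j i) then W j else 0)"

lemma upper_cases:
  assumes W: "weights J W"
  shows "0 \<le> upper J y W i" "upper J y W i \<le> 1"
    and "(\<And>j. j \<in> J \<Longrightarrow> 0 < W j \<Longrightarrow> side (y j i) = b) \<Longrightarrow> upper J y W i = of_bool b"
proof -
  have fin: "finite J" and pos: "\<And>j. j \<in> J \<Longrightarrow> 0 \<le> W j" and one: "sum W J = 1" using W by (auto simp: weights_def)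
  show "0 \<le> upper J y W i" unfolding upper_def using pos by (intro sum_nonneg) simp
  have "upper J y W i \<le> sum W J" unfolding upper_def using pos by (intro sum_mono) simp
  then show "upper J y W i \<le> 1" using one by simp
  show "upper J y W i = of_bool b" if same: "\<And>j. j \<in> J \<Longrightarrow> 0 < W j \<Longrightarrow> side (y j i) = b"
  proof -
    have "upper J y W i = (\<Sum>j\<in>J. if b then W j else 0)"
      unfolding upper_def
    proof (rule sum.cong)
      fix j assume "j \<in> J"
      with pos[OF this] same[OF this] show "(if side (y j i) then W j else 0) = (if b then W j else 0)"
        by (cases "W j = 0") auto
    qed simp
    then show ?thesis using one by (cases b) simp_all
  qed
qed

lemma nbhd_low_high:
  assumes "\<eta> \<le> 1/4" "0 < \<eta>" "c \<notin> V" "coord c \<noteq> 1/2" "z \<in> nbhd \<eta> c"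
  shows "z \<notin> V" "edge z = edge c" "side z = (1/2 < coord c)" "coord c < 1/2 \<Longrightarrow> coord z < 1/2 - \<eta>"
    "1/2 < coord c \<Longrightarrow> 1/2 + \<eta> < coord z"
  using assms by (auto simp: nbhd_def arc_def side_def split: if_split_asm)

text \<open>
  Within a chart, only a particle close to a midpoint has a target that is not an end of its edge, and
  all other particles of this edge are pushed away from it. At \<open>1/4\<close> and \<open>3/4\<close> the two descriptions of the
  target agree, which gives continuity.
\<close>

lemma target_cases:
  assumes c: "c \<in> topspace (sink_conf n G V)" and \<eta>: "0 < \<eta>" "\<eta> \<le> 1/4"
    and x: "x \<in> chart n \<eta> c" and y: "\<forall>j\<in>J. 0 < W j \<longrightarrow> y j \<in> chart n \<eta> c"
    and W: "weights J W" and i: "i < n" and xi: "x i \<notin> V"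
  defines "\<kappa> \<equiv> target (x i) (upper J y W i)"
  shows "(\<kappa> = 0 \<and> coord (x i) < 1/2 - \<eta> \<and> \<not> side (x i)) \<or> (\<kappa> = 1 \<and> 1/2 + \<eta> < coord (x i) \<and> side (x i)) \<or>
     (c i \<notin> V \<and> coord (c i) = 1/2 \<and> edge (x i) = edge (c i) \<and> \<kappa> = upper J y W i \<and>
        1/2 - \<eta> < coord (x i) \<and> coord (x i) < 1/2 + \<eta>)"
    and "coord (x i) \<le> 1/4 \<Longrightarrow> \<kappa> = 0" "3/4 \<le> coord (x i) \<Longrightarrow> \<kappa> = 1"
    and "1/4 \<le> coord (x i) \<Longrightarrow> coord (x i) \<le> 3/4 \<Longrightarrow> \<kappa> = upper J y W i"
proof -
  have nb: "x i \<in> nbhd \<eta> (c i)" using x i by (simp add: chart_def)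
  have nby: "y j i \<in> nbhd \<eta> (c i)" if "j \<in> J" "0 < W j" for j using y that i by (simp add: chart_def)
  let ?P = "(\<kappa> = 0 \<and> coord (x i) < 1/2 - \<eta> \<and> \<not> side (x i)) \<or> (\<kappa> = 1 \<and> 1/2 + \<eta> < coord (x i) \<and> side (x i)) \<or>
     (c i \<notin> V \<and> coord (c i) = 1/2 \<and> edge (x i) = edge (c i) \<and> \<kappa> = upper J y W i \<and>
        1/2 - \<eta> < coord (x i) \<and> coord (x i) < 1/2 + \<eta>)"
  have 2: "coord (x i) \<le> 1/4 \<Longrightarrow> \<kappa> = 0" and 3: "3/4 \<le> coord (x i) \<Longrightarrow> \<kappa> = 1" by (simp_all add: \<kappa>_def target_def)
  have "?P \<and> (1/4 \<le> coord (x i) \<longrightarrow> coord (x i) \<le> 3/4 \<longrightarrow> \<kappa> = upper J y W i)"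
  proof (cases "c i \<in> V")
    case True
    then have "coord (x i) < 1/4 \<or> 3/4 < coord (x i)" using nb xi by (auto simp: nbhd_def star_def)
    then show ?thesis using 2 3 \<eta> by (auto simp: side_def)
  next
    case False
    show ?thesis
    proof (cases "coord (c i) = 1/2")
      case True
      note m = nbhd_mid[OF \<eta> False True nb]
      then have "1/4 < coord (x i)" "coord (x i) < 3/4" using \<eta> by linarith+
      then have "\<kappa> = upper J y W i" by (simp add: \<kappa>_def target_def)
      then show ?thesis using m False True by simp
    next
      case F: False
      note l = nbhd_low_high[OF \<eta>(2,1) False F]
      have u: "upper J y W i = of_bool (1/2 < coord (c i))"
      proof (rule upper_cases(3)[OF W])
        fix j assume "j \<in> J" "0 < W j"
        from nbhd_low_high(3)[OF \<eta>(2,1) False F nby[OF this]] show "side (y j i) = (1/2 < coord (c i))" .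
      qed
      show ?thesis
      proof (cases "coord (c i) < 1/2")
        case True
        then have "coord (x i) < 1/2 - \<eta>" "\<not> side (x i)" using l(3,4)[OF nb] by auto
        moreover have "\<kappa> = 0" "upper J y W i = 0" using calculation u True \<eta> by (auto simp: \<kappa>_def target_def)
        ultimately show ?thesis by simp
      next
        case False
        then have gt: "1/2 < coord (c i)" using F by simp
        then have "1/2 + \<eta> < coord (x i)" "side (x i)" using l(3,5)[OF nb] by auto
        moreover have "\<kappa> = 1" "upper J y W i = 1" using calculation u gt \<eta> by (auto simp: \<kappa>_def target_def)
        ultimately show ?thesis by simp
      qed
    qed
  qed
  then show ?P and "1/4 \<le> coord (x i) \<Longrightarrow> coord (x i) \<le> 3/4 \<Longrightarrow> \<kappa> = upper J y W i" by blast+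
  show "coord (x i) \<le> 1/4 \<Longrightarrow> \<kappa> = 0" "3/4 \<le> coord (x i) \<Longrightarrow> \<kappa> = 1" using 2 3 by blast+
qed

lemma slide_in_conf:
  assumes c: "c \<in> topspace (sink_conf n G V)" and \<eta>: "0 < \<eta>" "\<eta> \<le> 1/4"
    and x: "x \<in> chart n \<eta> c" and y: "\<forall>j\<in>J. 0 < W j \<longrightarrow> y j \<in> chart n \<eta> c"
    and W: "weights J W" and t: "0 \<le> t" "t \<le> 1"
    and ij: "i < n" "j < n" "i \<noteq> j"
    and eq: "slide t (x i) (target (x i) (upper J y W i)) = slide t (x j) (target (x j) (upper J y W j))"
  shows "slide t (x i) (target (x i) (upper J y W i)) \<in> V"
proof (rule slide_conf[OF _ t _ _ _ ij eq])
  note tc = target_cases(1)[OF c \<eta> x y W]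
  have mid: "i = j" if "i < n" "j < n" "c i \<notin> V" "coord (c i) = 1/2" "c j \<notin> V" "coord (c j) = 1/2" "edge (c i) = edge (c j)" for i j
    using matching_chart_edge[OF c] that unfolding matching_def chart_edge_def by auto
  show "x \<in> topspace (sink_conf n G V)" using x by (simp add: chart_def)
  show "0 \<le> target (x i) (upper J y W i) \<and> target (x i) (upper J y W i) \<le> 1" for i
    using upper_cases(1,2)[OF W, of y i] by (simp add: target_def)
  show "target (x i) (upper J y W i) \<le> target (x j) (upper J y W j)"
    if "i < n" "j < n" "i \<noteq> j" "x i \<notin> V" "x j \<notin> V" "edge (x i) = edge (x j)" "coord (x i) < coord (x j)" for i j
  proof -
    have b: "0 \<le> target (x j) (upper J y W j)" "target (x i) (upper J y W i) \<le> 1"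
      using upper_cases(1,2)[OF W, of y] by (simp_all add: target_def)
    \<comment> \<open>two particles near the midpoint of the same edge would be at midpoints in the chart\<close>
    have nm: "\<not> (c i \<notin> V \<and> coord (c i) = 1/2 \<and> edge (x i) = edge (c i) \<and> c j \<notin> V \<and> coord (c j) = 1/2 \<and> edge (x j) = edge (c j))"
      using mid[OF that(1,2)] that(3,6) by auto
    show ?thesis
      using tc[OF that(1,4)] tc[OF that(2,5)] b nm that(7) \<eta> by linarith
  qed
  show "target (x i) (upper J y W i) = 0 \<or> target (x i) (upper J y W i) = 1"
    if "i < n" "j < n" "i \<noteq> j" "x i \<notin> V" "x j \<notin> V" "edge (x i) = edge (x j)"
      "target (x i) (upper J y W i) = target (x j) (upper J y W j)" for i j
    using tc[OF that(1,4)] tc[OF that(2,5)] mid[OF that(1,2)] that(3,6,7) by metis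
qed

text \<open>
  For a particle that crosses the midpoint of \<open>e\<close> in the chart, all labels have one of two stacks,
  according to the side on which the particle is. Whether the crossing pushes or cancels a piece, the
  parameter on \<open>e\<close> is the total weight of the labels with the particle on the upper side.
\<close>

lemma realize_is_slide:
  assumes c: "c \<in> topspace (sink_conf n G V)" and \<eta>: "0 < \<eta>" "\<eta> \<le> 1/4"
    and x: "x \<in> chart n \<eta> c" and y: "\<forall>j\<in>J. 0 < W j \<longrightarrow> y j \<in> chart n \<eta> c"
    and W: "weights J W" and p: "tracks n v x p"
    and q: "\<And>j. j \<in> J \<Longrightarrow> 0 < W j \<Longrightarrow> q j = carry n x (y j) p"
    and i: "i < n"
  shows "place (v i) (mass J (\<lambda>j. snd (q j) i) W) = slide 1 (x i) (target (x i) (upper J y W i))"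
proof -
  let ?\<mu> = "mass J (\<lambda>j. snd (q j) i) W"
  have fin: "finite J" and one: "sum W J = 1" and pos: "\<And>j. j \<in> J \<Longrightarrow> 0 \<le> W j"
    using W by (auto simp: weights_def)
  have nb: "x i \<in> nbhd \<eta> (c i)" using x i by (simp add: chart_def)
  have wp: "walk (v i) (snd p i)" "tip (v i) (snd p i) = rounding (x i)" "reduced_heap p"
    using p i by (auto simp: tracks_def)
  have qj: "q j = transport n (shift (chart_edge c) (\<lambda>i. side (x i)) (\<lambda>i. side (y j i))) p"
    if "j \<in> J" "0 < W j" for j
  proof -
    have "y j \<in> chart n \<eta> c" using y that by blast
    then show ?thesis using q[OF that] carry_chart[OF c \<eta> x] by simp
  qed
  show ?thesis
  proof (cases "c i \<notin> V \<and> coord (c i) = 1/2")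
    case False
    then have ce: "chart_edge c i = None" by (auto simp: chart_edge_def)
    have st: "snd (q j) i = snd p i" if "j \<in> J" "0 < W j" for j
      unfolding qj[OF that] using ce by (intro shift_off(2)) simp
    have "place (v i) ?\<mu> = tip (v i) (snd p i)"
    proof (rule place_tip)
      have "sum ?\<mu> {snd p i} = 1" by (rule mass_concentrated[OF W]) (simp_all add: st)
      then show "?\<mu> (snd p i) = 1" by simp
      fix Y assume "0 < ?\<mu> Y"
      then obtain j where "j \<in> J" "0 < W j" "snd (q j) i = Y" by (rule mass_pos[OF W])
      with st[OF this(1,2)] show "Y = snd p i" by simp
    qed
    also have "\<dots> = rounding (x i)" by (rule wp(2))
    also have "\<dots> = slide 1 (x i) (target (x i) (upper J y W i))"
    proof (cases "x i \<in> V")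
      case True
      then show ?thesis by (simp add: rounding_def slide_def)
    next
      case xi: False
      have "target (x i) (upper J y W i) = of_bool (side (x i))"
        using target_cases(1)[OF c \<eta> x y W i xi] False by (elim disjE conjE) simp_all
      then show ?thesis using xi by (simp add: rounding_def slide_def)
    qed
    finally show ?thesis .
  next
    case True
    then have ci: "c i \<notin> V" "coord (c i) = 1/2" by auto
    define e where "e = edge (c i)"
    have ce: "chart_edge c i = Some e" using ci by (simp add: chart_edge_def e_def)
    note m = nbhd_mid[OF \<eta> ci nb]
    have eE: "e \<in> E" unfolding e_def using coord_cases(1)[OF sink_conf_in[OF c i] ci(1)] .
    define b where "b = side (x i)"
    define st where "st b' = (if b' = b then snd p i else snd (move e i b' p) i)" for b'
    have sj: "snd (q j) i = st (side (y j i))" if "j \<in> J" "0 < W j" for j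
      using shift_at[OF matching_chart_edge[OF c] i ce wp(3), of "\<lambda>i. side (x i)" "\<lambda>i. side (y j i)"]
      unfolding qj[OF that] st_def b_def by auto
    have r: "rounding (x i) = \<phi> e (of_bool b)" using m by (simp add: rounding_def b_def e_def)
    have "tip (v i) (snd p i) = \<phi> e (of_bool (\<not> (\<not> b)))" using wp(2) r by simp
    note wm = walk_move[OF wp(1) eE this]
    have wst: "walk (v i) (st b')" for b' using wm wp(1) by (cases "b' = b") (auto simp: st_def)
    \<comment> \<open>in both cases the two stacks differ by a step of \<open>e\<close> towards the side of the longer one\<close>
    have rel: "(\<exists>l. st True = (e, True, l) # st False) \<or> (\<exists>l. st False = (e, False, l) # st True)"
    proof (cases "cancels p e i (\<not> b)")
      case True
      then obtain l Y where "snd p i = (e, b, l) # Y" by (auto simp: cancels_def)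
      then have "st b = (e, b, l) # st (\<not> b)" using True by (simp add: st_def move_def pop_def)
      then show ?thesis by (cases b) auto
    next
      case False
      then have "st (\<not> b) = (e, \<not> b, Suc (max (level (fst p e)) (level (snd p i)))) # st b"
        by (simp add: st_def move_def push_def)
      then show ?thesis by (cases b) auto
    qed
    have ne: "st True \<noteq> st False" using rel by auto
    have mT: "?\<mu> (st True) = upper J y W i"
      unfolding mass_filter[OF fin] upper_def
    proof (rule sum.cong)
      fix j assume j: "j \<in> J"
      show "(if snd (q j) i = st True then W j else 0) = (if side (y j i) then W j else 0)"
      proof (cases "0 < W j")
        case True
        then show ?thesis using sj[OF j] ne by (cases "side (y j i)") auto
      next
        case False
        then show ?thesis using pos[OF j] by simp
      qed
    qed simp
    have "sum ?\<mu> {st True, st False} = 1"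
    proof (rule mass_concentrated[OF W])
      fix j assume "j \<in> J" "0 < W j"
      from sj[OF this] show "snd (q j) i \<in> {st True, st False}" by (cases "side (y j i)") auto
    qed simp
    then have s: "?\<mu> (st True) + ?\<mu> (st False) = 1" using ne by simp
    have supp: "Y = st True \<or> Y = st False" if Y: "0 < ?\<mu> Y" for Y
    proof -
      obtain j where "j \<in> J" "0 < W j" "snd (q j) i = Y" using Y by (rule mass_pos[OF W])
      with sj[OF this(1,2)] show ?thesis by (cases "side (y j i)") auto
    qed
    have nn: "0 \<le> ?\<mu> Y" for Y by (rule mass_nonneg[OF W])
    from rel have "place (v i) ?\<mu> = \<phi> e (?\<mu> (st True))"
    proof (elim disjE exE)
      fix l assume st: "st True = (e, True, l) # st False"
      have "place (v i) ?\<mu> = \<phi> e (if True then ?\<mu> ((e, True, l) # st False) else 1 - ?\<mu> ((e, True, l) # st False))"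
        by (rule place_between) (use wst[of True] st s nn supp in auto)
      then show ?thesis using st by simp
    next
      fix l assume st: "st False = (e, False, l) # st True"
      have "place (v i) ?\<mu> = \<phi> e (if False then ?\<mu> ((e, False, l) # st True) else 1 - ?\<mu> ((e, False, l) # st True))"
        by (rule place_between) (use wst[of False] st s nn supp in \<open>auto simp: add.commute\<close>)
      moreover have "1 - ?\<mu> ((e, False, l) # st True) = ?\<mu> (st True)" using s st by simp
      ultimately show ?thesis by simp
    qed
    moreover have "target (x i) (upper J y W i) = upper J y W i"
      using target_cases(4)[OF c \<eta> x y W i m(1)] m(3,4) \<eta> by simp
    ultimately show ?thesis using m mT by (simp add: slide_def e_def)
  qed
qed

lemma continuous_slide:
  assumes F: "continuous_map Z G (\<lambda>z. F z)" and u: "continuous_map Z euclideanreal u"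
    and u01: "\<And>z. z \<in> topspace Z \<Longrightarrow> 0 \<le> u z \<and> u z \<le> 1"
    and target: "\<And>z. z \<in> topspace Z \<Longrightarrow> F z \<notin> V \<Longrightarrow> 1/4 \<le> coord (F z) \<Longrightarrow> coord (F z) \<le> 3/4 \<Longrightarrow>
      target (F z) (u z) = u z"
  shows "continuous_map (prod_topology (top_of_set {0..1}) Z) G (\<lambda>(t, z). slide t (F z) (target (F z) (u z)))"
    (is "continuous_map ?X G ?h")
proof (rule glue_over_graph[where F = "\<lambda>y. F (snd y)"])
  show "continuous_map ?X G (\<lambda>y. F (snd y))"
    using continuous_map_compose[OF continuous_map_snd F] by (simp add: o_def)
next
  fix v assume "v \<in> V"
  let ?S = "subtopology ?X {y \<in> topspace ?X. F (snd y) = v}"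
  have "continuous_map ?S G (\<lambda>_. v)" using vertex_in[OF \<open>v \<in> V\<close>] by simp
  then show "continuous_map ?S G ?h"
    by (rule continuous_map_eq) (use \<open>v \<in> V\<close> in \<open>auto simp: slide_def\<close>)
next
  have piece: "continuous_map (subtopology ?X {y \<in> topspace ?X. F (snd y) \<in> \<phi> e ` {a..b}}) G ?h"
    if e: "e \<in> E" and ab: "0 \<le> a" "b \<le> 1" "0 < a \<or> b < 1"
      and k: "continuous_map Z euclideanreal k" "\<And>z. z \<in> topspace Z \<Longrightarrow> 0 \<le> k z \<and> k z \<le> 1"
      and eq: "\<And>t z r. z \<in> topspace Z \<Longrightarrow> a \<le> r \<Longrightarrow> r \<le> b \<Longrightarrow> F z = \<phi> e r \<Longrightarrow> 0 < r \<Longrightarrow> r < 1 \<Longrightarrow> target (F z) (u z) = k z"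
      and k0: "\<And>z. z \<in> topspace Z \<Longrightarrow> a = 0 \<Longrightarrow> k z = 0" and k1: "\<And>z. z \<in> topspace Z \<Longrightarrow> b = 1 \<Longrightarrow> k z = 1"
    for e a b k
  proof -
    obtain \<theta> where \<theta>: "continuous_map (subtopology G (\<phi> e ` {a..b})) euclideanreal \<theta>"
      and \<theta>r: "\<And>r. a \<le> r \<Longrightarrow> r \<le> b \<Longrightarrow> \<theta> (\<phi> e r) = r"
      using arc_inverse[OF e ab] by blast
    let ?S = "subtopology ?X {y \<in> topspace ?X. F (snd y) \<in> \<phi> e ` {a..b}}"
    have Fs: "continuous_map ?S (subtopology G (\<phi> e ` {a..b})) (\<lambda>y. F (snd y))"
    proof -
      have "continuous_map ?S G (\<lambda>y. F (snd y))"
        using continuous_map_compose[OF continuous_map_snd F]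
        by (intro continuous_map_from_subtopology) (simp add: o_def)
      then show ?thesis by (auto simp: continuous_map_in_subtopology)
    qed
    have c1: "continuous_map ?S euclideanreal (\<lambda>y. \<theta> (F (snd y)))"
      using continuous_map_compose[OF Fs \<theta>] by (simp add: o_def)
    have c2: "continuous_map ?S euclideanreal (\<lambda>y. k (snd y))"
      using continuous_map_compose[OF continuous_map_snd k(1)]
      by (intro continuous_map_from_subtopology) (simp add: o_def)
    have c3: "continuous_map ?S euclideanreal fst"
      using continuous_map_fst[of "top_of_set {0..1::real}" Z]
      by (intro continuous_map_from_subtopology) (simp add: continuous_map_in_subtopology)
    have "continuous_map ?S euclideanreal (\<lambda>y. (1 - fst y) * \<theta> (F (snd y)) + fst y * k (snd y))"
      by (intro continuous_intros c1 c2 c3) simp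
    moreover have "(1 - fst y) * \<theta> (F (snd y)) + fst y * k (snd y) \<in> {0..1}" if y: "y \<in> topspace ?S" for y
    proof -
      obtain r where r: "a \<le> r" "r \<le> b" "F (snd y) = \<phi> e r" using y by auto
      have "0 \<le> fst y" "fst y \<le> 1" "snd y \<in> topspace Z" using y by auto
      then show ?thesis using convex_01[of "fst y" r "k (snd y)"] r ab k(2)[of "snd y"] \<theta>r[OF r(1,2)] by simp
    qed
    ultimately have "continuous_map ?S (top_of_set {0..1}) (\<lambda>y. (1 - fst y) * \<theta> (F (snd y)) + fst y * k (snd y))"
      unfolding continuous_map_in_subtopology by blast
    from continuous_map_compose[OF this edge_map_cont[OF e]]
    have "continuous_map ?S G (\<lambda>y. \<phi> e ((1 - fst y) * \<theta> (F (snd y)) + fst y * k (snd y)))" by (simp add: o_def)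
    then show ?thesis
    proof (rule continuous_map_eq)
      fix y assume y: "y \<in> topspace ?S"
      then obtain r where r: "a \<le> r" "r \<le> b" "F (snd y) = \<phi> e r" by auto
      have z: "snd y \<in> topspace Z" using y by auto
      have \<theta>': "\<theta> (F (snd y)) = r" using \<theta>r[OF r(1,2)] r(3) by simp
      show "\<phi> e ((1 - fst y) * \<theta> (F (snd y)) + fst y * k (snd y)) = ?h y"
      proof (cases "r = 0 \<or> r = 1")
        case True
        then have "k (snd y) = r" using k0[OF z] k1[OF z] r ab by auto
        moreover have "\<phi> e r \<in> V" using True edge_ends[OF e] by auto
        ultimately show ?thesis using \<theta>' r(3) by (simp add: slide_def split_beta algebra_simps)
      next
        case False
        then have r01: "0 < r" "r < 1" using r ab by auto
        note ip = interior_point[OF e r01]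
        show ?thesis using ip eq[OF z r r01] \<theta>' r(3) by (simp add: slide_def split_beta)
      qed
    qed
  qed
  fix e assume e: "e \<in> E"
  have coord: "coord (F z) = r" "F z \<notin> V" if "F z = \<phi> e r" "0 < r" "r < 1" for z r
    using interior_point[OF e that(2,3)] that(1) by simp_all
  show "continuous_map (subtopology ?X {y \<in> topspace ?X. F (snd y) \<in> \<phi> e ` {0..1/4}}) G ?h"
  proof (rule piece[of e 0 "1/4" "\<lambda>_. 0", OF e])
    fix z r assume "0 \<le> r" "r \<le> 1/4" "F z = \<phi> e r" "0 < r" "r < 1"
    then have "coord (F z) \<le> 1/4" using coord(1)[of z r] by simp
    then show "target (F z) (u z) = 0" by (simp add: target_def)
  qed auto
  show "continuous_map (subtopology ?X {y \<in> topspace ?X. F (snd y) \<in> \<phi> e ` {1/4..3/4}}) G ?h"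
  proof (rule piece[of e "1/4" "3/4" u, OF e])
    fix z r assume "z \<in> topspace Z" "1/4 \<le> r" "r \<le> 3/4" "F z = \<phi> e r" "0 < r" "r < 1"
    then show "target (F z) (u z) = u z" using coord[of z r] by (intro target) simp_all
  qed (use u u01 in auto)
  show "continuous_map (subtopology ?X {y \<in> topspace ?X. F (snd y) \<in> \<phi> e ` {3/4..1}}) G ?h"
  proof (rule piece[of e "3/4" 1 "\<lambda>_. 1", OF e])
    fix z r assume "3/4 \<le> r" "r \<le> 1" "F z = \<phi> e r" "0 < r" "r < 1"
    then have "3/4 \<le> coord (F z)" using coord(1)[of z r] by simp
    then show "target (F z) (u z) = 1" by (simp add: target_def)
  qed auto
qed

text \<open>
  The weights sit at points \<open>y j\<close> near \<open>f z\<close>, so that a common chart contains \<open>f z\<close> and all \<open>y j\<close> of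
  positive weight, and the labels are the heaps obtained by carrying a heap over \<open>f z\<close> to the \<open>y j\<close>.
\<close>

lemma homotopic_to_realization:
  assumes f: "continuous_map Z (sink_conf n G V) f"
    and W: "\<And>z. z \<in> topspace Z \<Longrightarrow> weights J (\<lambda>j. w j z)"
    and cont: "\<And>j. j \<in> J \<Longrightarrow> continuous_map Z euclideanreal (w j)"
    and chart: "\<And>z. z \<in> topspace Z \<Longrightarrow> \<exists>W. good_chart n W \<and> f z \<in> W \<and> (\<forall>j\<in>J. 0 < w j z \<longrightarrow> y j \<in> W)"
    and track: "\<And>z. z \<in> topspace Z \<Longrightarrow> tracks n v (f z) (g z)"
    and q: "\<And>z j. z \<in> topspace Z \<Longrightarrow> j \<in> J \<Longrightarrow> 0 < w j z \<Longrightarrow> q j = carry n (f z) (y j) (g z)"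
    and B: "B \<subseteq> topspace Z" "\<And>z. z \<in> B \<Longrightarrow> f z = x0" "\<And>z j. z \<in> B \<Longrightarrow> j \<in> J \<Longrightarrow> 0 < w j z \<Longrightarrow> y j = x0"
  shows "homotopic_with (\<lambda>h. \<exists>c. \<forall>z\<in>B. h z = c) Z (sink_conf n G V) f (\<lambda>z. realize n v J q (\<lambda>j. w j z))"
proof (cases "topspace Z = {}")
  case True
  then show ?thesis using B by (intro homotopic_with_equal) (auto simp: continuous_map_on_empty)
next
  case False
  then obtain z0 where "z0 \<in> topspace Z" by blast
  from W[OF this] have fin: "finite J" by (simp add: weights_def)
  let ?X = "prod_topology (top_of_set {0..1::real}) Z"
  define U where "U i z = upper J y (\<lambda>j. w j z) i" for i z
  define S where "S i = (\<lambda>(t, z). slide t (f z i) (target (f z i) (U i z)))" for i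
  define H where "H a = (\<lambda>i\<in>{..<n}. S i a)" for a
  have fz: "f z \<in> topspace (sink_conf n G V)" if "z \<in> topspace Z" for z
    using continuous_map_image_subset_topspace[OF f] that by blast
  have chart': "\<exists>c \<eta>. c \<in> topspace (sink_conf n G V) \<and> 0 < \<eta> \<and> \<eta> \<le> 1/4 \<and> f z \<in> chart n \<eta> c \<and>
      (\<forall>j\<in>J. 0 < w j z \<longrightarrow> y j \<in> chart n \<eta> c)" if "z \<in> topspace Z" for z
    using chart[OF that] unfolding good_chart_def by blast
  have comp: "continuous_map Z G (\<lambda>z. f z i)" if "i < n" for i
    using continuous_map_compose[OF f continuous_component[OF that]] by (simp add: o_def)
  have contU: "continuous_map Z euclideanreal (U i)" for i
    unfolding U_def upper_def using fin cont by (intro continuous_map_sum) auto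
  have contH: "continuous_map ?X (sink_conf n G V) (\<lambda>a. \<lambda>i\<in>{..<n}. S i a)"
  proof (rule continuous_into_sink_conf)
    fix i assume i: "i < n"
    show "continuous_map ?X G (S i)"
      unfolding S_def
    proof (rule continuous_slide[OF comp[OF i] contU])
      fix z assume z: "z \<in> topspace Z"
      show "0 \<le> U i z \<and> U i z \<le> 1" unfolding U_def using upper_cases(1,2)[OF W[OF z]] by blast
      assume m: "f z i \<notin> V" "1/4 \<le> coord (f z i)" "coord (f z i) \<le> 3/4"
      obtain c \<eta> where c: "c \<in> topspace (sink_conf n G V)" "0 < \<eta>" "\<eta> \<le> 1/4" "f z \<in> chart n \<eta> c"
        and yc: "\<forall>j\<in>J. 0 < w j z \<longrightarrow> y j \<in> chart n \<eta> c" using chart'[OF z] by blast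
      show "target (f z i) (U i z) = U i z"
        unfolding U_def by (rule target_cases(4)[OF c yc W[OF z] i m])
    qed
  next
    fix a i j assume a: "a \<in> topspace ?X" and ij: "i < n" "j < n" "i \<noteq> j" and eq: "S i a = S j a"
    obtain t z where tz: "a = (t, z)" "0 \<le> t" "t \<le> 1" "z \<in> topspace Z" using a by (cases a) auto
    obtain c \<eta> where c: "c \<in> topspace (sink_conf n G V)" "0 < \<eta>" "\<eta> \<le> 1/4" "f z \<in> chart n \<eta> c"
      and yc: "\<forall>j\<in>J. 0 < w j z \<longrightarrow> y j \<in> chart n \<eta> c" using chart'[OF tz(4)] by blast
    show "S i a \<in> V"
      unfolding S_def tz(1) prod.case U_def
      by (rule slide_in_conf[OF c yc W[OF tz(4)] tz(2,3) ij])
        (use eq in \<open>simp add: S_def U_def tz(1)\<close>)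
  qed
  have H0: "H (0, z) = f z" if z: "z \<in> topspace Z" for z
  proof (rule extensionalityI[of _ "{..<n}"])
    show "H (0, z) \<in> extensional {..<n}" by (simp add: H_def)
    show "f z \<in> extensional {..<n}" using fz[OF z] by (simp add: sink_conf_iff PiE_iff)
    show "H (0, z) i = f z i" if "i \<in> {..<n}" for i
      using that sink_conf_in[OF fz[OF z], of i] by (simp add: H_def S_def slide_zero)
  qed
  have H1: "H (1, z) = realize n v J q (\<lambda>j. w j z)" if z: "z \<in> topspace Z" for z
  proof -
    obtain c \<eta> where c: "c \<in> topspace (sink_conf n G V)" "0 < \<eta>" "\<eta> \<le> 1/4" "f z \<in> chart n \<eta> c"
      and yc: "\<forall>j\<in>J. 0 < w j z \<longrightarrow> y j \<in> chart n \<eta> c" using chart'[OF z] by blast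
    show ?thesis
      unfolding H_def realize_def
    proof (rule restrict_ext)
      fix i assume "i \<in> {..<n}"
      then have i: "i < n" by simp
      have "place (v i) (mass J (\<lambda>j. snd (q j) i) (\<lambda>j. w j z)) =
          slide 1 (f z i) (target (f z i) (upper J y (\<lambda>j. w j z) i))"
        by (rule realize_is_slide[OF c yc W[OF z] track[OF z] q[OF z] i])
      then show "S i (1, z) = place (v i) (mass J (\<lambda>j. snd (q j) i) (\<lambda>j. w j z))"
        by (simp add: S_def U_def)
    qed
  qed
  have HB: "H (t, z) = (\<lambda>i\<in>{..<n}. slide t (x0 i) (target (x0 i) (of_bool (side (x0 i)))))" if z: "z \<in> B" for t z
  proof -
    have zZ: "z \<in> topspace Z" using z B(1) by blast
    have "U i z = of_bool (side (x0 i))" for i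
      unfolding U_def by (rule upper_cases(3)[OF W[OF zZ]]) (simp add: B(3)[OF z])
    then show ?thesis by (simp add: H_def S_def B(2)[OF z])
  qed
  show ?thesis
  proof (subst homotopic_with)
    show "(\<exists>c. \<forall>z\<in>B. h z = c) = (\<exists>c. \<forall>z\<in>B. k z = c)" if "\<And>x. x \<in> topspace Z \<Longrightarrow> h x = k x" for h k :: "'b \<Rightarrow> nat \<Rightarrow> 'a"
    proof -
      have "\<forall>z\<in>B. h z = k z" using that B(1) by blast
      then show ?thesis by simp
    qed
    show "\<exists>h. continuous_map ?X (sink_conf n G V) h \<and> (\<forall>x\<in>topspace Z. h (0, x) = f x) \<and>
        (\<forall>x\<in>topspace Z. h (1, x) = realize n v J q (\<lambda>j. w j x)) \<and>
        (\<forall>t\<in>{0..1}. \<exists>c. \<forall>z\<in>B. h (t, z) = c)"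
    proof (intro exI[of _ H] conjI ballI)
      show "continuous_map ?X (sink_conf n G V) H" using contH by (simp add: H_def[abs_def])
      show "\<exists>c. \<forall>z\<in>B. H (t, z) = c" for t using HB by blast
    qed (use H0 H1 in auto)
  qed
qed

end

section \<open>Maps of cubes and the homotopy groups\<close>

lemma compact_cube: "compact_space (cube k)"
  unfolding cube_def by (simp add: compact_space_product_topology compact_space_subtopology)

lemma continuous_cube_component: "i < k \<Longrightarrow> continuous_map (cube k) euclideanreal (\<lambda>s. s i)"
proof -
  assume "i < k"
  then have "continuous_map (cube k) (top_of_set {0..1}) (\<lambda>s. s i)"
    unfolding cube_def by (intro continuous_map_product_projection) simp
  then show ?thesis by (simp add: continuous_map_in_subtopology)
qed

lemma openin_near: "openin (cube k) {s' \<in> topspace (cube k). near k d s s'}"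
proof -
  have slab: "openin (cube k) {s' \<in> topspace (cube k). s' i \<in> ball (s i) d}" if "i < k" for i
    by (rule openin_continuous_map_preimage[OF continuous_cube_component[OF that]]) simp
  have "{s' \<in> topspace (cube k). near k d s s'} =
      topspace (cube k) \<inter> (\<Inter>i\<in>{..<k}. {s' \<in> topspace (cube k). s' i \<in> ball (s i) d})"
    by (auto simp: near_def dist_real_def)
  also have "openin (cube k) \<dots>"
  proof (cases "k = 0")
    case False
    show ?thesis
    proof (rule openin_Int_Inter)
      fix U assume "U \<in> (\<lambda>i. {s' \<in> topspace (cube k). s' i \<in> ball (s i) d}) ` {..<k}"
      then obtain i where "i < k" "U = {s' \<in> topspace (cube k). s' i \<in> ball (s i) d}" by blast
      with slab[of i] show "openin (cube k) U" by simp
    qed (use False in auto)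
  qed simp
  finally show ?thesis .
qed

lemma near_in_open:
  assumes U: "openin (cube k) U" and s: "s \<in> U"
  obtains d where "0 < d" "\<And>s'. s' \<in> topspace (cube k) \<Longrightarrow> near k d s s' \<Longrightarrow> s' \<in> U"
proof -
  obtain T where T: "\<And>i. i < k \<Longrightarrow> openin (top_of_set {0..1::real}) (T i)"
    and sT: "s \<in> PiE {..<k} T" and TU: "PiE {..<k} T \<subseteq> U"
    using U s unfolding cube_def openin_product_topology_alt by (metis lessThan_iff)
  have "\<exists>r>0. \<forall>y\<in>{0..1}. dist y (s i) < r \<longrightarrow> y \<in> T i" if "i < k" for i
    using T[OF that] sT that unfolding openin_euclidean_subtopology_iff by (auto simp: PiE_iff)
  then obtain r where r: "\<And>i. i < k \<Longrightarrow> 0 < r i" "\<And>i y. i < k \<Longrightarrow> y \<in> {0..1} \<Longrightarrow> dist y (s i) < r i \<Longrightarrow> y \<in> T i"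
    by metis
  define d where "d = Min (insert 1 (r ` {..<k}))"
  have "0 < d" unfolding d_def using r(1) by (subst Min_gr_iff) auto
  moreover have "s' \<in> U" if s': "s' \<in> topspace (cube k)" "near k d s s'" for s'
  proof -
    have "s' i \<in> T i" if i: "i < k" for i
    proof (rule r(2)[OF i])
      show "s' i \<in> {0..1}" using s'(1) i by (auto simp: cube_mem)
      have "d \<le> r i" unfolding d_def using i by (intro Min_le) auto
      then show "dist (s' i) (s i) < r i" using s'(2) i by (force simp: near_def dist_real_def)
    qed
    then have "s' \<in> PiE {..<k} T" using s'(1) by (simp add: cube_mem PiE_iff)
    then show ?thesis using TU by blast
  qed
  ultimately show ?thesis using that by blast
qed

lemma finite_net:
  assumes "\<And>s. s \<in> topspace (cube k) \<Longrightarrow> 0 < r s"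
  obtains F where "finite F" "F \<subseteq> topspace (cube k)" "\<And>s. s \<in> topspace (cube k) \<Longrightarrow> \<exists>a\<in>F. near k (r a) a s"
proof -
  let ?N = "\<lambda>a. {s \<in> topspace (cube k). near k (r a) a s}"
  have "\<exists>\<F>. finite \<F> \<and> \<F> \<subseteq> ?N ` topspace (cube k) \<and> topspace (cube k) \<subseteq> \<Union>\<F>"
  proof (rule compact_space_alt[THEN iffD1, OF compact_cube, rule_format])
    show "(\<forall>U\<in>?N ` topspace (cube k). openin (cube k) U) \<and> topspace (cube k) \<subseteq> \<Union> (?N ` topspace (cube k))"
    proof
      show "\<forall>U\<in>?N ` topspace (cube k). openin (cube k) U" using openin_near by blast
      show "topspace (cube k) \<subseteq> \<Union> (?N ` topspace (cube k))"
      proof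
        fix s assume s: "s \<in> topspace (cube k)"
        then have "s \<in> ?N s" using near_refl[OF assms[OF s]] by simp
        with s show "s \<in> \<Union> (?N ` topspace (cube k))" by blast
      qed
    qed
  qed
  then obtain \<F> where \<F>: "finite \<F>" "\<F> \<subseteq> ?N ` topspace (cube k)" "topspace (cube k) \<subseteq> \<Union>\<F>" by blast
  obtain F where F: "finite F" "F \<subseteq> topspace (cube k)" "\<F> = ?N ` F"
    using finite_subset_image[OF \<F>(1,2)] by blast
  show ?thesis
  proof (rule that[OF F(1,2)])
    fix s assume "s \<in> topspace (cube k)"
    then have "s \<in> \<Union>(?N ` F)" using \<F>(3) F(3) by blast
    then show "\<exists>a\<in>F. near k (r a) a s" by blast
  qed
qed

lemma Lebesgue_number_cube:
  assumes "\<And>s. s \<in> topspace (cube k) \<Longrightarrow> \<exists>U. openin (cube k) U \<and> s \<in> U \<and> P U"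
  obtains d where "0 < d"
    "\<And>s. s \<in> topspace (cube k) \<Longrightarrow> \<exists>U. P U \<and> (\<forall>s'\<in>topspace (cube k). near k d s s' \<longrightarrow> s' \<in> U)"
proof -
  have "\<exists>U r. 0 < r \<and> P U \<and> (\<forall>s'\<in>topspace (cube k). near k (r + r) s s' \<longrightarrow> s' \<in> U)"
    if s: "s \<in> topspace (cube k)" for s
  proof -
    obtain U where U: "openin (cube k) U" "s \<in> U" "P U" using assms[OF s] by blast
    obtain d where d: "0 < d" "\<And>s'. s' \<in> topspace (cube k) \<Longrightarrow> near k d s s' \<Longrightarrow> s' \<in> U"
      using near_in_open[OF U(1,2)] by blast
    have "0 < d/2" "d/2 + d/2 = d" using d(1) by simp_all
    then show ?thesis using U(3) d(2) by metis
  qed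
  then obtain U r where Ur: "\<And>s. s \<in> topspace (cube k) \<Longrightarrow> 0 < r s" "\<And>s. s \<in> topspace (cube k) \<Longrightarrow> P (U s)"
    "\<And>s s'. s \<in> topspace (cube k) \<Longrightarrow> s' \<in> topspace (cube k) \<Longrightarrow> near k (r s + r s) s s' \<Longrightarrow> s' \<in> U s"
    by metis
  obtain F where F: "finite F" "F \<subseteq> topspace (cube k)" "\<And>s. s \<in> topspace (cube k) \<Longrightarrow> \<exists>a\<in>F. near k (r a) a s"
    using finite_net[of k r] Ur(1) by blast
  define d where "d = Min (insert 1 (r ` F))"
  show ?thesis
  proof (rule that[of d])
    show "0 < d" unfolding d_def using F(1,2) Ur(1) by (subst Min_gr_iff) auto
    fix s assume s: "s \<in> topspace (cube k)"
    obtain a where a: "a \<in> F" "near k (r a) a s" using F(3)[OF s] by blast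
    have aK: "a \<in> topspace (cube k)" using a F(2) by blast
    have da: "d \<le> r a" unfolding d_def using a(1) F(1) by (intro Min_le) auto
    have "s' \<in> U a" if "s' \<in> topspace (cube k)" "near k d s s'" for s'
    proof (rule Ur(3)[OF aK that(1)])
      have "near k (r a + d) a s'" by (rule near_trans[OF a(2) that(2)])
      then show "near k (r a + r a) a s'" by (rule near_mono) (use da in simp)
    qed
    then show "\<exists>U. P U \<and> (\<forall>s'\<in>topspace (cube k). near k d s s' \<longrightarrow> s' \<in> U)" using Ur(2)[OF aK] by blast
  qed
qed

text \<open>
  Products of tent functions are positive exactly on the boxes of radius \<open>d\<close>; they are normalized.
\<close>

lemma partition_of_unity_cube:
  assumes d: "0 < d"
  obtains J w where "J \<subseteq> topspace (cube k)"
    "\<And>s. s \<in> topspace (cube k) \<Longrightarrow> weights J (\<lambda>a. w a s)" "finite J"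
    "\<And>a. a \<in> J \<Longrightarrow> continuous_map (cube k) euclideanreal (w a)"
    "\<And>a s. a \<in> J \<Longrightarrow> s \<in> topspace (cube k) \<Longrightarrow> 0 < w a s \<Longrightarrow> near k d s a"
proof -
  obtain J where J: "finite J" "J \<subseteq> topspace (cube k)" "\<And>s. s \<in> topspace (cube k) \<Longrightarrow> \<exists>a\<in>J. near k d a s"
    using finite_net[of k "\<lambda>_. d"] d by blast
  define hat where "hat a s = (\<Prod>i<k. max 0 (d - \<bar>s i - a i\<bar>))" for a s :: "nat \<Rightarrow> real"
  have nonneg: "0 \<le> hat a s" for a s unfolding hat_def by (intro prod_nonneg) simp
  have pos: "0 < hat a s \<longleftrightarrow> near k d s a" for a s
  proof
    assume "0 < hat a s"
    show "near k d s a"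
    proof (rule ccontr)
      assume "\<not> near k d s a"
      then obtain i where "i < k" "d \<le> \<bar>s i - a i\<bar>" unfolding near_def by force
      then have "hat a s = 0" unfolding hat_def by (intro prod_zero) (auto intro!: bexI[of _ i])
      with \<open>0 < hat a s\<close> show False by simp
    qed
  next
    assume "near k d s a"
    then show "0 < hat a s" unfolding hat_def by (intro prod_pos) (simp add: near_def)
  qed
  have cont: "continuous_map (cube k) euclideanreal (hat a)" for a
    unfolding hat_def
    by (intro continuous_map_prod continuous_map_real_max continuous_map_diff continuous_map_real_abs
        continuous_cube_component) auto
  have total: "0 < (\<Sum>b\<in>J. hat b s)" if s: "s \<in> topspace (cube k)" for s
  proof -
    obtain a where a: "a \<in> J" "near k d a s" using J(3) s by blast
    then have "0 < hat a s" using pos near_sym by blast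
    also have "hat a s \<le> (\<Sum>b\<in>J. hat b s)" by (rule member_le_sum[OF a(1)]) (use nonneg J in auto)
    finally show ?thesis .
  qed
  define w where "w a s = hat a s / (\<Sum>b\<in>J. hat b s)" for a s
  show ?thesis
  proof (rule that[of J w])
    show "weights J (\<lambda>a. w a s)" if "s \<in> topspace (cube k)" for s
      using total[OF that] nonneg J(1)
      by (auto simp: weights_def w_def sum_divide_distrib[symmetric] intro!: divide_nonneg_pos)
    show "continuous_map (cube k) euclideanreal (w a)" if "a \<in> J" for a
      unfolding w_def
      by (intro continuous_map_real_divide continuous_map_sum cont) (use J total in force)+
    show "near k d s a" if "a \<in> J" "s \<in> topspace (cube k)" "0 < w a s" for a s
      using that(3) total[OF that(2)] pos[of a s] by (simp add: w_def zero_less_divide_iff)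
  qed (use J in auto)
qed

text \<open>
  Expansion about the centre by the factor \<open>1 + u\<close>, cut off at the faces. At \<open>u = 1\<close> a collar of width
  \<open>1/4\<close> is pressed into the boundary.
\<close>

definition widen :: "nat \<Rightarrow> real \<Rightarrow> (nat \<Rightarrow> real) \<Rightarrow> nat \<Rightarrow> real" where
  "widen k u s = (\<lambda>i\<in>{..<k}. max 0 (min 1 (1/2 + (s i - 1/2) * (1 + u))))"

lemma widen_in: "widen k u s \<in> topspace (cube k)"
  by (auto simp: cube_mem widen_def)

lemma widen_zero: "s \<in> topspace (cube k) \<Longrightarrow> widen k 0 s = s"
  by (rule extensionalityI[of _ "{..<k}"]) (auto simp: cube_mem widen_def)

lemma widen_boundary:
  assumes "s \<in> cube_boundary k" "0 \<le> u" shows "widen k u s \<in> cube_boundary k"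
proof -
  obtain i where i: "i < k" "s i = 0 \<or> s i = 1" using assms(1) by (auto simp: cube_boundary_def)
  have w: "widen k u s i = max 0 (min 1 (1/2 + (s i - 1/2) * (1 + u)))" using i by (simp add: widen_def)
  from i(2) have "widen k u s i = 0 \<or> widen k u s i = 1"
  proof
    assume s: "s i = 0"
    have "1/2 + (s i - 1/2) * (1 + u) \<le> 0" unfolding s using assms(2) by (simp add: field_simps)
    then show ?thesis unfolding w by linarith
  next
    assume s: "s i = 1"
    have "1 \<le> 1/2 + (s i - 1/2) * (1 + u)" unfolding s using assms(2) by (simp add: field_simps)
    then show ?thesis unfolding w by linarith
  qed
  then show ?thesis using i(1) widen_in by (auto simp: cube_boundary_def)
qed

lemma widen_one_boundary:
  assumes "i < k" "s i \<le> 1/4 \<or> 3/4 \<le> s i" shows "widen k 1 s \<in> cube_boundary k"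
proof -
  have "widen k 1 s i = 0 \<or> widen k 1 s i = 1" using assms by (auto simp: widen_def)
  then show ?thesis using assms(1) widen_in by (auto simp: cube_boundary_def)
qed

lemma continuous_widen:
  "continuous_map (prod_topology (top_of_set {0..1}) (cube k)) (cube k) (\<lambda>y. widen k (fst y) (snd y))"
proof -
  let ?X = "prod_topology (top_of_set {0..1::real}) (cube k)"
  have f: "continuous_map ?X euclideanreal fst"
    using continuous_map_fst[of "top_of_set {0..1::real}" "cube k"] by (simp add: continuous_map_in_subtopology)
  have "continuous_map ?X (top_of_set {0..1}) (\<lambda>y. widen k (fst y) (snd y) i)" if i: "i < k" for i
  proof -
    have c: "continuous_map ?X euclideanreal (\<lambda>y. snd y i)"
      using continuous_map_compose[OF continuous_map_snd continuous_cube_component[OF i]] by (simp add: o_def)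
    have "continuous_map ?X euclideanreal (\<lambda>y. max 0 (min 1 (1/2 + (snd y i - 1/2) * (1 + fst y))))"
      by (intro continuous_map_real_max continuous_map_real_min continuous_map_add continuous_map_real_mult
          continuous_map_diff f c) auto
    then show ?thesis using i by (simp add: continuous_map_in_subtopology widen_def)
  qed
  then have "continuous_map ?X (product_topology (\<lambda>_. top_of_set {0..1}) {..<k}) (\<lambda>y. widen k (fst y) (snd y))"
    unfolding continuous_map_componentwise by (auto simp: widen_def)
  then show ?thesis by (simp add: cube_def)
qed

lemma homotopic_widen:
  assumes f: "f \<in> cube_maps k X x0"
  shows "homotopic_with (\<lambda>h. \<forall>t\<in>cube_boundary k. h t = x0) (cube k) X f (\<lambda>s. f (widen k 1 s))"
proof (subst homotopic_with)
  show "(\<forall>t\<in>cube_boundary k. h t = x0) = (\<forall>t\<in>cube_boundary k. h' t = x0)"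
    if "\<And>x. x \<in> topspace (cube k) \<Longrightarrow> h x = h' x" for h h'
    using that by (auto simp: cube_boundary_def)
  show "\<exists>h. continuous_map (prod_topology (top_of_set {0..1::real}) (cube k)) X h \<and>
      (\<forall>x\<in>topspace (cube k). h (0, x) = f x) \<and> (\<forall>x\<in>topspace (cube k). h (1, x) = f (widen k 1 x)) \<and>
      (\<forall>t\<in>{0..1}. \<forall>s\<in>cube_boundary k. h (t, s) = x0)"
  proof (intro exI[of _ "\<lambda>y. f (widen k (fst y) (snd y))"] conjI ballI)
    have "continuous_map (cube k) X f" using f by (simp add: cube_maps_def)
    from continuous_map_compose[OF continuous_widen this]
    show "continuous_map (prod_topology (top_of_set {0..1}) (cube k)) X (\<lambda>y. f (widen k (fst y) (snd y)))"
      by (simp add: o_def)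
    show "f (widen k (fst (t, s)) (snd (t, s))) = x0" if "t \<in> {0..1}" "s \<in> cube_boundary k" for t s
      using f widen_boundary[OF that(2), of t] that(1) by (simp add: cube_maps_def)
  qed (simp_all add: widen_zero)
qed

text \<open>
  Let \<open>H\<close> be the given homotopy and \<open>\<gamma>\<close> the path that it traces on the boundary. While the cube is
  widened, the time of \<open>H\<close> is kept at 0 on the boundary and grows towards the centre. In the end only
  the collar is left, mapped along \<open>\<gamma>\<close>, and this can be pulled back along \<open>\<gamma>\<close>.
\<close>

lemma null_homotopic_rel_boundary:
  assumes k: "1 \<le> k" and f: "f \<in> cube_maps k X x0"
    and hom: "homotopic_with (\<lambda>h. \<exists>c. \<forall>t\<in>cube_boundary k. h t = c) (cube k) X f (\<lambda>_. y)"
  shows "homotopic_with (\<lambda>h. \<forall>t\<in>cube_boundary k. h t = x0) (cube k) X f (\<lambda>_. x0)"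
proof -
  let ?I = "top_of_set {0..1::real}" and ?P = "\<lambda>h. \<forall>t\<in>cube_boundary k. h t = x0"
  let ?Y = "prod_topology ?I (cube k)"
  obtain H where H: "continuous_map ?Y X H" "\<And>s. H (0, s) = f s" "\<And>s. H (1, s) = y"
    "\<And>t. t \<in> {0..1} \<Longrightarrow> \<exists>c. \<forall>s\<in>cube_boundary k. H (t, s) = c"
    using hom unfolding homotopic_with_def by blast
  define o0 where "o0 = (\<lambda>i\<in>{..<k}. 0::real)"
  have o0: "o0 \<in> cube_boundary k" using k by (auto simp: o0_def cube_boundary_def cube_mem intro!: exI[of _ 0])
  then have o0K: "o0 \<in> topspace (cube k)" by (simp add: cube_boundary_def)
  define \<gamma> where "\<gamma> t = H (t, o0)" for t
  have HB: "H (t, s) = \<gamma> t" if "t \<in> {0..1}" "s \<in> cube_boundary k" for t s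
    using H(4)[OF that(1)] that(2) o0 unfolding \<gamma>_def by metis
  have \<gamma>0: "\<gamma> 0 = x0" using f o0 by (simp add: \<gamma>_def H(2) cube_maps_def)
  have \<gamma>1: "\<gamma> 1 = y" by (simp add: \<gamma>_def H(3))
  have \<gamma>: "continuous_map ?I X \<gamma>"
  proof -
    have "continuous_map ?I ?Y (\<lambda>t. (t, o0))" using o0K by (intro continuous_map_pairedI) auto
    from continuous_map_compose[OF this H(1)] show ?thesis by (simp add: o_def \<gamma>_def[abs_def])
  qed
  define bump where "bump s = (\<Prod>i<k. max 0 (min 1 (4 * min (s i) (1 - s i))))" for s :: "nat \<Rightarrow> real"
  have bump01: "0 \<le> bump s" "bump s \<le> 1" for s
    unfolding bump_def by (intro prod_nonneg; simp) (intro prod_le_1; simp)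
  have bumpB: "bump s = 0" if s: "s \<in> cube_boundary k" for s
  proof -
    obtain i where i: "i < k" "s i = 0 \<or> s i = 1" using s by (auto simp: cube_boundary_def)
    then have "max 0 (min 1 (4 * min (s i) (1 - s i))) = 0" by auto
    then show ?thesis unfolding bump_def using i(1) by (intro prod_zero bexI[of _ i]) auto
  qed
  have bump1: "bump s = 1 \<or> widen k 1 s \<in> cube_boundary k" for s
  proof (cases "\<exists>i<k. s i \<le> 1/4 \<or> 3/4 \<le> s i")
    case True
    then show ?thesis using widen_one_boundary by blast
  next
    case False
    then have "bump s = 1" unfolding bump_def by (intro prod.neutral) (auto simp: not_le min_def max_def)
    then show ?thesis ..
  qed
  have bumpc: "continuous_map (cube k) euclideanreal bump"
    unfolding bump_def
    by (intro continuous_map_prod continuous_map_real_max continuous_map_real_min continuous_map_real_mult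
        continuous_map_diff continuous_cube_component) auto
  have fstc: "continuous_map ?Y euclideanreal fst"
    using continuous_map_fst[of ?I "cube k"] by (simp add: continuous_map_in_subtopology)
  have bumpc2: "continuous_map ?Y euclideanreal (\<lambda>y. bump (snd y))"
    using continuous_map_compose[OF continuous_map_snd bumpc] by (simp add: o_def)
  have Pcong: "?P h = ?P h'" if "\<And>x. x \<in> topspace (cube k) \<Longrightarrow> h x = h' x" for h h'
    using that by (auto simp: cube_boundary_def)
  have 1: "homotopic_with ?P (cube k) X f (\<lambda>s. \<gamma> (bump s))"
  proof (subst homotopic_with[OF Pcong])
    \<comment> \<open>at \<open>u = 1\<close>, points whose time \<open>bump s\<close> is less than 1 have been widened into the boundary\<close>
    define F where "F y = H (min (fst y) (bump (snd y)), widen k (fst y) (snd y))" for y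
    have "continuous_map ?Y ?I (\<lambda>y. min (fst y) (bump (snd y)))"
      using continuous_map_real_min[OF fstc bumpc2] bump01 by (auto simp: continuous_map_in_subtopology min_le_iff_disj)
    then have "continuous_map ?Y ?Y (\<lambda>y. (min (fst y) (bump (snd y)), widen k (fst y) (snd y)))"
      by (intro continuous_map_pairedI continuous_widen)
    from continuous_map_compose[OF this H(1)] have "continuous_map ?Y X F" by (simp add: o_def F_def[abs_def])
    moreover have "F (0, s) = f s" if "s \<in> topspace (cube k)" for s
      using that bump01[of s] by (simp add: F_def H(2) widen_zero)
    moreover have "F (1, s) = \<gamma> (bump s)" for s
      using bump1[of s] HB[of "bump s"] bump01[of s] by (auto simp: F_def H(3) \<gamma>1)
    moreover have "F (t, s) = x0" if "t \<in> {0..1}" "s \<in> cube_boundary k" for t s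
      using that HB[of 0 "widen k t s"] widen_boundary[OF that(2), of t] by (simp add: F_def bumpB \<gamma>0)
    ultimately show "\<exists>h. continuous_map ?Y X h \<and> (\<forall>x\<in>topspace (cube k). h (0, x) = f x) \<and>
      (\<forall>x\<in>topspace (cube k). h (1, x) = \<gamma> (bump x)) \<and> (\<forall>t\<in>{0..1}. \<forall>s\<in>cube_boundary k. h (t, s) = x0)"
      by (intro exI[of _ F]) auto
  qed
  have 2: "homotopic_with ?P (cube k) X (\<lambda>s. \<gamma> (bump s)) (\<lambda>_. x0)"
  proof (subst homotopic_with[OF Pcong])
    define F where "F y = \<gamma> ((1 - fst y) * bump (snd y))" for y
    have "continuous_map ?Y euclideanreal (\<lambda>y. (1 - fst y) * bump (snd y))"
      by (intro continuous_map_real_mult continuous_map_diff fstc bumpc2) auto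
    then have "continuous_map ?Y ?I (\<lambda>y. (1 - fst y) * bump (snd y))"
      using bump01 by (auto simp: continuous_map_in_subtopology mult_le_one)
    from continuous_map_compose[OF this \<gamma>] have "continuous_map ?Y X F" by (simp add: o_def F_def[abs_def])
    moreover have "F (0, s) = \<gamma> (bump s)" "F (1, s) = x0" for s by (simp_all add: F_def \<gamma>0)
    moreover have "F (t, s) = x0" if "s \<in> cube_boundary k" for t s using that by (simp add: F_def bumpB \<gamma>0)
    ultimately show "\<exists>h. continuous_map ?Y X h \<and> (\<forall>x\<in>topspace (cube k). h (0, x) = \<gamma> (bump x)) \<and>
      (\<forall>x\<in>topspace (cube k). h (1, x) = x0) \<and> (\<forall>t\<in>{0..1}. \<forall>s\<in>cube_boundary k. h (t, s) = x0)"
      by (intro exI[of _ F]) auto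
  qed
  from 1 2 show ?thesis by (rule homotopic_with_trans)
qed

text \<open>
  If all maps are homotopic to the constant one, the set of all maps is the only class, and the product of
  this class with itself is again this class.
\<close>

lemma trivial_homotopy_group:
  assumes x0: "x0 \<in> topspace X"
    and null: "\<And>f. f \<in> cube_maps k X x0 \<Longrightarrow>
      homotopic_with (\<lambda>h. \<forall>t\<in>cube_boundary k. h t = x0) (cube k) X f (\<lambda>_. x0)"
  shows "trivial_group (homotopy_group k X x0)"
proof -
  let ?C = "cube_maps k X x0" and ?R = "cube_homotopy_rel k X x0"
  have const: "(\<lambda>_. x0) \<in> ?C" using x0 by (simp add: cube_maps_def)
  have all: "(f, g) \<in> ?R" if "f \<in> ?C" "g \<in> ?C" for f g
    using that homotopic_with_trans[OF null homotopic_with_symD[OF null]]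
    by (auto simp: cube_homotopy_rel_def)
  have sub: "?R \<subseteq> ?C \<times> ?C" by (auto simp: cube_homotopy_rel_def)
  have cls: "?R `` {f} = ?C" if "f \<in> ?C" for f using all[OF that] sub by blast
  have carrier: "?C // ?R = {?C}" unfolding quotient_def using cls const by auto
  have mult: "?R `` {cube_concat f g | f g. f \<in> ?C \<and> g \<in> ?C} = ?C"
  proof
    show "?R `` {cube_concat f g | f g. f \<in> ?C \<and> g \<in> ?C} \<subseteq> ?C" using sub by blast
    have "cube_concat (\<lambda>_. x0) (\<lambda>_. x0) = (\<lambda>_. x0)" by (auto simp: cube_concat_def)
    then have "(\<lambda>_. x0) \<in> {cube_concat f g | f g. f \<in> ?C \<and> g \<in> ?C}" using const by (metis (mono_tags, lifting) mem_Collect_eq)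
    then show "?C \<subseteq> ?R `` {cube_concat f g | f g. f \<in> ?C \<and> g \<in> ?C}" using all[OF const] by blast
  qed
  have "group (homotopy_group k X x0)"
    by (rule groupI) (auto simp: homotopy_group_def carrier mult cls[OF const])
  then show ?thesis
    by (simp add: trivial_group_def homotopy_group_def carrier cls[OF const])
qed

context cw_graph
begin

lemma null_homotopic_sink_conf:
  assumes k: "2 \<le> k" and f: "f \<in> cube_maps k (sink_conf n G V) x0"
  shows "homotopic_with (\<lambda>h. \<forall>t\<in>cube_boundary k. h t = x0) (cube k) (sink_conf n G V) f (\<lambda>_. x0)"
proof -
  let ?X = "sink_conf n G V" and ?K = "topspace (cube k)" and ?B = "cube_boundary k"
  let ?Q = "\<lambda>h. \<exists>c. \<forall>t\<in>?B. h t = c"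
  define f1 where "f1 s = f (widen k 1 s)" for s
  have hom1: "homotopic_with (\<lambda>h. \<forall>t\<in>?B. h t = x0) (cube k) ?X f f1"
    unfolding f1_def[abs_def] by (rule homotopic_widen[OF f])
  have f1c: "continuous_map (cube k) ?X f1" using hom1 homotopic_with_imp_continuous_maps by blast
  have f1B: "f1 s = x0" if "i < k" "s i \<le> 1/4 \<or> 3/4 \<le> s i" for s i
    using f widen_one_boundary[of i k s, OF that] by (simp add: f1_def cube_maps_def)
  have BK: "?B \<subseteq> ?K" by (auto simp: cube_boundary_def)
  have f1B': "f1 s = x0" if "s \<in> ?B" for s
    using that f1B by (force simp: cube_boundary_def)
  have cover: "\<exists>U. openin (cube k) U \<and> s \<in> U \<and> (\<exists>W. good_chart n W \<and> (\<forall>s'\<in>U. f1 s' \<in> W))" if s: "s \<in> ?K" for s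
  proof -
    have "f1 s \<in> topspace ?X" using continuous_map_image_subset_topspace[OF f1c] s by blast
    then obtain W where W: "good_chart n W" "openin ?X W" "f1 s \<in> W" by (rule exists_chart)
    have "openin (cube k) {s' \<in> ?K. f1 s' \<in> W}" by (rule openin_continuous_map_preimage[OF f1c W(2)])
    then show ?thesis using W s by (intro exI[of _ "{s' \<in> ?K. f1 s' \<in> W}"]) auto
  qed
  obtain d0 where d0: "0 < d0"
    "\<And>s. s \<in> ?K \<Longrightarrow> \<exists>U. (\<exists>W. good_chart n W \<and> (\<forall>s'\<in>U. f1 s' \<in> W)) \<and> (\<forall>s'\<in>?K. near k d0 s s' \<longrightarrow> s' \<in> U)"
    using Lebesgue_number_cube[where P = "\<lambda>U. \<exists>W. good_chart n W \<and> (\<forall>s'\<in>U. f1 s' \<in> W)", OF cover] by blast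
  \<comment> \<open>the bound \<open>1/4\<close> keeps all centres that matter on the boundary inside the collar\<close>
  define d where "d = min d0 (1/4)"
  have d: "0 < d" "d \<le> 1/4" "0 < d/2" using d0(1) by (auto simp: d_def)
  have chart: "\<exists>W. good_chart n W \<and> (\<forall>s'\<in>?K. near k d s s' \<longrightarrow> f1 s' \<in> W)" if s: "s \<in> ?K" for s
  proof -
    obtain U W where UW: "good_chart n W" "\<forall>s'\<in>U. f1 s' \<in> W" "\<forall>s'\<in>?K. near k d0 s s' \<longrightarrow> s' \<in> U"
      using d0(2)[OF s] by blast
    have "near k d0 s s'" if "near k d s s'" for s' by (rule near_mono[OF that]) (simp add: d_def)
    then show ?thesis using UW by blast
  qed
  let ?o = "shrink k 0 (\<lambda>_. 0)"
  define v where "v i = rounding (f1 ?o i)" for i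
  obtain g where g: "\<And>s. s \<in> ?K \<Longrightarrow> tracks n v (f1 s) (g s)"
    "\<And>s s'. s \<in> ?K \<Longrightarrow> s' \<in> ?K \<Longrightarrow> near k (d/2) s s' \<Longrightarrow> g s' = carry n (f1 s) (f1 s') (g s)"
    "g ?o = empty_heap"
    using exists_lift[OF d(1) chart] unfolding v_def by blast
  have gB: "g s = empty_heap" if s: "s \<in> ?B" for s
  proof -
    have "g s = g ?o"
    proof (rule lift_on_boundary[OF k d(3)])
      show "g t' = carry n (f1 t) (f1 t') (g t)" if "t \<in> ?K" "t' \<in> ?K" "near k (d/2) t t'" for t t'
        by (rule g(2)[OF that])
      show "f1 t = x0" if "t \<in> ?B" for t by (rule f1B'[OF that])
    qed (rule s)
    then show ?thesis using g(3) by simp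
  qed
  obtain J w where J: "J \<subseteq> ?K" "finite J" and W: "\<And>s. s \<in> ?K \<Longrightarrow> weights J (\<lambda>a. w a s)"
    and wc: "\<And>a. a \<in> J \<Longrightarrow> continuous_map (cube k) euclideanreal (w a)"
    and wn: "\<And>a s. a \<in> J \<Longrightarrow> s \<in> ?K \<Longrightarrow> 0 < w a s \<Longrightarrow> near k (d/2) s a"
    using partition_of_unity_cube[OF d(3), of k] by metis
  have wB: "f1 a = x0" if s: "s \<in> ?B" and a: "a \<in> J" "0 < w a s" for a s
  proof -
    obtain i where i: "i < k" "s i = 0 \<or> s i = 1" using s by (auto simp: cube_boundary_def)
    have "near k (d/2) s a" using wn[OF a(1) _ a(2)] s BK by blast
    then have "\<bar>s i - a i\<bar> < d/2" using i(1) by (simp add: near_def)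
    then have "a i \<le> 1/4 \<or> 3/4 \<le> a i" using i(2) d(2) by auto
    then show ?thesis using f1B i(1) by blast
  qed
  have lab: "g a = carry n (f1 s) (f1 a) (g s)" if "s \<in> ?K" "a \<in> J" "0 < w a s" for s a
    using g(2)[OF that(1) _ wn[OF that(2,1,3)]] J(1) that(2) by blast
  have chart': "\<exists>W. good_chart n W \<and> f1 s \<in> W \<and> (\<forall>a\<in>J. 0 < w a s \<longrightarrow> f1 a \<in> W)" if s: "s \<in> ?K" for s
  proof -
    obtain W where W: "good_chart n W" "\<forall>s'\<in>?K. near k d s s' \<longrightarrow> f1 s' \<in> W" using chart[OF s] by blast
    have "f1 a \<in> W" if "a \<in> J" "0 < w a s" for a
      using W(2) J(1) that near_mono[OF wn[OF that(1) s that(2)], of d] d(1) by auto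
    moreover have "f1 s \<in> W" using W(2) s near_refl[OF d(1)] by blast
    ultimately show ?thesis using W(1) by blast
  qed
  have hom2: "homotopic_with ?Q (cube k) ?X f1 (\<lambda>s. realize n v J g (\<lambda>a. w a s))"
    by (rule homotopic_to_realization[OF f1c W wc chart' g(1) lab BK f1B' wB])
  have hom3: "homotopic_with (\<lambda>h. \<forall>s\<in>?B. h s = (\<lambda>i\<in>{..<n}. v i)) (cube k) ?X
      (\<lambda>s. realize n v J g (\<lambda>a. w a s)) (\<lambda>_. \<lambda>i\<in>{..<n}. v i)"
  proof (rule contract_labels[OF W J(2) wc BK])
    fix s assume s: "s \<in> ?K"
    obtain W where Wc: "good_chart n W" "f1 s \<in> W" "\<forall>a\<in>J. 0 < w a s \<longrightarrow> f1 a \<in> W" using chart'[OF s] by blast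
    have "reduced_heap (g s)" using g(1)[OF s] by (simp add: tracks_def)
    then have "cubical ((\<lambda>x'. carry n (f1 s) x' (g s)) ` W)" by (rule cubical_carry[OF Wc(1,2)])
    moreover have "{g a | a. a \<in> J \<and> 0 < w a s} \<subseteq> (\<lambda>x'. carry n (f1 s) x' (g s)) ` W"
      using lab[OF s] Wc(3) by blast
    ultimately show "cubical {g a | a. a \<in> J \<and> 0 < w a s}" by (rule cubical_subset)
  next
    fix a assume "a \<in> J"
    then have t: "tracks n v (f1 a) (g a)" using g(1) J(1) by blast
    then show "reduced_heap (g a)" by (simp add: tracks_def)
    show "walk (v i) (snd (g a) i)" if "i < n" for i using t that by (simp add: tracks_def)
    show "snd (g a) i = []" if "n \<le> i" for i using t that by (simp add: tracks_def)
  next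
    fix s a i assume s: "s \<in> ?B" and a: "a \<in> J" "0 < w a s"
    have "g a = carry n (f1 s) (f1 a) (g s)" using lab[OF _ a] s BK by blast
    then have "g a = empty_heap" using wB[OF s a] f1B'[OF s] gB[OF s] by (simp add: carry_refl)
    then show "snd (g a) i = []" by (simp add: empty_heap_def)
  qed
  have "homotopic_with ?Q (cube k) ?X f f1"
    by (rule homotopic_with_mono[OF hom1]) blast
  moreover have "homotopic_with ?Q (cube k) ?X (\<lambda>s. realize n v J g (\<lambda>a. w a s)) (\<lambda>_. \<lambda>i\<in>{..<n}. v i)"
    by (rule homotopic_with_mono[OF hom3]) blast
  ultimately have "homotopic_with ?Q (cube k) ?X f (\<lambda>_. \<lambda>i\<in>{..<n}. v i)"
    using hom2 homotopic_with_trans by blast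
  then show ?thesis using k f by (intro null_homotopic_rel_boundary) auto
qed

lemma path_to_vertices:
  assumes x: "x \<in> topspace (sink_conf n G V)"
  shows "path_component_of (sink_conf n G V) x (\<lambda>i\<in>{..<n}. rounding (x i))"
  unfolding path_component_of_def pathin_def
proof (intro exI[of _ "\<lambda>t. \<lambda>i\<in>{..<n}. slide t (x i) (of_bool (side (x i)))"] conjI)
  show "continuous_map (top_of_set {0..1}) (sink_conf n G V) (\<lambda>t. \<lambda>i\<in>{..<n}. slide t (x i) (of_bool (side (x i))))"
  proof (rule continuous_into_sink_conf)
    fix i assume i: "i < n"
    note G = sink_conf_in[OF x i]
    show "continuous_map (top_of_set {0..1}) G (\<lambda>t. slide t (x i) (of_bool (side (x i))))"
    proof (cases "x i \<in> V")
      case True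
      then show ?thesis using G by (simp add: slide_def)
    next
      case False
      note c = coord_cases[OF G False]
      have "continuous_map (top_of_set {0..1}) (top_of_set {0..1}) (\<lambda>t. (1 - t) * coord (x i) + t * of_bool (side (x i)))"
        using c convex_01[of _ "coord (x i)" "of_bool (side (x i))"] by (auto intro!: continuous_intros)
      from continuous_map_compose[OF this edge_map_cont[OF c(1)]] show ?thesis
        using False by (simp add: slide_def o_def)
    qed
  next
    fix t :: real and i j
    assume t: "t \<in> topspace (top_of_set {0..1})" and ij: "i < n" "j < n" "i \<noteq> j"
      and eq: "slide t (x i) (of_bool (side (x i))) = slide t (x j) (of_bool (side (x j)))"
    show "slide t (x i) (of_bool (side (x i))) \<in> V"
    proof (rule slide_conf[OF x _ _ _ _ _ ij eq])
      show "of_bool (side (x i)) \<le> (of_bool (side (x j)) :: real)" if "coord (x i) < coord (x j)" for i j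
        using that by (auto simp: side_def)
    qed (use t in auto)
  qed
  show "(\<lambda>i\<in>{..<n}. slide 0 (x i) (of_bool (side (x i)))) = x"
  proof (rule extensionalityI[of _ "{..<n}"])
    show "x \<in> extensional {..<n}" using x by (simp add: sink_conf_iff PiE_iff)
  qed (use sink_conf_in[OF x] in \<open>auto simp: slide_zero\<close>)
  show "(\<lambda>i\<in>{..<n}. slide 1 (x i) (of_bool (side (x i)))) = (\<lambda>i\<in>{..<n}. rounding (x i))"
    by (intro restrict_ext) (simp add: slide_def rounding_def)
qed

lemma vertex_conf:
  assumes "\<And>i. i < n \<Longrightarrow> x i \<in> V"
  shows "(\<lambda>i\<in>{..<n}. x i) \<in> topspace (sink_conf n G V)"
  using assms vertex_in by (auto simp: sink_conf_iff)

text \<open>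
  Particles are moved one at a time; all others rest at vertices, where they may be met.
\<close>

lemma path_between_vertices:
  assumes x: "\<And>i. i < n \<Longrightarrow> x i \<in> V" and y: "\<And>i. i < n \<Longrightarrow> y i \<in> V"
  shows "path_component_of (sink_conf n G V) (\<lambda>i\<in>{..<n}. x i) (\<lambda>i\<in>{..<n}. y i)"
proof -
  define z where "z m = (\<lambda>i\<in>{..<n}. if i < m then y i else x i)" for m
  have "path_component_of (sink_conf n G V) (z 0) (z m)" if "m \<le> n" for m
    using that
  proof (induction m)
    case 0
    have "z 0 \<in> topspace (sink_conf n G V)"
      unfolding z_def by (rule vertex_conf) (simp add: x)
    then show ?case by (simp add: path_component_of_refl)
  next
    case (Suc m)
    then have m: "m < n" by simp
    have "path_component_of G (x m) (y m)"
      using path_connected_graph x[OF m] y[OF m] vertex_in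
      unfolding path_connected_space_iff_path_component by blast
    then obtain \<gamma> where \<gamma>: "continuous_map (top_of_set {0..1::real}) G \<gamma>" "\<gamma> 0 = x m" "\<gamma> 1 = y m"
      unfolding path_component_of_def pathin_def by blast
    have "path_component_of (sink_conf n G V) (z m) (z (Suc m))"
      unfolding path_component_of_def pathin_def
    proof (intro exI[of _ "\<lambda>t. \<lambda>i\<in>{..<n}. if i = m then \<gamma> t else z m i"] conjI)
      have zV: "z m i \<in> V" if "i < n" for i using that x y by (simp add: z_def)
      show "continuous_map (top_of_set {0..1}) (sink_conf n G V) (\<lambda>t. \<lambda>i\<in>{..<n}. if i = m then \<gamma> t else z m i)"
      proof (rule continuous_into_sink_conf)
        show "continuous_map (top_of_set {0..1}) G (\<lambda>t. if i = m then \<gamma> t else z m i)" if "i < n" for i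
          using \<gamma>(1) zV[OF that] vertex_in by (cases "i = m") auto
        show "(if i = m then \<gamma> t else z m i) \<in> V"
          if "i < n" "j < n" "i \<noteq> j" "(if i = m then \<gamma> t else z m i) = (if j = m then \<gamma> t else z m j)" for t i j
          using that zV[of i] zV[of j] by (auto split: if_split_asm)
      qed
      show "(\<lambda>i\<in>{..<n}. if i = m then \<gamma> 0 else z m i) = z m"
        by (auto simp: z_def \<gamma>(2) fun_eq_iff)
      show "(\<lambda>i\<in>{..<n}. if i = m then \<gamma> 1 else z m i) = z (Suc m)"
        using m by (auto simp: z_def \<gamma>(3) fun_eq_iff less_Suc_eq)
    qed
    with Suc show ?case using path_component_of_trans by (metis Suc_leD)
  qed
  from this[of n] show ?thesis
    by (simp add: z_def cong: restrict_cong)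
qed

lemma path_connected_sink_conf: "path_connected_space (sink_conf n G V)"
  unfolding path_connected_space_iff_path_component
proof (intro ballI)
  fix x y assume xy: "x \<in> topspace (sink_conf n G V)" "y \<in> topspace (sink_conf n G V)"
  have r: "rounding (x i) \<in> V" "rounding (y i) \<in> V" if "i < n" for i
    using rounding_in sink_conf_in[OF xy(1) that] sink_conf_in[OF xy(2) that] by blast+
  have "path_component_of (sink_conf n G V) x (\<lambda>i\<in>{..<n}. rounding (y i))"
    using path_component_of_trans[OF path_to_vertices[OF xy(1)] path_between_vertices[OF r]] .
  from path_component_of_trans[OF this path_component_of_sym[OF path_to_vertices[OF xy(2)]]]
  show "path_component_of (sink_conf n G V) x y" .
qed

lemma K_pi_1_sink_conf: "K_pi_1_space (sink_conf n G V)"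
  unfolding K_pi_1_space_def
proof (intro conjI allI impI ballI)
  obtain z where "z \<in> topspace G" using nonempty by blast
  then have "(\<lambda>i\<in>{..<n}. rounding z) \<in> topspace (sink_conf n G V)"
    by (intro vertex_conf rounding_in)
  then show "topspace (sink_conf n G V) \<noteq> {}" by blast
  show "path_connected_space (sink_conf n G V)" by (rule path_connected_sink_conf)
  fix k :: nat and x0 assume "2 \<le> k" "x0 \<in> topspace (sink_conf n G V)"
  then show "trivial_group (homotopy_group k (sink_conf n G V) x0)"
    by (intro trivial_homotopy_group null_homotopic_sink_conf)
qed

end

theorem theorem3p6:
  fixes G :: "'a topology" and V :: "'a set" and E :: "'a set set" and n :: nat
  assumes "CW_graph G V E"
  shows "K_pi_1_space (sink_conf n G V)"
proof -
  have "\<forall>e\<in>E. \<exists>\<phi>. characteristic_map G V e \<phi>"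
    using assms by (simp add: CW_graph_def CW_complex_1_def)
  then obtain \<phi> where "\<And>e. e \<in> E \<Longrightarrow> characteristic_map G V e (\<phi> e)" by metis
  with assms interpret cw_graph G V E \<phi> by unfold_locales
  show ?thesis by (rule K_pi_1_sink_conf)
qed

end
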